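(* Suppose that (i) there exists a $\mathbb{Q}$-algebra homomorphism $\varphi_{\mathcal{S}}:\mathcal{Z}^{\mathrm{cyc}}\to\mathcal{Z}/\zeta(2)\mathcal{Z}$ such that $\varphi_{\mathcal{S}}(Z(\mathbf{k}))=\zeta_{\mathcal{S}}(\mathbf{k})\bmod\zeta(2)\mathcal{Z}$ for every index $\mathbf{k}$, and (ii) $\ker\varphi_{\mathcal{S}}=\ker\varphi_{\mathcal{A}}$. Then there exists a $\mathbb{Q}$-algebra isomorphism $\varphi_{KZ}:\mathcal{Z}_{\mathcal{A}}\to\mathcal{Z}/\zeta(2)\mathcal{Z}$ such that $\varphi_{KZ}(\zeta_{\mathcal{A}}(\mathbf{k}))=\zeta_{\mathcal{S}}(\mathbf{k})\bmod\zeta(2)\mathcal{Z}$ for every index $\mathbf{k}$.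
   Context: Index: a tuple $\mathbf{k}=(k_1,\dots,k_r)$ of positive integers (possibly empty); it is admissible if empty or $k_1\ge2$. Real side: for admissible $\mathbf{k}$, $\zeta(\mathbf{k})=\sum_{m_1>\cdots>m_r>0}m_1^{-k_1}\cdots m_r^{-k_r}$ ($\zeta(\emptyset)=1$); $\mathcal{Z}\subset\mathbb{R}$ is the $\mathbb{Q}$-algebra spanned by all of them. Let $\mathfrak{H}^1=\mathbb{Q}\langle e_1,e_2,\ldots\rangle$ with $e_{\mathbf{k}}=e_{k_1}\cdots e_{k_r}$ and stuffle product $\ast$: $1\ast w=w\ast1=w$, $e_kw\ast e_{k'}w'=e_k(w\ast e_{k'}w')+e_{k'}(e_kw\ast w')+e_{k+k'}(w\ast w')$. Let $R:(\mathfrak{H}^1,\ast)\to\mathbb{R}[T]$ be the unique $\mathbb{Q}$-algebra homomorphism with $R(1)=1$, $R(e_1)=T$, $R(e_{\mathbf{k}})=\zeta(\mathbf{k})$ for admissible $\mathbf{k}$, and $R_{\mathbf{k}}(T)=R(e_{\mathbf{k}})$. Then $\zeta_{\mathcal{S}}(k_1,\dots,k_r)=\sum_{a=0}^r(-1)^{k_1+\cdots+k_a}R_{k_a,\ldots,k_1}(T)R_{k_{a+1},\ldots,k_r}(T)$, which does not depend on $T$ and lies in $\mathcal{Z}$. Finite side: $\mathcal{A}=(\prod_p\mathbb{F}_p)/(\bigoplus_p\mathbb{F}_p)$ ($p$ over all primes), $\zeta_{\mathcal{A}}(\mathbf{k})=\big(\sum_{p>m_1>\cdots>m_r>0}m_1^{-k_1}\cdots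 m_r^{-k_r}\bmod p\big)_p\in\mathcal{A}$, and $\mathcal{Z}_{\mathcal{A}}\subset\mathcal{A}$ is the $\mathbb{Q}$-subalgebra spanned over $\mathbb{Q}$ by all $\zeta_{\mathcal{A}}(\mathbf{k})$. Cyclotomic side: for each prime $p$ let $\zeta_p$ be a primitive $p$-th root of unity; $\mathcal{A}^{\mathrm{cyc}}=(\prod_p\mathbb{Z}[\zeta_p]/(p))/(\bigoplus_p\mathbb{Z}[\zeta_p]/(p))$, a $\mathbb{Q}$-algebra. With $[m]_q=\frac{1-q^m}{1-q}$ and $z_n(\mathbf{k};q)=\sum_{n>m_1>\cdots>m_r>0}\prod_jq^{(k_j-1)m_j}[m_j]_q^{-k_j}$ ($z_n(\emptyset;q)=1$), one has $z_p(\mathbf{k};\zeta_p)\in\mathbb{Z}[\zeta_p]$; put $Z(\mathbf{k})=(z_p(\mathbf{k};\zeta_p)\bmod(p))_p$. $\mathcal{Z}^{\mathrm{cyc}}\subset\mathcal{A}^{\mathrm{cyc}}$ is the $\mathbb{Q}$-span of all $Z(\mathbf{k})$, which is a $\mathbb{Q}$-subalgebra. The map $\varphi:\mathcal{A}^{\mathrm{cyc}}\to\mathcal{A}$, $(a_p\bmod(p))_p\mapsto(a_p\bmod(1-\zeta_p))_p$ (using $\mathbb{Z}[\zeta_p]/(1-\zeta_p)\simeq\mathbb{F}_p$), restricts to a surjective $\mathbb{Q}$-algebra homomorphism $\varphi_{\mathcal{A}}:\mathcal{Z}^{\mathrm{cyc}}\to\mathcal{Z}_{\mathcal{A}}$ with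 $\varphi_{\mathcal{A}}(Z(\mathbf{k}))=\zeta_{\mathcal{A}}(\mathbf{k})$. *)

theory Defs
  imports
    "HOL-Analysis.Infinite_Sum"
    "HOL-Library.Poly_Mapping"
    "HOL-Computational_Algebra.Polynomial"
    "HOL-Number_Theory.Residues"
    "HOL-Algebra.Module"
    "HOL-Algebra.QuotRing"
    "HOL-Algebra.Generated_Rings"
    "HOL-Algebra.Algebraic_Closure_Type"
begin

section \<open>Algebras over the rationals\<close>

text \<open>
  A \<open>\<rat>\<close>-algebra is a record of type \<open>(rat, 'a) module\<close>. A commutative ring in which every
  positive integer is invertible carries exactly one \<open>\<rat>\<close>-algebra structure, and \<open>rat_alg\<close> equips
  a ring with it: \<open>a/b\<close> acts as multiplication by \<open>(a \<cdot> 1) (b \<cdot> 1)\<^sup>-\<^sup>1\<close>.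
\<close>

definition rat_alg :: "'a ring \<Rightarrow> (rat, 'a) module" where
  "rat_alg R = ring.extend R
     \<lparr>module.smult = \<lambda>c x. case quotient_of c of (a, b) \<Rightarrow>
        ([a] \<cdot>\<^bsub>R\<^esub> \<one>\<^bsub>R\<^esub> \<otimes>\<^bsub>R\<^esub> inv\<^bsub>R\<^esub> ([b] \<cdot>\<^bsub>R\<^esub> \<one>\<^bsub>R\<^esub>)) \<otimes>\<^bsub>R\<^esub> x\<rparr>"

definition rat_span :: "(rat, 'a) module \<Rightarrow> 'a set \<Rightarrow> 'a set" where
  "rat_span M S = {\<Oplus>\<^bsub>M\<^esub>x\<in>F. c x \<odot>\<^bsub>M\<^esub> x | c F. finite F \<and> F \<subseteq> S}"

definition rat_alg_hom :: "(rat, 'a) module \<Rightarrow> (rat, 'b) module \<Rightarrow> ('a \<Rightarrow> 'b) set" where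
  "rat_alg_hom A B =
     {h \<in> ring_hom A B. \<forall>c. \<forall>x\<in>carrier A. h (c \<odot>\<^bsub>A\<^esub> x) = c \<odot>\<^bsub>B\<^esub> h x}"

definition rat_alg_iso :: "(rat, 'a) module \<Rightarrow> (rat, 'b) module \<Rightarrow> ('a \<Rightarrow> 'b) set" where
  "rat_alg_iso A B = {h \<in> rat_alg_hom A B. bij_betw h (carrier A) (carrier B)}"


section \<open>Indices\<close>

definition is_index :: "nat list \<Rightarrow> bool" where
  "is_index ks \<longleftrightarrow> (\<forall>k\<in>set ks. 0 < k)"

definition admissible :: "nat list \<Rightarrow> bool" where
  "admissible ks \<longleftrightarrow> is_index ks \<and> (ks = [] \<or> 2 \<le> hd ks)"

text \<open>The tuples \<open>m\<^sub>1 > \<dots> > m\<^sub>r\<close> with entries in \<open>S\<close>.\<close>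

definition decr_tuples :: "nat set \<Rightarrow> nat \<Rightarrow> nat list set" where
  "decr_tuples S r = {ms. length ms = r \<and> sorted_wrt (>) ms \<and> set ms \<subseteq> S}"


section \<open>Multiple zeta values and their symmetric counterparts\<close>

definition mzv :: "nat list \<Rightarrow> real" where
  "mzv ks = (\<Sum>\<^sub>\<infinity>ms\<in>decr_tuples {0<..} (length ks).
               \<Prod>j<length ks. inverse (real (ms ! j) ^ (ks ! j)))"

definition mzv_alg :: "(rat, real) module" where
  "mzv_alg = (let A = rat_alg ring_of_type_algebra in
     A\<lparr>carrier := rat_span A {mzv ks | ks. admissible ks}\<rparr>)"

definition zeta2_ideal :: "real set" where
  "zeta2_ideal = PIdl\<^bsub>mzv_alg\<^esub> (mzv [2])"

definition mzv_mod_zeta2 :: "(rat, real set) module" where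
  "mzv_mod_zeta2 = rat_alg (mzv_alg Quot zeta2_ideal)"

text \<open>
  The space \<open>\<rat>\<langle>e\<^sub>1, e\<^sub>2, \<dots>\<rangle>\<close>: the word \<open>e\<^bsub>k\<^sub>1\<^esub>\<cdots>e\<^bsub>k\<^sub>r\<^esub>\<close> is the list \<open>[k\<^sub>1, \<dots>, k\<^sub>r]\<close>, and an element
  is a finitely supported function from words to coefficients.
\<close>

definition word :: "nat list \<Rightarrow> (nat list \<Rightarrow>\<^sub>0 rat)" where
  "word ks = Poly_Mapping.single ks 1"

definition scale :: "rat \<Rightarrow> (nat list \<Rightarrow>\<^sub>0 rat) \<Rightarrow> (nat list \<Rightarrow>\<^sub>0 rat)" where
  "scale c f = Poly_Mapping.map (\<lambda>x. c * x) f"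

definition prepend :: "nat \<Rightarrow> (nat list \<Rightarrow>\<^sub>0 rat) \<Rightarrow> (nat list \<Rightarrow>\<^sub>0 rat)" where
  "prepend k f = (\<Sum>w\<in>Poly_Mapping.keys f. scale (Poly_Mapping.lookup f w) (word (k # w)))"

fun stuffle_words :: "nat list \<Rightarrow> nat list \<Rightarrow> (nat list \<Rightarrow>\<^sub>0 rat)" where
  "stuffle_words [] w = word w"
| "stuffle_words w [] = word w"
| "stuffle_words (k # w) (k' # w') =
     prepend k (stuffle_words w (k' # w')) + prepend k' (stuffle_words (k # w) w')
       + prepend (k + k') (stuffle_words w w')"

definition stuffle ::
    "(nat list \<Rightarrow>\<^sub>0 rat) \<Rightarrow> (nat list \<Rightarrow>\<^sub>0 rat) \<Rightarrow> (nat list \<Rightarrow>\<^sub>0 rat)" where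
  "stuffle f g = (\<Sum>u\<in>Poly_Mapping.keys f. \<Sum>v\<in>Poly_Mapping.keys g.
     scale (Poly_Mapping.lookup f u * Poly_Mapping.lookup g v) (stuffle_words u v))"

definition stuffle_alg :: "(rat, nat list \<Rightarrow>\<^sub>0 rat) module" where
  "stuffle_alg = \<lparr>carrier = {f. \<forall>w\<in>Poly_Mapping.keys f. is_index w},
     monoid.mult = stuffle, one = word [], zero = 0, add = (+), module.smult = scale\<rparr>"

text \<open>
  The regularization homomorphism \<open>R\<close> into \<open>\<real>[T]\<close>. The algebraic conditions say nothing about words
  containing the letter \<open>0\<close>; extensionality fixes \<open>R\<close> there, so that the description is definite.
\<close>

definition regularization :: "(nat list \<Rightarrow>\<^sub>0 rat) \<Rightarrow> real poly" where
  "regularization = (THE R.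
     R \<in> extensional (carrier stuffle_alg) \<and>
     R \<in> rat_alg_hom stuffle_alg (rat_alg ring_of_type_algebra) \<and>
     R (word [1]) = [:0, 1:] \<and>
     (\<forall>ks. admissible ks \<longrightarrow> R (word ks) = [:mzv ks:]))"

definition reg_mzv :: "nat list \<Rightarrow> real poly" where
  "reg_mzv ks = regularization (word ks)"

text \<open>
  The defining sum of \<open>\<zeta>\<^sub>S\<close> is a constant polynomial in \<open>T\<close>; the real number is that constant.
\<close>

definition zeta_S :: "nat list \<Rightarrow> real" where
  "zeta_S ks = (THE c. [:c:] = (\<Sum>a\<le>length ks.
     (-1) ^ sum_list (take a ks) * reg_mzv (rev (take a ks)) * reg_mzv (drop a ks)))"

definition zeta_S_mod :: "nat list \<Rightarrow> real set" where
  "zeta_S_mod ks = zeta2_ideal +>\<^bsub>mzv_alg\<^esub> zeta_S ks"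


section \<open>Families over the primes modulo finitely many primes\<close>

definition primes :: "nat set" where
  "primes = {p. Factorial_Ring.prime p}"

definition prime_prod :: "(nat \<Rightarrow> 'a ring) \<Rightarrow> (nat \<Rightarrow> 'a) ring" where
  "prime_prod R = \<lparr>carrier = (\<Pi>\<^sub>E p\<in>primes. carrier (R p)),
     monoid.mult = (\<lambda>f g. \<lambda>p\<in>primes. f p \<otimes>\<^bsub>R p\<^esub> g p), one = (\<lambda>p\<in>primes. \<one>\<^bsub>R p\<^esub>),
     zero = (\<lambda>p\<in>primes. \<zero>\<^bsub>R p\<^esub>), add = (\<lambda>f g. \<lambda>p\<in>primes. f p \<oplus>\<^bsub>R p\<^esub> g p)\<rparr>"

definition prime_sum :: "(nat \<Rightarrow> 'a ring) \<Rightarrow> (nat \<Rightarrow> 'a) set" where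
  "prime_sum R = {f \<in> carrier (prime_prod R). finite {p \<in> primes. f p \<noteq> \<zero>\<^bsub>R p\<^esub>}}"

definition prime_alg :: "(nat \<Rightarrow> 'a ring) \<Rightarrow> (rat, (nat \<Rightarrow> 'a) set) module" where
  "prime_alg R = rat_alg (prime_prod R Quot prime_sum R)"

definition prime_class :: "(nat \<Rightarrow> 'a ring) \<Rightarrow> (nat \<Rightarrow> 'a) \<Rightarrow> (nat \<Rightarrow> 'a) set" where
  "prime_class R f = prime_sum R +>\<^bsub>prime_prod R\<^esub> (\<lambda>p\<in>primes. f p)"


section \<open>Finite multiple zeta values\<close>

definition Fp :: "nat \<Rightarrow> int ring" where
  "Fp p = residue_ring (int p)"

definition zeta_A :: "nat list \<Rightarrow> (nat \<Rightarrow> int) set" where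
  "zeta_A ks = prime_class Fp (\<lambda>p.
     \<Oplus>\<^bsub>Fp p\<^esub>ms\<in>decr_tuples {0<..<p} (length ks).
       \<Otimes>\<^bsub>Fp p\<^esub>j\<in>{..<length ks}. (inv\<^bsub>Fp p\<^esub> (int (ms ! j))) [^]\<^bsub>Fp p\<^esub> (ks ! j))"

definition finite_mzv_alg :: "(rat, (nat \<Rightarrow> int) set) module" where
  "finite_mzv_alg =
     (prime_alg Fp)\<lparr>carrier := rat_span (prime_alg Fp) {zeta_A ks | ks. is_index ks}\<rparr>"


section \<open>Values at roots of unity\<close>

definition primitive_root_of_unity :: "nat \<Rightarrow> complex \<Rightarrow> bool" where
  "primitive_root_of_unity n z \<longleftrightarrow> 0 < n \<and> z ^ n = 1 \<and> (\<forall>k. 0 < k \<and> k < n \<longrightarrow> z ^ k \<noteq> 1)"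

definition cyc_ring :: "complex \<Rightarrow> complex ring" where
  "cyc_ring z = ring_of_type_algebra\<lparr>carrier := generate_ring ring_of_type_algebra {z}\<rparr>"

definition cyc_mod_p :: "(nat \<Rightarrow> complex) \<Rightarrow> nat \<Rightarrow> complex set ring" where
  "cyc_mod_p \<zeta> p = cyc_ring (\<zeta> p) Quot (PIdl\<^bsub>cyc_ring (\<zeta> p)\<^esub> (of_nat p))"

definition qint :: "complex \<Rightarrow> nat \<Rightarrow> complex" where
  "qint q m = (1 - q ^ m) / (1 - q)"

definition qmzv :: "nat \<Rightarrow> nat list \<Rightarrow> complex \<Rightarrow> complex" where
  "qmzv n ks q = (\<Sum>ms\<in>decr_tuples {0<..<n} (length ks).
     \<Prod>j<length ks. q ^ ((ks ! j - 1) * ms ! j) / qint q (ms ! j) ^ (ks ! j))"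

definition Z_cyc :: "(nat \<Rightarrow> complex) \<Rightarrow> nat list \<Rightarrow> (nat \<Rightarrow> complex set) set" where
  "Z_cyc \<zeta> ks = prime_class (cyc_mod_p \<zeta>) (\<lambda>p.
     (PIdl\<^bsub>cyc_ring (\<zeta> p)\<^esub> (of_nat p)) +>\<^bsub>cyc_ring (\<zeta> p)\<^esub> qmzv p ks (\<zeta> p))"

definition cyc_mzv_alg ::
    "(nat \<Rightarrow> complex) \<Rightarrow> (rat, (nat \<Rightarrow> complex set) set) module" where
  "cyc_mzv_alg \<zeta> = (prime_alg (cyc_mod_p \<zeta>))
     \<lparr>carrier := rat_span (prime_alg (cyc_mod_p \<zeta>)) {Z_cyc \<zeta> ks | ks. is_index ks}\<rparr>"

text \<open>
  \<open>cyc_residue z p a\<close> is the image of \<open>a \<in> \<int>[z]\<close> in the prime field: the residue class that the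
  canonical isomorphism from the prime field to \<open>\<int>[z]/(1 - z)\<close> sends to \<open>a mod (1 - z)\<close>.
\<close>

definition cyc_residue :: "complex \<Rightarrow> nat \<Rightarrow> complex \<Rightarrow> int" where
  "cyc_residue z p a = (THE c. c \<in> carrier (Fp p) \<and>
     (PIdl\<^bsub>cyc_ring z\<^esub> (1 - z)) +>\<^bsub>cyc_ring z\<^esub> of_int c =
     (PIdl\<^bsub>cyc_ring z\<^esub> (1 - z)) +>\<^bsub>cyc_ring z\<^esub> a)"

text \<open>
  The map \<open>phi \<zeta>\<close> is \<open>(a\<^sub>p mod (p))\<^sub>p \<mapsto> (a\<^sub>p mod (1 - \<zeta>\<^sub>p))\<^sub>p\<close>. Elements of both algebras are classes of
  families, and on the cyclotomic side each member of a family is itself a class. The two uses of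
  \<open>the_elem\<close> select the common value of the map on all representatives.
\<close>

definition phi ::
    "(nat \<Rightarrow> complex) \<Rightarrow> (nat \<Rightarrow> complex set) set \<Rightarrow> (nat \<Rightarrow> int) set" where
  "phi \<zeta> x = the_elem
     ((\<lambda>u. prime_class Fp (\<lambda>p. the_elem (cyc_residue (\<zeta> p) p ` u p))) ` x)"

definition phi_A ::
    "(nat \<Rightarrow> complex) \<Rightarrow> (nat \<Rightarrow> complex set) set \<Rightarrow> (nat \<Rightarrow> int) set" where
  "phi_A \<zeta> = restrict (phi \<zeta>) (carrier (cyc_mzv_alg \<zeta>))"

end

theory Submission
  imports Defs "HOL-Library.Function_Algebras" "HOL-Real_Asymp.Real_Asymp" "HOL-Analysis.Harmonic_Numbers"
    "HOL-Analysis.Complex_Transcendental"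
begin

text \<open>
  The kernels of \<open>phi_A\<close> and \<open>phi_S\<close> agree, so both targets are the quotient of the cyclotomic algebra
  by the same ideal as soon as both maps are onto. For \<open>phi_A\<close> this is clear. It is a ring
  homomorphism on a ring: \<open>Z(u) Z(v)\<close> is given by a quasi-shuffle product with extra terms
  \<open>(1 - \<zeta>\<^sub>p) Z(w)\<close>, and these lie in the span of the values, since \<open>Z(1) \<equiv> - (1 - \<zeta>\<^sub>p) / 2\<close> modulo \<open>p\<close>.

  For \<open>phi_S\<close>, surjectivity is Yasuda's theorem that the symmetric multiple zeta values span the
  space of all multiple zeta values. The stuffle and the shuffle regularization differ only by products
  with values of lower weight, so by induction on the weight one may work modulo products, where the
  shuffle regularized values are controlled by the shuffle relations, the duality relations (obtained
  from multiple polylogarithms on \<open>(0, 1)\<close>), and the relations that the symmetric values impose.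
\<close>

text \<open>Both regularizations are realized analytically, as the polynomials in the asymptotic
  expansions of truncated sums in the harmonic number and of polylogarithms in
  \<open>- ln (1 - z)\<close>. Identities between functions pass to the polynomials because such
  expansions are unique. The symmetric sum at level n is itself an iterated sum, over the points 1/m
  and -1/m, so the symmetric values inherit the stuffle product in the limit; this makes their span
  a ring and puts the products of lower values into it. The two expansions belong to different
  variables. Abel means carry one to the other, but control only constant terms modulo products, and
  words made of ones alone escape the comparison; for these the stuffle product with 1 is used.
  Words ending in \<open>False\<close> have no polylogarithm, so the functional on words has to be
  extended to them before duality and rotation can act. A rational linear functional that separates
  a value from the span replaces congruences by equations between real numbers.\<close>

lemma is_index_simps [simp]:
  "is_index []" "is_index (k # ks) \<longleftrightarrow> 0 < k \<and> is_index ks"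
  "is_index (u @ v) \<longleftrightarrow> is_index u \<and> is_index v" "is_index (rev u) \<longleftrightarrow> is_index u"
  by (auto simp: is_index_def)

lemma is_index_replicate [simp]: "0 < k \<Longrightarrow> is_index (replicate n k)"
  by (auto simp: is_index_def)

lemma is_index_take [simp]: "is_index u \<Longrightarrow> is_index (take n u)"
  by (auto simp: is_index_def dest: in_set_takeD)

lemma is_index_drop [simp]: "is_index u \<Longrightarrow> is_index (drop n u)"
  by (auto simp: is_index_def dest: in_set_dropD)

section \<open>Iterated sums and quasi-shuffle products\<close>

text \<open>Harmonic sums, symmetric sums and the sums at roots of unity differ only in the term
  \<open>F\<close> and in the list of points. The points are listed in the order of m_1, m_2, ...,
  so the head is either skipped or serves the first exponent.\<close>

fun iter_sum :: "(nat \<Rightarrow> 'x \<Rightarrow> 'a::comm_ring_1) \<Rightarrow> 'x list \<Rightarrow> nat list \<Rightarrow> 'a" where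
  "iter_sum F xs [] = 1"
| "iter_sum F [] (k # ks) = 0"
| "iter_sum F (x # xs) (k # ks) = iter_sum F xs (k # ks) + F k x * iter_sum F xs ks"

text \<open>
  \<open>quasi T f u v\<close> is the value on the quasi-shuffle product of the words \<open>u\<close> and \<open>v\<close> of the additive
  extension of \<open>f\<close>. The stuffle product is the case \<open>T = 0\<close>; the term with \<open>T\<close> accounts for
  \<open>q\<^bsup>(k-1)m\<^esup>[m]\<^sup>-\<^sup>k \<cdot> q\<^bsup>(l-1)m\<^esup>[m]\<^sup>-\<^sup>l\<close>, where \<open>T\<close> is multiplication by \<open>1 - q\<close>.
\<close>

fun quasi :: "('v \<Rightarrow> 'v::comm_monoid_add) \<Rightarrow> (nat list \<Rightarrow> 'v) \<Rightarrow> nat list \<Rightarrow> nat list \<Rightarrow> 'v" where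
  "quasi T f [] v = f v"
| "quasi T f (k # u) [] = f (k # u)"
| "quasi T f (k # u) (l # v) =
     quasi T (\<lambda>w. f (k # w)) u (l # v) + quasi T (\<lambda>w. f (l # w)) (k # u) v
     + quasi T (\<lambda>w. f ((k + l) # w) + T (f ((k + l - 1) # w))) u v"

abbreviation stuf :: "(nat list \<Rightarrow> 'v::comm_monoid_add) \<Rightarrow> nat list \<Rightarrow> nat list \<Rightarrow> 'v" where
  "stuf \<equiv> quasi (\<lambda>_. 0)"

lemma quasi_Nil2 [simp]: "quasi T f u [] = f u"
  by (cases u) auto

lemma quasi_closed:
  assumes "\<And>x y. x \<in> A \<Longrightarrow> y \<in> A \<Longrightarrow> x + y \<in> A" and "\<And>x. x \<in> A \<Longrightarrow> T x \<in> A"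
    and "is_index u" "is_index v" and "\<And>w. is_index w \<Longrightarrow> f w \<in> A"
  shows "quasi T f u v \<in> A"
  using assms by (induction T f u v rule: quasi.induct) (auto simp del: One_nat_def)

text \<open>Without the \<open>T\<close> term every word of the product has weight
  \<open>sum_list u + sum_list v\<close>, so \<open>f\<close> has to be controlled in that weight
  alone. The inductions on the weight rest on this.\<close>

lemma stuf_closed:
  assumes "\<And>x y. x \<in> A \<Longrightarrow> y \<in> A \<Longrightarrow> x + y \<in> A" and "is_index u" "is_index v"
    and "\<And>w. is_index w \<Longrightarrow> sum_list w = sum_list u + sum_list v \<Longrightarrow> f w \<in> A"
  shows "stuf f u v \<in> A"
  using assms(2-)
proof (induction "\<lambda>_::'a. 0::'a" f u v rule: quasi.induct)
  case (3 f k u l v)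
  have "stuf (\<lambda>w. f (k # w)) u (l # v) \<in> A"
    using 3(4,5) by (intro 3(1)) (auto intro!: 3(6))
  moreover have "stuf (\<lambda>w. f (l # w)) (k # u) v \<in> A"
    using 3(4,5) by (intro 3(2)) (auto intro!: 3(6))
  moreover have "stuf (\<lambda>w. f ((k + l) # w) + 0) u v \<in> A"
    using 3(4,5) by (intro 3(3)) (auto intro!: 3(6))
  ultimately show ?case by (auto intro!: assms(1))
qed auto

text \<open>Besides evaluation at a point this is applied to \<open>fst\<close> and
  \<open>snd\<close>: a pair-valued \<open>f\<close> lets a closure lemma prove a relation between
  two functionals at once.\<close>

lemma quasi_hom:
  assumes "\<And>x y. h (x + y) = h x + h y" and "\<And>x. h (T x) = T' (h x)"
  shows "h (quasi T f u v) = quasi T' (\<lambda>w. h (f w)) u v"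
  using assms by (induction T f u v rule: quasi.induct) (simp_all del: One_nat_def)

lemma quasi_add:
  assumes "\<And>x y. T (x + y) = T x + T y"
  shows "quasi T (\<lambda>w. f w + g w) u v = quasi T f u v + quasi T g u v"
proof (induction u arbitrary: v f g)
  case (Cons k u)
  note IHu = Cons.IH
  show ?case
  proof (induction v arbitrary: f g)
    case (Cons l v)
    have "quasi T (\<lambda>w. f ((k + l) # w) + g ((k + l) # w)
            + T (f ((k + l - 1) # w) + g ((k + l - 1) # w))) u v =
          quasi T (\<lambda>w. (f ((k + l) # w) + T (f ((k + l - 1) # w)))
            + (g ((k + l) # w) + T (g ((k + l - 1) # w)))) u v"
      by (simp add: assms add_ac)
    then show ?case by (simp only: quasi.simps IHu Cons.IH add_ac)
  qed simp
qed simp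

text \<open>When 1 meets a letter l, the \<open>T\<close> term carries the letter 1 + l - 1 = l and
  gives back \<open>w\<close> itself, once for each letter of \<open>w\<close>.\<close>

lemma quasi_1:
  "quasi T f [1] w = stuf f [1] w + (\<Sum>i<length w. T (f w))"
proof (induction w arbitrary: f)
  case (Cons l w)
  show ?case using Cons.IH[of "\<lambda>w. f (l # w)"] by (simp add: add_ac)
qed simp

text \<open>Induction on the points. Each factor either skips the head \<open>x\<close> or uses it;
  when both use it, the hypothesis on \<open>F\<close> merges the two terms into the third summand
  of \<open>quasi\<close>.\<close>

lemma iter_sum_mult:
  assumes "\<And>x k l. x \<in> set xs \<Longrightarrow> 0 < k \<Longrightarrow> 0 < l \<Longrightarrow> F k x * F l x = F (k + l) x + c * F (k + l - 1) x"
    and "is_index u" "is_index v"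
  shows "iter_sum F xs u * iter_sum F xs v = quasi (\<lambda>y. c * y) (iter_sum F xs) u v"
  using assms
proof (induction xs arbitrary: u v)
  case Nil
  have zero: "quasi (\<lambda>y. c * y) (\<lambda>_. 0) u v = 0" for u v
    by (induction "\<lambda>y. c * y" "\<lambda>_::nat list. 0 :: 'b" u v rule: quasi.induct) auto
  show ?case by (cases u; cases v) (auto simp: zero)
next
  case (Cons x xs)
  have lin: "quasi (\<lambda>y. c * y) (\<lambda>w. f w + a * g w) u v
      = quasi (\<lambda>y. c * y) f u v + a * quasi (\<lambda>y. c * y) g u v" for f g a u v
    using quasi_add[of "\<lambda>y. c * y" f "\<lambda>w. a * g w" u v]
      quasi_hom[of "\<lambda>y. a * y" "\<lambda>y. c * y" "\<lambda>y. c * y" g u v]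
    by (simp add: distrib_left mult.left_commute)
  show ?case
  proof (cases u; cases v)
    fix k u' l v' assume u: "u = k # u'" and v: "v = l # v'"
    let ?J = "iter_sum F xs"
    define q where "q = quasi (\<lambda>y. c * y)"
    have q_Cons: "q f (k # u) (l # v) = q (\<lambda>w. f (k # w)) u (l # v) + q (\<lambda>w. f (l # w)) (k # u) v
        + q (\<lambda>w. f ((k + l) # w) + c * f ((k + l - 1) # w)) u v" for f k u l v
      by (simp add: q_def)
    have IH: "q ?J u v = ?J u * ?J v" if "is_index u" "is_index v" for u v
      unfolding q_def using that Cons.prems(1) by (intro Cons.IH[symmetric]) auto
    note lin = lin[folded q_def]
    have F: "F k x * F l x = F (k + l) x + c * F (k + l - 1) x"
      using Cons.prems u v by simp
    have "q (iter_sum F (x # xs)) u v =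
        q (\<lambda>w. ?J (k # w) + F k x * ?J w) u' (l # v') + q (\<lambda>w. ?J (l # w) + F l x * ?J w) (k # u') v'
        + q (\<lambda>w. (?J ((k + l) # w) + c * ?J ((k + l - 1) # w))
              + (F (k + l) x + c * F (k + l - 1) x) * ?J w) u' v'"
      by (simp add: u v q_Cons algebra_simps del: One_nat_def)
    also have "\<dots> = q ?J u v + F k x * q ?J u' v + F l x * q ?J u v' + (F k x * F l x) * q ?J u' v'"
      unfolding lin F u v q_Cons by (simp only: algebra_simps)
    also have "\<dots> = iter_sum F (x # xs) u * iter_sum F (x # xs) v"
      using Cons.prems(2,3) by (simp add: IH u v) (simp add: algebra_simps)
    finally show ?thesis by (simp add: q_def)
  qed auto
qed

text \<open>The points of \<open>xs\<close> precede those of \<open>ys\<close>, so they serve an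
  initial segment of the exponents; \<open>a\<close> is its length.\<close>

lemma iter_sum_append:
  "iter_sum F (xs @ ys) ks = (\<Sum>a\<le>length ks. iter_sum F xs (take a ks) * iter_sum F ys (drop a ks))"
proof (induction xs arbitrary: ks)
  case Nil
  have "iter_sum F [] (take a ks) = (if a = 0 then 1 else 0)" if "a \<le> length ks" for a
    using that by (cases ks; cases a) auto
  then have "(\<Sum>a\<le>length ks. iter_sum F [] (take a ks) * iter_sum F ys (drop a ks))
    = (\<Sum>a\<le>length ks. if a = 0 then iter_sum F ys ks else 0)"
    by (intro sum.cong) auto
  then show ?case by simp
next
  case (Cons x xs)
  show ?case
  proof (cases ks)
    case (Cons k ks')
    show ?thesis
      unfolding Cons
      by (simp add: Cons.IH sum.atMost_Suc_shift sum_distrib_left sum.distrib algebra_simps del: sum.atMost_Suc)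
  qed simp
qed

lemma iter_sum_Nil: "iter_sum F [] ks = (if ks = [] then 1 else 0)"
  by (cases ks) auto

lemma iter_sum_snoc:
  "iter_sum F (xs @ [x]) (ks @ [k]) = iter_sum F xs (ks @ [k]) + F k x * iter_sum F xs ks"
proof (induction xs arbitrary: ks)
  case Nil
  show ?case by (cases ks) (auto simp: iter_sum_Nil)
next
  case (Cons y xs)
  show ?case
  proof (cases ks)
    case Nil
    then show ?thesis using Cons.IH[of "[]"] by simp
  next
    case (Cons l ls)
    then show ?thesis
      using Cons.IH[of ks] Cons.IH[of ls] by (simp add: distrib_left mult.left_commute add_ac)
  qed
qed

lemma iter_sum_rev: "iter_sum F (rev xs) (rev ks) = iter_sum F xs ks"
proof (induction F xs ks rule: iter_sum.induct)
  case (2 F k ks)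
  show ?case by (simp add: iter_sum_Nil)
qed (auto simp: iter_sum_snoc)

lemma iter_sum_cong:
  assumes "\<And>k x. k \<in> set ks \<Longrightarrow> x \<in> set xs \<Longrightarrow> F k x = G k x"
  shows "iter_sum F xs ks = iter_sum G xs ks"
  using assms by (induction F xs ks rule: iter_sum.induct) auto

lemma iter_sum_map: "iter_sum F (map g xs) ks = iter_sum (\<lambda>k x. F k (g x)) xs ks"
  by (induction F "map g xs" ks arbitrary: xs rule: iter_sum.induct) auto

lemma iter_sum_sign:
  "iter_sum (\<lambda>k x. (- 1) ^ k * F k x) xs ks = (- 1) ^ sum_list ks * iter_sum F xs ks"
  by (induction F xs ks rule: iter_sum.induct) (auto simp: algebra_simps power_add)

section \<open>Iterated sums as sums over strictly decreasing tuples\<close>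

lemma decr_tuples_Nil: "decr_tuples S 0 = {[]}"
  by (auto simp: decr_tuples_def)

lemma decr_tuples_Cons:
  assumes "\<And>y. y \<in> S \<Longrightarrow> y < x"
  shows "decr_tuples (insert x S) (Suc r) = decr_tuples S (Suc r) \<union> (#) x ` decr_tuples S r"
proof (intro equalityI subsetI)
  fix ms assume "ms \<in> decr_tuples (insert x S) (Suc r)"
  then obtain m ms' where ms: "ms = m # ms'" "length ms' = r" "\<forall>y\<in>set ms'. y < m" "sorted_wrt (>) ms'"
      "set ms' \<subseteq> insert x S" "m \<in> insert x S"
    by (auto simp: decr_tuples_def length_Suc_conv)
  have "set ms' \<subseteq> S"
  proof
    fix y assume "y \<in> set ms'"
    then show "y \<in> S" using ms assms by (metis insertE not_less_iff_gr_or_eq subsetD)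
  qed
  then show "ms \<in> decr_tuples S (Suc r) \<union> (#) x ` decr_tuples S r"
    using ms by (auto simp: decr_tuples_def)
qed (use assms in \<open>fastforce simp: decr_tuples_def\<close>)

lemma finite_decr_tuples: "finite S \<Longrightarrow> finite (decr_tuples S r)"
  by (rule finite_subset[OF _ finite_lists_length_eq[of S r]]) (auto simp: decr_tuples_def)

lemma iter_sum_eq_sum_decr_tuples:
  assumes "sorted_wrt (>) xs"
  shows "iter_sum F xs ks = (\<Sum>ms\<in>decr_tuples (set xs) (length ks). \<Prod>j<length ks. F (ks ! j) (ms ! j))"
  using assms
proof (induction F xs ks rule: iter_sum.induct)
  case (2 F k ks)
  have "decr_tuples {} (Suc (length ks)) = {}" by (auto simp: decr_tuples_def)
  then show ?case by simp
next
  case (3 F x xs k ks)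
  have disj: "decr_tuples (set xs) (Suc (length ks)) \<inter> (#) x ` decr_tuples (set xs) (length ks) = {}"
    using 3(3) by (auto simp: decr_tuples_def)
  have "(\<Sum>ms\<in>decr_tuples (set (x # xs)) (length (k # ks)). \<Prod>j<length (k # ks). F ((k # ks) ! j) (ms ! j))
      = (\<Sum>ms\<in>decr_tuples (set xs) (Suc (length ks)). \<Prod>j<length (k # ks). F ((k # ks) ! j) (ms ! j))
      + (\<Sum>ms\<in>(#) x ` decr_tuples (set xs) (length ks). \<Prod>j<length (k # ks). F ((k # ks) ! j) (ms ! j))"
    using 3(3) disj by (simp add: decr_tuples_Cons sum.union_disjoint finite_decr_tuples)
  also have "\<dots> = iter_sum F xs (k # ks) + F k x * iter_sum F xs ks"
    using 3 by (simp add: sum.reindex prod.lessThan_Suc_shift sum_distrib_left del: prod.lessThan_Suc)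
  finally show ?case by simp
qed (simp add: decr_tuples_Nil)

section \<open>Leading ones in the stuffle algebra\<close>

text \<open>Among the leading ones the new 1 has a + 1 places, all giving the same word; in every
  other term it is merged with a letter or lies to the right of the first letter of
  \<open>w\<close>, and at most a + j ones lead. The ones already passed by the recursion are
  counted by \<open>j\<close>. The multiple by a + 1 is written as a sum because the values lie in a
  mere abelian group.\<close>

lemma stuf_1_replicate:
  assumes A: "0 \<in> A" "\<And>x y. x \<in> A \<Longrightarrow> y \<in> A \<Longrightarrow> x + y \<in> A"
    and "admissible w"
    and "\<And>b v. b \<le> a + j \<Longrightarrow> admissible v \<Longrightarrow> b + sum_list v = Suc (a + j + sum_list w)
      \<Longrightarrow> f (replicate b 1 @ v) \<in> A"
  shows "stuf (\<lambda>v. f (replicate j 1 @ v)) [1] (replicate a 1 @ w)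
     - (\<Sum>i\<le>a. f (replicate (Suc (a + j)) 1 @ w)) \<in> (A :: 'a::ab_group_add set)"
  using assms(4)
proof (induction a arbitrary: j)
  case 0
  show ?case
  proof (cases w)
    case Nil
    then show ?thesis using A(1) by (simp add: replicate_append_same)
  next
    case (Cons k v)
    then have k: "2 \<le> k" "is_index v" using assms(3) by (auto simp: admissible_def)
    have "stuf (\<lambda>w. f (replicate j 1 @ k # w)) [1] v \<in> A"
      using k Cons by (intro stuf_closed A 0) (auto simp: admissible_def)
    moreover have "f (replicate j 1 @ Suc k # v) \<in> A"
      using k Cons by (intro 0) (auto simp: admissible_def)
    moreover have "f (replicate j 1 @ 1 # k # v) = f (replicate (Suc j) 1 @ k # v)"
      by (simp flip: replicate_append_same)
    ultimately show ?thesis using A Cons by simp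
  qed
next
  case (Suc a)
  have w: "is_index w" using assms(3) by (auto simp: admissible_def)
  have "stuf (\<lambda>v. f (replicate (Suc j) 1 @ v)) [1] (replicate a 1 @ w)
     - (\<Sum>i\<le>a. f (replicate (Suc (a + Suc j)) 1 @ w)) \<in> A"
    by (intro Suc.IH Suc.prems) auto
  moreover have "(\<lambda>v. f (replicate (Suc j) 1 @ v)) = (\<lambda>v. f (replicate j 1 @ 1 # v))"
    by (simp flip: replicate_append_same)
  moreover have "f (replicate j 1 @ 2 # replicate a 1 @ w) \<in> A"
    using w by (intro Suc.prems) (auto simp: admissible_def sum_list_replicate)
  moreover have "f (replicate j 1 @ 1 # 1 # replicate a 1 @ w) = f (replicate (Suc (Suc a + j)) 1 @ w)"
  proof -
    have "replicate j 1 @ 1 # 1 # replicate a (1::nat) = replicate (Suc (Suc a + j)) 1"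
      by (metis add.commute add_Suc add_Suc_right replicate_Suc replicate_add)
    then show ?thesis by (metis append.assoc append_Cons)
  qed
  moreover have "stuf (\<lambda>v. f (replicate j 1 @ v)) [1] (replicate (Suc a) 1 @ w)
      = f (replicate j 1 @ 1 # 1 # replicate a 1 @ w)
        + stuf (\<lambda>v. f (replicate j 1 @ 1 # v)) [1] (replicate a 1 @ w) + f (replicate j 1 @ 2 # replicate a 1 @ w)"
    by (simp add: numeral_2_eq_2)
  ultimately have "f (replicate j 1 @ 2 # replicate a 1 @ w)
      + (stuf (\<lambda>v. f (replicate j 1 @ 1 # v)) [1] (replicate a 1 @ w)
         - (\<Sum>i\<le>a. f (replicate (Suc (Suc a + j)) 1 @ w))) \<in> A"
    and "stuf (\<lambda>v. f (replicate j 1 @ v)) [1] (replicate (Suc a) 1 @ w)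
      = f (replicate (Suc (Suc a + j)) 1 @ w)
        + stuf (\<lambda>v. f (replicate j 1 @ 1 # v)) [1] (replicate a 1 @ w) + f (replicate j 1 @ 2 # replicate a 1 @ w)"
    by (auto intro!: A(2) simp: numeral_2_eq_2)
  then show ?case by (simp add: algebra_simps del: replicate_Suc)
qed

text \<open>
  The stuffle algebra is generated over the admissible words by the word \<open>1\<close>, because
  \<open>1 * 1\<^sup>a w\<close> is \<open>(a + 1) 1\<^bsup>a+1\<^esup> w\<close> up to words with at most \<open>a\<close> leading ones.
\<close>

lemma index_decompose:
  assumes "is_index ks"
  obtains a w where "ks = replicate a 1 @ w" "admissible w"
  using assms
proof (induction ks arbitrary: thesis)
  case (Cons k ks)
  then obtain a w where aw: "ks = replicate a 1 @ w" "admissible w" by auto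
  show ?case
  proof (cases "k = 1")
    case True
    then show ?thesis using Cons.prems(1)[of "Suc a" w] aw by simp
  next
    case False
    then show ?thesis using Cons.prems Cons.prems(1)[of 0 "k # ks"] by (auto simp: admissible_def)
  qed
qed (auto simp: admissible_def)

text \<open>Induction on the number of leading ones: \<open>step\<close> puts the product with 1
  into \<open>A\<close>, the remaining words have fewer leading ones, and \<open>divide\<close>
  removes the multiplicity.\<close>

lemma stuf_induct:
  fixes f :: "nat list \<Rightarrow> 'a::ab_group_add"
  assumes A: "0 \<in> A" "\<And>x y. x \<in> A \<Longrightarrow> y \<in> A \<Longrightarrow> x + y \<in> A" "\<And>x y. x \<in> A \<Longrightarrow> y \<in> A \<Longrightarrow> x - y \<in> A"
    and divide: "\<And>n x. (\<Sum>i\<le>(n::nat). x) \<in> A \<Longrightarrow> x \<in> A"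
    and adm: "\<And>w. admissible w \<Longrightarrow> f w \<in> A"
    and step: "\<And>w. is_index w \<Longrightarrow> f w \<in> A \<Longrightarrow> stuf f [1] w \<in> A"
    and "is_index w"
  shows "f w \<in> A"
proof -
  have *: "f (replicate a 1 @ v) \<in> A" if "admissible v" for a v
    using that
  proof (induction a arbitrary: v rule: less_induct)
    case (less a)
    show ?case
    proof (cases a)
      case 0
      then show ?thesis using adm less.prems by simp
    next
      case (Suc b)
      have v: "is_index v" using less.prems by (auto simp: admissible_def)
      have 1: "stuf (\<lambda>v. f (replicate 0 1 @ v)) [1] (replicate b 1 @ v)
         - (\<Sum>i\<le>b. f (replicate (Suc (b + 0)) 1 @ v)) \<in> A"
        using less Suc by (intro stuf_1_replicate A) auto
      have "stuf f [1] (replicate b 1 @ v) \<in> A"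
        using less Suc v by (intro step) auto
      from A(3)[OF this 1] have "(\<Sum>i\<le>b. f (replicate a 1 @ v)) \<in> A" by (simp add: Suc)
      then show ?thesis by (rule divide)
    qed
  qed
  from assms(7) show ?thesis by (rule index_decompose) (use * in auto)
qed

section \<open>Asymptotic polynomials\<close>

text \<open>The error must beat every power of \<open>t\<close>, because in a product it is
  multiplied by the polynomial of the other factor.\<close>

definition asymp_poly :: "'a filter \<Rightarrow> ('a \<Rightarrow> real) \<Rightarrow> ('a \<Rightarrow> real) \<Rightarrow> real poly \<Rightarrow> bool" where
  "asymp_poly F t f P \<longleftrightarrow> (\<forall>m. ((\<lambda>x. (f x - poly P (t x)) * t x ^ m) \<longlongrightarrow> 0) F)"

lemma asymp_polyD: "asymp_poly F t f P \<Longrightarrow> ((\<lambda>x. f x - poly P (t x)) \<longlongrightarrow> 0) F"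
  unfolding asymp_poly_def by (drule spec[of _ 0]) simp

lemma asymp_poly_exact: "(\<And>x. f x = poly P (t x)) \<Longrightarrow> asymp_poly F t f P"
  by (simp add: asymp_poly_def)

lemma asymp_poly_cong: "eventually (\<lambda>x. f x = g x) F \<Longrightarrow> asymp_poly F t f P \<longleftrightarrow> asymp_poly F t g P"
  unfolding asymp_poly_def by (intro all_cong1 tendsto_cong) (auto elim: eventually_mono)

lemma asymp_poly_add:
  assumes "asymp_poly F t f P" "asymp_poly F t g Q"
  shows "asymp_poly F t (\<lambda>x. f x + g x) (P + Q)"
  unfolding asymp_poly_def
proof
  fix m
  have "((\<lambda>x. (f x - poly P (t x)) * t x ^ m + (g x - poly Q (t x)) * t x ^ m) \<longlongrightarrow> 0 + 0) F"
    using assms unfolding asymp_poly_def by (intro tendsto_add) auto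
  then show "((\<lambda>x. (f x + g x - poly (P + Q) (t x)) * t x ^ m) \<longlongrightarrow> 0) F"
    by (simp add: algebra_simps)
qed

lemma asymp_poly_cmult:
  assumes "asymp_poly F t f P"
  shows "asymp_poly F t (\<lambda>x. c * f x) (Polynomial.smult c P)"
  unfolding asymp_poly_def
proof
  fix m
  have "((\<lambda>x. c * ((f x - poly P (t x)) * t x ^ m)) \<longlongrightarrow> c * 0) F"
    using assms unfolding asymp_poly_def by (intro tendsto_mult) auto
  then show "((\<lambda>x. (c * f x - poly (Polynomial.smult c P) (t x)) * t x ^ m) \<longlongrightarrow> 0) F"
    by (simp add: algebra_simps)
qed

lemma asymp_poly_diff:
  assumes "asymp_poly F t f P" "asymp_poly F t g Q"
  shows "asymp_poly F t (\<lambda>x. f x - g x) (P - Q)"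
  using asymp_poly_add[OF assms(1) asymp_poly_cmult[OF assms(2), of "-1"]] by simp

lemma asymp_poly_sum:
  assumes "\<And>i. i \<in> I \<Longrightarrow> asymp_poly F t (f i) (P i)"
  shows "asymp_poly F t (\<lambda>x. \<Sum>i\<in>I. f i x) (\<Sum>i\<in>I. P i)"
  using assms
proof (induction I rule: infinite_finite_induct)
  case (insert i I)
  then show ?case by (simp add: asymp_poly_add)
qed (auto intro: asymp_poly_exact)

lemma tendsto_poly_mult_zero:
  assumes "\<And>m. ((\<lambda>x. e x * t x ^ m) \<longlongrightarrow> (0::real)) F"
  shows "((\<lambda>x. e x * poly P (t x) * t x ^ m) \<longlongrightarrow> 0) F"
proof (induction P arbitrary: m)
  case (pCons a P)
  have "((\<lambda>x. a * (e x * t x ^ m) + e x * poly P (t x) * t x ^ Suc m) \<longlongrightarrow> a * 0 + 0) F"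
    by (intro tendsto_add tendsto_mult tendsto_const assms pCons.IH)
  then show ?case by (simp add: algebra_simps)
qed simp

lemma asymp_poly_mult:
  assumes "asymp_poly F t f P" "asymp_poly F t g Q"
  shows "asymp_poly F t (\<lambda>x. f x * g x) (P * Q)"
  unfolding asymp_poly_def
proof
  fix m
  have f: "\<And>m. ((\<lambda>x. (f x - poly P (t x)) * t x ^ m) \<longlongrightarrow> 0) F"
    and g: "\<And>m. ((\<lambda>x. (g x - poly Q (t x)) * t x ^ m) \<longlongrightarrow> 0) F"
    using assms unfolding asymp_poly_def by auto
  have "((\<lambda>x. ((f x - poly P (t x)) * t x ^ m) * ((g x - poly Q (t x)) * t x ^ 0)
      + (f x - poly P (t x)) * poly Q (t x) * t x ^ m
      + (g x - poly Q (t x)) * poly P (t x) * t x ^ m) \<longlongrightarrow> 0 * 0 + 0 + 0) F"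
    by (intro tendsto_add tendsto_mult f g tendsto_poly_mult_zero)
  then show "((\<lambda>x. (f x * g x - poly (P * Q) (t x)) * t x ^ m) \<longlongrightarrow> 0) F"
    by (simp add: algebra_simps)
qed

lemma poly_tendsto_0_imp_0:
  assumes "((\<lambda>x. poly P (t x)) \<longlongrightarrow> (0::real)) F" and "filterlim t at_top F" and "F \<noteq> bot"
  shows "P = 0"
proof (rule ccontr)
  assume "P \<noteq> 0"
  define Q where "Q = (if lead_coeff P > 0 then P else - P)"
  have Q: "lead_coeff Q > 0" using \<open>P \<noteq> 0\<close> by (auto simp: Q_def not_less le_less)
  have lim: "((\<lambda>x. poly Q (t x)) \<longlongrightarrow> 0) F"
    using assms(1) tendsto_minus[OF assms(1)] by (auto simp: Q_def)
  obtain n where n: "\<forall>x\<ge>n. lead_coeff Q \<le> poly Q x" using poly_pinfty_gt_lc[OF Q] by auto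
  have "eventually (\<lambda>x. lead_coeff Q \<le> poly Q (t x)) F"
    using assms(2) n unfolding filterlim_at_top by (metis (mono_tags, lifting) eventually_mono)
  then have "lead_coeff Q \<le> 0" by (rule tendsto_lowerbound[OF lim _ assms(3)])
  with Q show False by simp
qed

text \<open>The second expansion is assumed as a plain limit only, because Abel summation of a null
  sequence provides no rate of convergence.\<close>

lemma asymp_poly_unique:
  assumes "asymp_poly F t f P" "((\<lambda>x. f x - poly Q (t x)) \<longlongrightarrow> 0) F" "filterlim t at_top F" "F \<noteq> bot"
  shows "P = Q"
proof -
  have "((\<lambda>x. (f x - poly Q (t x)) - (f x - poly P (t x))) \<longlongrightarrow> 0 - 0) F"
    by (intro tendsto_diff assms asymp_polyD)
  then have "P - Q = 0" by (intro poly_tendsto_0_imp_0[of "P - Q" t F]) (use assms in simp_all)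
  then show ?thesis by simp
qed

section \<open>Multiple harmonic sums\<close>

text \<open>The multiple zeta value truncated at m_1 \<le> n; in \<open>qmzv\<close> the largest
  index stays below n.\<close>

definition harm_sum :: "nat list \<Rightarrow> nat \<Rightarrow> real" where
  "harm_sum ks n = iter_sum (\<lambda>k m. inverse (real m ^ k)) (rev [1..<Suc n]) ks"

lemma harm_sum_simps [simp]:
  "harm_sum [] n = 1" "harm_sum (k # ks) 0 = 0"
  "harm_sum (k # ks) (Suc n) = harm_sum (k # ks) n + inverse (real (Suc n) ^ k) * harm_sum ks n"
  by (auto simp: harm_sum_def)

lemma harm_sum_1: "harm_sum [1] = harm"
proof
  show "harm_sum [1] n = harm n" for n
    by (induction n) (auto simp: harm_Suc harm_expand(1))
qed

lemma harm_sum_nonneg: "0 \<le> harm_sum ks n"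
proof (induction n arbitrary: ks)
  case 0 show ?case by (cases ks) auto
next
  case (Suc n) show ?case by (cases ks) (auto intro!: add_nonneg_nonneg mult_nonneg_nonneg Suc)
qed

lemma incseq_harm_sum: "incseq (harm_sum ks)"
proof (rule incseq_SucI)
  show "harm_sum ks n \<le> harm_sum ks (Suc n)" for n
    by (cases ks) (auto intro!: mult_nonneg_nonneg harm_sum_nonneg)
qed

lemma harm_sum_le: "is_index ks \<Longrightarrow> harm_sum ks n \<le> harm n ^ length ks"
proof (induction n arbitrary: ks)
  case 0 show ?case by (cases ks) (auto simp: harm_expand(1))
next
  case (Suc n)
  show ?case
  proof (cases ks)
    case (Cons k ls)
    have "harm_sum ks (Suc n) = harm_sum ks n + inverse (real (Suc n) ^ k) * harm_sum ls n"
      by (simp add: Cons)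
    also have "inverse (real (Suc n) ^ k) \<le> inverse (real (Suc n) ^ 1)"
      using Suc.prems Cons by (intro le_imp_inverse_le power_increasing) auto
    then have "harm_sum ks n + inverse (real (Suc n) ^ k) * harm_sum ls n
       \<le> harm n ^ length ks + inverse (real (Suc n)) * harm n ^ length ls"
      using Suc.prems Suc.IH[of ks] Suc.IH[of ls] Cons
      by (intro add_mono mult_mono) (auto intro!: harm_sum_nonneg)
    also have "\<dots> = (harm n + inverse (real (Suc n))) * harm n ^ length ls"
      by (simp add: Cons algebra_simps)
    also have "\<dots> \<le> harm (Suc n) * harm (Suc n) ^ length ls"
      by (intro mult_mono power_mono) (auto simp: harm_Suc harm_nonneg)
    finally show ?thesis by (simp add: Cons)
  qed simp
qed

lemma harm_sum_mult:
  assumes "is_index u" "is_index v"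
  shows "harm_sum u n * harm_sum v n = stuf harm_sum u v n"
proof -
  have "harm_sum u n * harm_sum v n = stuf (\<lambda>w. harm_sum w n) u v"
    using assms iter_sum_mult[of "rev [1..<Suc n]" "\<lambda>k m. inverse (real m ^ k)" 0 u v]
    by (simp add: harm_sum_def power_add)
  also have "\<dots> = stuf harm_sum u v n"
    by (rule quasi_hom[symmetric, where h = "\<lambda>f. f n"]) auto
  finally show ?thesis .
qed

section \<open>Rate of convergence of the truncated sums\<close>

lemma harm_le_ln: "harm n \<le> 1 + ln (real n + 1)"
proof (cases "n = 0")
  case False
  then have "harm n - ln (real n) \<le> 1"
    using euler_mascheroni_sequence_decreasing[of 1 n] by (simp add: harm_expand)
  moreover have "ln (real n) \<le> ln (real n + 1)" using False by simp
  ultimately show ?thesis by linarith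
qed (simp add: harm_expand)

text \<open>With s = sqrt x and t = sqrt (x + 1), the right side is 4 / (s t (s + t)) because (t -
  s) (s + t) = 1. From t \<le> 3/2 s one gets s t (s + t) \<le> 15/4 s^3, whence the constant
  4.\<close>

lemma inverse_sqrt_telescope:
  assumes "1 \<le> (x::real)"
  shows "sqrt x / x ^ 2 \<le> 4 / sqrt x - 4 / sqrt (x + 1)"
proof -
  define s t where "s = sqrt x" and "t = sqrt (x + 1)"
  have st: "0 < s" "0 < t" "x = s * s" "t * t = s * s + 1" "1 \<le> s * s" using assms by (auto simp: s_def t_def)
  have "t ^ 2 \<le> (3 / 2 * s) ^ 2" unfolding power2_eq_square st(4) using st(5) by simp
  then have t: "t \<le> 3 / 2 * s" by (rule power2_le_imp_le) (use st(1) in simp)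
  have "s * t * (s + t) \<le> s * (3 / 2 * s) * (s + 3 / 2 * s)"
    using st(1,2) t by (intro mult_mono) auto
  also have "\<dots> \<le> 4 * (s * s * s)" using st(1) by simp
  finally have "4 / (4 * (s * s * s)) \<le> 4 / (s * t * (s + t))" 
    using st(1,2) by (intro divide_left_mono) (auto intro!: mult_pos_pos add_pos_pos)
  also have "(t - s) * (s + t) = 1" using st(4) by (simp add: algebra_simps)
  then have "4 / (s * t * (s + t)) = (4 * ((t - s) * (s + t))) / (s * t * (s + t))" by simp
  also have "\<dots> = (4 * (t - s)) / (s * t)" using st(1,2) by simp
  also have "\<dots> = 4 / s - 4 / t" using st(1,2) by (simp add: diff_divide_distrib right_diff_distrib)
  finally show ?thesis unfolding s_def[symmetric] t_def[symmetric] using st(1) by (simp add: st(3) power2_eq_square mult.assoc)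
qed

text \<open>Powers of the logarithm are traded for a square root, the same for every depth, which
  still leaves x^(-3/2) after division by x^2.\<close>

lemma harm_pow_le_sqrt: "\<exists>C\<ge>0. \<forall>n. harm n ^ r \<le> C * sqrt (real n + 1)"
proof -
  have "(\<lambda>n. (1 + ln (real n + 1)) ^ r / sqrt (real n + 1)) \<longlonglongrightarrow> 0"
    by real_asymp
  then have "Bseq (\<lambda>n. (1 + ln (real n + 1)) ^ r / sqrt (real n + 1))"
    by (intro convergent_imp_Bseq convergentI)
  then obtain C where C: "\<And>n. \<bar>(1 + ln (real n + 1)) ^ r / sqrt (real n + 1)\<bar> \<le> C" "0 < C"
    by (auto simp: Bseq_def)
  have "harm n ^ r \<le> C * sqrt (real n + 1)" for n
  proof -
    have "harm n ^ r \<le> (1 + ln (real n + 1)) ^ r" by (intro power_mono harm_le_ln harm_nonneg)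
    also have "\<dots> \<le> C * sqrt (real n + 1)" using C(1)[of n] by (simp add: abs_le_iff pos_divide_le_eq)
    finally show ?thesis .
  qed
  then show ?thesis using C(2) by (intro exI[of _ C]) auto
qed

text \<open>With k_1 \<ge> 2 the increments are at most a multiple of x^(-3/2), which telescopes.
  The explicit rate matters: convergence alone would not beat powers of the harmonic number.\<close>

lemma harm_sum_limit:
  assumes "admissible ks"
  shows "\<exists>z C. 0 \<le> C \<and> (\<forall>n. harm_sum ks n \<le> z \<and> z - harm_sum ks n \<le> C / sqrt (real n + 1))"
proof (cases ks)
  case Nil
  then show ?thesis by (intro exI[of _ 1] exI[of _ 0]) auto
next
  case (Cons k ls)
  then have k: "2 \<le> k" "is_index ls" using assms by (auto simp: admissible_def)
  obtain C where C: "0 \<le> C" "\<And>n. harm n ^ length ls \<le> C * sqrt (real n + 1)"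
    using harm_pow_le_sqrt by blast
  have step: "harm_sum ks (Suc n) - harm_sum ks n \<le> 4 * C / sqrt (real n + 1) - 4 * C / sqrt (real (Suc n) + 1)" for n
  proof -
    define x where "x = real n + 1"
    have x: "1 \<le> x" by (simp add: x_def)
    have "harm_sum ks (Suc n) - harm_sum ks n = inverse (x ^ k) * harm_sum ls n"
      by (simp add: Cons x_def add.commute)
    also have "\<dots> \<le> inverse (x ^ 2) * (C * sqrt x)"
      using x k C(2)[of n] harm_sum_le[of ls n]
      by (intro mult_mono le_imp_inverse_le power_increasing) (auto simp: x_def intro!: harm_sum_nonneg)
    also have "\<dots> = C * (sqrt x / x ^ 2)" by (simp add: field_simps)
    also have "\<dots> \<le> C * (4 / sqrt x - 4 / sqrt (x + 1))"
      using x C(1) by (intro mult_left_mono inverse_sqrt_telescope) auto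
    finally show ?thesis by (simp add: x_def algebra_simps)
  qed
  \<comment> \<open>Adding the telescoped tail makes the sequence decreasing, so it stays above its
    limit; this is the rate.\<close>
  have dec: "decseq (\<lambda>n. harm_sum ks n + 4 * C / sqrt (real n + 1))"
    using step by (intro decseq_SucI) (simp add: algebra_simps)
  have "harm_sum ks n \<le> 4 * C" for n
  proof -
    have "harm_sum ks n + 4 * C / sqrt (real n + 1) \<le> 4 * C"
      using decseqD[OF dec, of 0 n] by (simp add: Cons)
    moreover have "0 \<le> 4 * C / sqrt (real n + 1)" using C(1) by simp
    ultimately show ?thesis by linarith
  qed
  then obtain z where z: "harm_sum ks \<longlonglongrightarrow> z" "\<And>n. harm_sum ks n \<le> z"
    using incseq_convergent[OF incseq_harm_sum[of ks]] by metis
  have "(\<lambda>n. 4 * C / sqrt (real n + 1)) \<longlonglongrightarrow> 0" by real_asymp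
  from tendsto_add[OF z(1) this] have "(\<lambda>n. harm_sum ks n + 4 * C / sqrt (real n + 1)) \<longlonglongrightarrow> z" by simp
  from decseq_ge[OF dec this] have "z - harm_sum ks n \<le> 4 * C / sqrt (real n + 1)" for n
    by (simp add: algebra_simps)
  then show ?thesis using z(2) C(1) by (intro exI[of _ z] exI[of _ "4 * C"]) auto
qed

text \<open>For nonnegative terms every finite partial sum is dominated by the sum over some
  \<open>B n\<close>, so the limit along the exhaustion is the unordered sum.\<close>

lemma has_sum_exhaust:
  fixes f :: "'a \<Rightarrow> real"
  assumes "\<And>x. x \<in> A \<Longrightarrow> 0 \<le> f x" "\<And>n. finite (B n)" "mono B" "(\<Union>n. B n) = A"
    "(\<lambda>n. sum f (B n)) \<longlonglongrightarrow> L"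
  shows "(f has_sum L) A"
proof -
  have mono_sum: "incseq (\<lambda>n. sum f (B n))"
    using assms by (intro monoI sum_mono2) (auto dest: monoD)
  have le: "sum f F \<le> L" if F: "finite F" "F \<subseteq> A" for F
  proof -
    have "\<exists>n. F \<subseteq> B n" using F
    proof (induction F rule: finite_induct)
      case (insert x F)
      then obtain m n where "x \<in> B m" "F \<subseteq> B n" using assms(4) by blast
      then have "insert x F \<subseteq> B (max m n)"
        using monoD[OF assms(3), of m "max m n"] monoD[OF assms(3), of n "max m n"] by auto
      then show ?case ..
    qed auto
    then obtain n where "F \<subseteq> B n" ..
    then have "sum f F \<le> sum f (B n)" using assms(1,2,4) by (intro sum_mono2) auto
    also have "\<dots> \<le> L" by (rule incseq_le[OF mono_sum assms(5)])
    finally show ?thesis .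
  qed
  show ?thesis
    unfolding has_sum_def
  proof (rule tendstoI)
    fix e :: real assume "0 < e"
    then have "eventually (\<lambda>n. dist (sum f (B n)) L < e) sequentially"
      using assms(5) by (rule tendstoD[rotated])
    then obtain n where n: "dist (sum f (B n)) L < e" by (auto simp: eventually_sequentially)
    have "dist (sum f F) L < e" if "finite F" "B n \<subseteq> F" "F \<subseteq> A" for F
    proof -
      have "sum f (B n) \<le> sum f F" using that assms(1) by (intro sum_mono2) auto
      then show ?thesis using n le[OF that(1,3)] by (auto simp: dist_real_def)
    qed
    then show "eventually (\<lambda>F. dist (sum f F) L < e) (finite_subsets_at_top A)"
      using assms(2,4) by (auto simp: eventually_finite_subsets_at_top intro!: exI[of _ "B n"])
  qed
qed

lemma harm_sum_tendsto_mzv: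
  assumes "admissible ks"
  shows "\<exists>C\<ge>0. \<forall>n. harm_sum ks n \<le> mzv ks \<and> mzv ks - harm_sum ks n \<le> C / sqrt (real n + 1)"
proof -
  obtain z C where z: "0 \<le> C" "\<And>n. harm_sum ks n \<le> z" "\<And>n. z - harm_sum ks n \<le> C / sqrt (real n + 1)"
    using harm_sum_limit[OF assms] by blast
  have lim: "harm_sum ks \<longlonglongrightarrow> z"
  proof (rule tendsto_sandwich)
    show "(\<lambda>n. z - C / sqrt (real n + 1)) \<longlonglongrightarrow> z" by real_asymp
  qed (use z in \<open>auto simp: algebra_simps\<close>)
  have "((\<lambda>ms. \<Prod>j<length ks. inverse (real (ms ! j) ^ (ks ! j))) has_sum z) (decr_tuples {0<..} (length ks))"
  proof (rule has_sum_exhaust)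
    show "mono (\<lambda>n. decr_tuples {1..n} (length ks))"
      by (auto simp: mono_def decr_tuples_def)
    show "(\<Union>n. decr_tuples {1..n} (length ks)) = decr_tuples {0<..} (length ks)"
    proof (intro equalityI subsetI)
      fix ms assume ms: "ms \<in> decr_tuples {0<..} (length ks)"
      then have "ms \<in> decr_tuples {1..Max (set ms)} (length ks)"
        by (auto simp: decr_tuples_def Suc_le_eq)
      then show "ms \<in> (\<Union>n. decr_tuples {1..n} (length ks))" by blast
    qed (auto simp: decr_tuples_def)
    have "(\<Sum>ms\<in>decr_tuples {1..n} (length ks). \<Prod>j<length ks. inverse (real (ms ! j) ^ (ks ! j))) = harm_sum ks n" for n
      unfolding harm_sum_def
      by (subst iter_sum_eq_sum_decr_tuples)
        (auto simp: sorted_wrt_rev atLeastLessThanSuc_atLeastAtMost simp del: upt_Suc)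
    with lim show "(\<lambda>n. \<Sum>ms\<in>decr_tuples {1..n} (length ks). \<Prod>j<length ks. inverse (real (ms ! j) ^ (ks ! j))) \<longlonglongrightarrow> z"
      by simp
  qed (auto intro!: prod_nonneg finite_decr_tuples)
  then have "mzv ks = z" unfolding mzv_def by (rule infsumI)
  then show ?thesis using z by (intro exI[of _ C]) auto
qed

lemma filterlim_harm: "filterlim (harm :: nat \<Rightarrow> real) at_top sequentially"
  by (rule harm_at_top)

text \<open>The rate n^(-1/2) beats every power of the harmonic number, so the expansion is a
  constant.\<close>

lemma asymp_poly_admissible:
  assumes "admissible ks"
  shows "asymp_poly sequentially harm (harm_sum ks) [:mzv ks:]"
  unfolding asymp_poly_def
proof
  fix m
  obtain C where C: "0 \<le> C" "\<And>n. harm_sum ks n \<le> mzv ks" "\<And>n. mzv ks - harm_sum ks n \<le> C / sqrt (real n + 1)"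
    using harm_sum_tendsto_mzv[OF assms] by blast
  have "(\<lambda>n. (mzv ks - harm_sum ks n) * harm n ^ m) \<longlonglongrightarrow> 0"
  proof (rule tendsto_sandwich)
    show "eventually (\<lambda>n. 0 \<le> (mzv ks - harm_sum ks n) * harm n ^ m) sequentially"
      using C(2) by (auto intro!: always_eventually mult_nonneg_nonneg harm_nonneg zero_le_power)
    have "(mzv ks - harm_sum ks n) * harm n ^ m \<le> C / sqrt (real n + 1) * (1 + ln (real n + 1)) ^ m" for n
      using C by (intro mult_mono power_mono harm_le_ln) (auto intro!: harm_nonneg zero_le_power)
    then show "eventually (\<lambda>n. (mzv ks - harm_sum ks n) * harm n ^ m
        \<le> C / sqrt (real n + 1) * (1 + ln (real n + 1)) ^ m) sequentially"
      by auto
    show "(\<lambda>n. C / sqrt (real n + 1) * (1 + ln (real n + 1)) ^ m) \<longlonglongrightarrow> 0" by real_asymp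
  qed auto
  from tendsto_minus[OF this] show "(\<lambda>n. (harm_sum ks n - poly [:mzv ks:] (harm n)) * harm n ^ m) \<longlonglongrightarrow> 0"
    by (simp add: algebra_simps)
qed

section \<open>Regularized multiple zeta values\<close>

lemma asymp_poly_harm_divide:
  assumes "asymp_poly F t (\<Sum>i\<le>(n::nat). f) P"
  shows "asymp_poly F t f (Polynomial.smult (1 / real (Suc n)) P)"
proof -
  have "(\<Sum>i\<le>n. f) x = real (Suc n) * f x" for x
    by (induction n) (auto simp: algebra_simps)
  then have "(\<lambda>x. 1 / real (Suc n) * (\<Sum>i\<le>n. f) x) = f" by (auto simp: fun_eq_iff)
  with asymp_poly_cmult[OF assms, of "1 / real (Suc n)"] show ?thesis by simp
qed

text \<open>The stuffle product with the index 1 is multiplication by the harmonic number, which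
  multiplies the expansion by T; the convergent admissible sums start the induction.\<close>

lemma harm_sum_asymp_poly:
  assumes "is_index ks"
  shows "\<exists>P. asymp_poly sequentially harm (harm_sum ks) P"
proof -
  let ?A = "{f. \<exists>P. asymp_poly sequentially harm f P}"
  have "harm_sum ks \<in> ?A"
    using assms
  proof (rule stuf_induct[rotated -1])
    show "0 \<in> ?A" by (auto intro!: exI[of _ 0] asymp_poly_exact)
    show "x + y \<in> ?A" if "x \<in> ?A" "y \<in> ?A" for x y
      using that asymp_poly_add by (fastforce simp: plus_fun_def)
    show "x - y \<in> ?A" if "x \<in> ?A" "y \<in> ?A" for x y
      using that asymp_poly_diff by (fastforce simp: fun_diff_def)
    show "x \<in> ?A" if "(\<Sum>i\<le>n. x) \<in> ?A" for n :: nat and x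
      using that asymp_poly_harm_divide by blast
    show "harm_sum w \<in> ?A" if "admissible w" for w
      using asymp_poly_admissible[OF that] by blast
    show "stuf harm_sum [1] w \<in> ?A" if "is_index w" "harm_sum w \<in> ?A" for w
    proof -
      obtain P where P: "asymp_poly sequentially harm (harm_sum w) P" using \<open>harm_sum w \<in> ?A\<close> by blast
      have "asymp_poly sequentially harm (\<lambda>n. harm n * harm_sum w n) ([:0, 1:] * P)"
        by (rule asymp_poly_mult[OF asymp_poly_exact P]) simp
      moreover have "stuf harm_sum [1] w = (\<lambda>n. harm n * harm_sum w n)"
        using harm_sum_mult[of "[1]" w] \<open>is_index w\<close> unfolding harm_sum_1 by (intro ext) simp
      ultimately show ?thesis by auto
    qed
  qed
  then show ?thesis by blast
qed

text \<open>The stuffle regularization. T stands for the harmonic number itself rather than for a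
  logarithm, so that the index 1 receives exactly T.\<close>

definition reg_poly :: "nat list \<Rightarrow> real poly" where
  "reg_poly ks = (THE P. asymp_poly sequentially harm (harm_sum ks) P)"

lemma reg_poly_eqI: "asymp_poly sequentially harm (harm_sum ks) P \<Longrightarrow> reg_poly ks = P"
  unfolding reg_poly_def
  by (rule the_equality) (auto intro: asymp_poly_unique asymp_polyD filterlim_harm)

lemma asymp_poly_reg_poly:
  "is_index ks \<Longrightarrow> asymp_poly sequentially harm (harm_sum ks) (reg_poly ks)"
  using harm_sum_asymp_poly[of ks] reg_poly_eqI[of ks] by auto

lemma reg_poly_admissible: "admissible ks \<Longrightarrow> reg_poly ks = [:mzv ks:]"
  by (intro reg_poly_eqI asymp_poly_admissible)

lemma reg_poly_Nil [simp]: "reg_poly [] = 1"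
  by (intro reg_poly_eqI asymp_poly_exact) simp

lemma reg_poly_1: "reg_poly [1] = [:0, 1:]"
  unfolding harm_sum_1[symmetric] by (intro reg_poly_eqI asymp_poly_exact) (simp only: harm_sum_1, simp)

text \<open>Pairs of a function and its expansion are closed under addition, so the stuffle sum of
  pairs is such a pair. Its function is the product of the truncated sums, whose expansion is also
  the product of the polynomials.\<close>

lemma reg_poly_mult:
  assumes "is_index u" "is_index v"
  shows "reg_poly u * reg_poly v = stuf reg_poly u v"
proof -
  let ?A = "{(f, P). asymp_poly sequentially harm f P}"
  let ?p = "stuf (\<lambda>w. (harm_sum w, reg_poly w)) u v"
  have "?p \<in> ?A"
    using assms asymp_poly_add
    by (intro stuf_closed) (auto simp: plus_fun_def intro: asymp_poly_reg_poly)
  moreover have "fst ?p = stuf harm_sum u v"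
    by (subst quasi_hom[where h = fst and T' = "\<lambda>_. 0"]) auto
  moreover have "snd ?p = stuf reg_poly u v"
    by (subst quasi_hom[where h = snd and T' = "\<lambda>_. 0"]) auto
  ultimately have "asymp_poly sequentially harm (stuf harm_sum u v) (stuf reg_poly u v)"
    by (auto simp: case_prod_unfold)
  moreover have "stuf harm_sum u v = (\<lambda>n. harm_sum u n * harm_sum v n)"
    using harm_sum_mult[OF assms] by auto
  moreover have "asymp_poly sequentially harm (\<lambda>n. harm_sum u n * harm_sum v n) (reg_poly u * reg_poly v)"
    using assms by (intro asymp_poly_mult asymp_poly_reg_poly)
  ultimately show ?thesis
    by (auto intro: asymp_poly_unique asymp_polyD filterlim_harm)
qed

text \<open>Deleting a leading one is a derivation of the stuffle algebra, and \<open>reg_poly\<close> turns it into \<open>d/dT\<close>.\<close>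

lemma pderiv_reg_poly:
  assumes "is_index ks"
  shows "pderiv (reg_poly ks) = (if ks \<noteq> [] \<and> hd ks = 1 then reg_poly (tl ks) else 0)"
proof -
  define D where "D ks = (if ks \<noteq> [] \<and> hd ks = 1 then reg_poly (tl ks) else 0)" for ks
  let ?A = "{(P, Q). pderiv P = (Q :: real poly)}"
  have "(reg_poly ks, D ks) \<in> ?A"
    using assms
  proof (rule stuf_induct[where f = "\<lambda>ks. (reg_poly ks, D ks)", rotated -1])
    show "x \<in> ?A" if "(\<Sum>i\<le>n. x) \<in> ?A" for n :: nat and x
    proof -
      have "(\<Sum>i\<le>n. x) = (of_nat (Suc n) * fst x, of_nat (Suc n) * snd x)"
        by (simp add: prod_eq_iff fst_sum snd_sum)
      with that have "of_nat (Suc n) * pderiv (fst x) = of_nat (Suc n) * snd x"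
        by (simp add: pderiv_mult del: of_nat_Suc)
      then show ?thesis by (simp add: case_prod_unfold del: of_nat_Suc)
    qed
    show "(reg_poly w, D w) \<in> ?A" if "admissible w" for w
      using that by (auto simp: D_def admissible_def reg_poly_admissible)
    show "stuf (\<lambda>w. (reg_poly w, D w)) [1] w \<in> ?A" if w: "is_index w" and A: "(reg_poly w, D w) \<in> ?A" for w
    proof -
      let ?p = "stuf (\<lambda>w. (reg_poly w, D w)) [1] w"
      have 1: "fst ?p = [:0, 1:] * reg_poly w"
        using w reg_poly_mult[of "[1]" w, symmetric] unfolding reg_poly_1
        by (subst quasi_hom[where h = fst and T' = "\<lambda>_. 0"]) auto
      have "snd ?p = stuf D [1] w"
        by (subst quasi_hom[where h = snd and T' = "\<lambda>_. 0"]) auto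
      \<comment> \<open>The Leibniz rule: the term with the new 1 in front gives
        \<open>reg_poly w\<close>, the terms that keep the head of \<open>w\<close> give T times
        \<open>D w\<close>, and a merged first letter is at least 2 and contributes nothing.\<close>
      also have "\<dots> = reg_poly w + [:0, 1:] * D w"
      proof (cases w)
        case (Cons l v)
        have zero: "stuf (\<lambda>_. 0 :: real poly) u v = 0" for u v
          by (induction "\<lambda>_ :: real poly. 0 :: real poly" "\<lambda>_ :: nat list. 0 :: real poly" u v rule: quasi.induct) auto
        have "stuf (\<lambda>w. D (l # w)) [1] v = [:0, 1:] * D w"
        proof (cases "l = 1")
          case True
          then have "(\<lambda>w. D (l # w)) = reg_poly" by (auto simp: D_def)
          then show ?thesis
            using w reg_poly_mult[of "[1]" v, symmetric] True Cons unfolding reg_poly_1 by (simp add: D_def)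
        next
          case False
          then have "(\<lambda>w. D (l # w)) = (\<lambda>_. 0)" by (auto simp: D_def)
          then show ?thesis using False zero by (simp add: D_def Cons)
        qed
        moreover have "D (1 # w) = reg_poly w" "D (Suc l # v) = 0" using w Cons by (auto simp: D_def)
        ultimately show ?thesis by (simp add: Cons)
      qed (simp add: D_def)
      finally have 2: "snd ?p = reg_poly w + [:0, 1:] * D w" .
      have "pderiv (fst ?p) = snd ?p"
        unfolding 1 2 using A by (simp add: pderiv_mult pderiv_pCons algebra_simps)
      then show ?thesis by (simp add: case_prod_unfold)
    qed
  qed (auto simp: pderiv_add pderiv_diff zero_prod_def)
  then show ?thesis by (simp add: D_def)
qed

section \<open>Symmetric sums\<close>

definition symm_sum :: "nat list \<Rightarrow> nat \<Rightarrow> real" where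
  "symm_sum ks n = (\<Sum>a\<le>length ks.
     (- 1) ^ sum_list (take a ks) * harm_sum (rev (take a ks)) n * harm_sum (drop a ks) n)"

definition symm_poly :: "nat list \<Rightarrow> real poly" where
  "symm_poly ks = (\<Sum>a\<le>length ks.
     (- 1) ^ sum_list (take a ks) * reg_poly (rev (take a ks)) * reg_poly (drop a ks))"

text \<open>The points \<open>-1, -1/2, \<dots>, -1/n, 1/n, \<dots>, 1/2, 1\<close> exhibit \<open>symm_sum\<close> as an iterated sum.\<close>

lemma symm_sum_iter_sum:
  "symm_sum ks n = iter_sum (\<lambda>k x. x ^ k)
     (map (\<lambda>m. - inverse (real m)) [1..<Suc n] @ map (\<lambda>m. inverse (real m)) (rev [1..<Suc n])) ks"
proof -
  have "iter_sum (\<lambda>k x. x ^ k) (map (\<lambda>m. - inverse (real m)) [1..<Suc n]) u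
      = (- 1) ^ sum_list u * harm_sum (rev u) n" for u
  proof -
    have "iter_sum (\<lambda>k x. x ^ k) (map (\<lambda>m. - inverse (real m)) [1..<Suc n]) u
      = iter_sum (\<lambda>k m. (- 1) ^ k * inverse (real m ^ k)) [1..<Suc n] u"
      unfolding iter_sum_map by (intro iter_sum_cong) (simp add: power_minus[of "inverse _"] power_inverse)
    also have "\<dots> = (- 1) ^ sum_list u * iter_sum (\<lambda>k m. inverse (real m ^ k)) [1..<Suc n] u"
      by (rule iter_sum_sign)
    also have "iter_sum (\<lambda>k m. inverse (real m ^ k)) [1..<Suc n] u = harm_sum (rev u) n"
      unfolding harm_sum_def by (rule iter_sum_rev[symmetric])
    finally show ?thesis .
  qed
  moreover have "iter_sum (\<lambda>k x. x ^ k) (map (\<lambda>m. inverse (real m)) (rev [1..<Suc n])) u = harm_sum u n" for u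
    unfolding iter_sum_map harm_sum_def by (intro iter_sum_cong) (simp add: power_inverse)
  ultimately show ?thesis by (simp add: symm_sum_def iter_sum_append)
qed

lemma symm_sum_mult:
  assumes "is_index u" "is_index v"
  shows "symm_sum u n * symm_sum v n = stuf symm_sum u v n"
proof -
  have "symm_sum u n * symm_sum v n = stuf (\<lambda>w. symm_sum w n) u v"
    using assms iter_sum_mult[of _ "\<lambda>k x. x ^ k" 0 u v]
    by (simp add: symm_sum_iter_sum power_add del: upt_Suc)
  also have "\<dots> = stuf symm_sum u v n"
    by (rule quasi_hom[symmetric, where h = "\<lambda>f. f n"]) auto
  finally show ?thesis .
qed

lemma asymp_poly_symm:
  assumes "is_index ks"
  shows "asymp_poly sequentially harm (symm_sum ks) (symm_poly ks)"
  unfolding symm_sum_def[abs_def] symm_poly_def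
  using assms
  by (intro asymp_poly_sum asymp_poly_mult asymp_poly_reg_poly asymp_poly_exact) (auto simp: poly_power)

text \<open>The derivatives of the prefix factor \<open>A (Suc a)\<close> and of the suffix factor
  \<open>B a\<close> both delete the letter \<open>ks ! a\<close> if it is 1, and both leave
  \<open>A a * B (Suc a)\<close>. The signs of the two terms differ by (-1)^1, so they
  cancel.\<close>

lemma symm_poly_const:
  assumes "is_index ks"
  shows "pderiv (symm_poly ks) = 0"
proof -
  let ?r = "length ks"
  define e :: "nat \<Rightarrow> real poly" where "e a = (- 1) ^ sum_list (take a ks)" for a
  define A B where "A a = reg_poly (rev (take a ks))" and "B a = reg_poly (drop a ks)" for a
  have "pderiv ((- 1) ^ m) = (0 :: real poly)" for m
    by (induction m) (auto simp: pderiv_mult pderiv_minus)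
  then have e: "pderiv (e a) = 0" for a by (simp add: e_def)
  have A0: "pderiv (A 0) = 0" by (simp add: A_def)
  have A1: "pderiv (A (Suc a)) = (if ks ! a = 1 then A a else 0)" if "a < ?r" for a
  proof -
    have "0 < ks ! a" using that assms by (auto simp: is_index_def)
    then show ?thesis using that assms by (simp add: A_def pderiv_reg_poly take_Suc_conv_app_nth)
  qed
  have B0: "pderiv (B ?r) = 0" by (simp add: B_def)
  have B1: "pderiv (B a) = (if ks ! a = 1 then B (Suc a) else 0)" if "a < ?r" for a
    using that assms by (simp add: B_def pderiv_reg_poly hd_drop_conv_nth tl_drop drop_Suc)
  have "pderiv (symm_poly ks) = (\<Sum>a\<le>?r. pderiv (e a * A a * B a))"
    using higher_pderiv_sum[of 1 "\<lambda>a. e a * A a * B a" "{..?r}"] by (simp add: symm_poly_def e_def A_def B_def)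
  also have "\<dots> = (\<Sum>a\<le>?r. e a * pderiv (A a) * B a + e a * A a * pderiv (B a))"
    by (simp add: pderiv_mult e algebra_simps)
  also have "\<dots> = (\<Sum>a\<le>?r. e a * pderiv (A a) * B a) + (\<Sum>a\<le>?r. e a * A a * pderiv (B a))"
    by (rule sum.distrib)
  also have "(\<Sum>a\<le>?r. e a * pderiv (A a) * B a) = (\<Sum>a<?r. e (Suc a) * pderiv (A (Suc a)) * B (Suc a))"
    by (simp add: A0 sum.atMost_shift)
  also have "(\<Sum>a\<le>?r. e a * A a * pderiv (B a)) = (\<Sum>a<?r. e a * A a * pderiv (B a))"
    by (simp add: B0 lessThan_Suc_atMost[symmetric])
  also have "(\<Sum>a<?r. e (Suc a) * pderiv (A (Suc a)) * B (Suc a)) + (\<Sum>a<?r. e a * A a * pderiv (B a)) = 0"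
    unfolding sum.distrib[symmetric]
  proof (rule sum.neutral, safe)
    fix a assume "a < ?r"
    then have "e (Suc a) = - e a" if "ks ! a = 1"
      using that by (simp add: e_def take_Suc_conv_app_nth)
    then show "e (Suc a) * pderiv (A (Suc a)) * B (Suc a) + e a * A a * pderiv (B a) = 0"
      using \<open>a < ?r\<close> by (simp add: A1 B1)
  qed
  finally show ?thesis .
qed

text \<open>Any argument gives the same value on an index, since \<open>symm_poly\<close> is
  constant there.\<close>

definition symm_val :: "nat list \<Rightarrow> real" where
  "symm_val ks = poly (symm_poly ks) 0"

lemma symm_poly_eq:
  assumes "is_index ks"
  shows "symm_poly ks = [:symm_val ks:]"
proof -
  obtain c where "symm_poly ks = [:c:]" using symm_poly_const[OF assms] by (meson pderiv_iszero)
  then show ?thesis by (simp add: symm_val_def)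
qed

lemma symm_sum_tendsto: "is_index ks \<Longrightarrow> symm_sum ks \<longlonglongrightarrow> symm_val ks"
  using asymp_polyD[OF asymp_poly_symm, of ks] by (simp add: symm_poly_eq LIM_zero_iff)

lemma symm_val_Nil [simp]: "symm_val [] = 1"
  by (simp add: symm_val_def symm_poly_def)

text \<open>The stuffle product holds for the symmetric sums at every finite level and passes to the
  limit.\<close>

lemma symm_val_mult:
  assumes "is_index u" "is_index v"
  shows "symm_val u * symm_val v = stuf symm_val u v"
proof -
  let ?A = "{(f, c). f \<longlonglongrightarrow> (c :: real)}"
  let ?p = "stuf (\<lambda>w. (symm_sum w, symm_val w)) u v"
  have "?p \<in> ?A"
    using assms by (intro stuf_closed) (auto simp: plus_fun_def intro: symm_sum_tendsto tendsto_add)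
  moreover have "fst ?p = stuf symm_sum u v"
    by (subst quasi_hom[where h = fst and T' = "\<lambda>_. 0"]) auto
  moreover have "snd ?p = stuf symm_val u v"
    by (subst quasi_hom[where h = snd and T' = "\<lambda>_. 0"]) auto
  ultimately have "stuf symm_sum u v \<longlonglongrightarrow> stuf symm_val u v"
    by (auto simp: case_prod_unfold)
  moreover have "stuf symm_sum u v = (\<lambda>n. symm_sum u n * symm_sum v n)"
    using symm_sum_mult[OF assms] by auto
  moreover have "(\<lambda>n. symm_sum u n * symm_sum v n) \<longlonglongrightarrow> symm_val u * symm_val v"
    using assms by (intro tendsto_mult symm_sum_tendsto)
  ultimately show ?thesis using LIMSEQ_unique by auto
qed

section \<open>Algebras over the rationals\<close>

lemma rat_alg_simps [simp]:
  "carrier (rat_alg R) = carrier R" "monoid.mult (rat_alg R) = monoid.mult R" "one (rat_alg R) = one R"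
  "zero (rat_alg R) = zero R" "add (rat_alg R) = add R"
  by (simp_all add: rat_alg_def ring.defs)

lemma cring_rat_alg:
  assumes "cring R"
  shows "cring (rat_alg R)"
proof -
  interpret cring R by fact
  show ?thesis
  proof (intro cringI abelian_groupI comm_monoidI)
    show "\<exists>y\<in>carrier (rat_alg R). y \<oplus>\<^bsub>rat_alg R\<^esub> x = \<zero>\<^bsub>rat_alg R\<^esub>" if "x \<in> carrier (rat_alg R)" for x
      using that l_neg[of x] by auto
  qed (auto simp: a_ac l_distr m_assoc intro: m_comm)
qed

text \<open>The rational structure is determined by the ring once positive integers are invertible,
  so facts about spans are stated for rings; \<open>rat_emb\<close> is the structure map of
  \<open>rat_alg\<close>.\<close>

locale rat_ring = cring R for R :: "'a ring" (structure) +
  assumes nat_invertible: "0 < (n::int) \<Longrightarrow> \<exists>y\<in>carrier R. [n] \<cdot> \<one> \<otimes> y = \<one>"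
begin

lemma int_add: "[(m + n)] \<cdot> \<one> = [m] \<cdot> \<one> \<oplus> [n] \<cdot> \<one>" for m n :: int
  by (rule add.int_pow_mult) simp

lemma int_mult: "[(m * n)] \<cdot> \<one> = [m] \<cdot> \<one> \<otimes> [n] \<cdot> \<one>" for m n :: int
  by (simp add: add_pow_ldistr_int add.int_pow_pow mult.commute)

lemma int_Units: "0 < (n::int) \<Longrightarrow> [n] \<cdot> \<one> \<in> Units R"
  using nat_invertible[of n] by (auto simp: Units_def) (metis add.int_pow_closed m_comm one_closed)

definition rat_emb :: "rat \<Rightarrow> 'a" where
  "rat_emb c = (case quotient_of c of (a, b) \<Rightarrow> [a] \<cdot> \<one> \<otimes> inv ([b] \<cdot> \<one>))"

text \<open>Any fraction a / b representing \<open>c\<close> may be used, not only the reduced one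
  returned by \<open>quotient_of\<close>; sums and products can then be checked on the product of
  the denominators.\<close>

lemma rat_emb_unique:
  fixes a b :: int
  assumes "0 < b" "c * of_int b = of_int a" "x \<in> carrier R" "x \<otimes> [b] \<cdot> \<one> = [a] \<cdot> \<one>"
  shows "rat_emb c = x"
proof -
  obtain a' b' where q: "quotient_of c = (a', b')" by force
  have b': "0 < b'" using quotient_of_denom_pos[OF q] .
  have "c * of_int b' = of_int a'" using quotient_of_div[OF q] b' by simp
  then have "(of_int (a' * b) :: rat) = of_int (a * b')" using assms(2) by (simp add: algebra_simps flip: assms(2))
  then have e: "a' * b = a * b'" by (simp only: of_int_eq_iff)
  note U = int_Units[OF b'] int_Units[OF assms(1)]
  have "x \<otimes> ([b] \<cdot> \<one> \<otimes> [b'] \<cdot> \<one>) = [a'] \<cdot> \<one> \<otimes> [b] \<cdot> \<one>"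
  proof -
    have "x \<otimes> ([b] \<cdot> \<one> \<otimes> [b'] \<cdot> \<one>) = [(a * b')] \<cdot> \<one>"
      using assms(3) by (simp add: m_assoc[symmetric] assms(4) int_mult)
    then show ?thesis unfolding e[symmetric] by (simp add: int_mult)
  qed
  then have "(x \<otimes> [b'] \<cdot> \<one>) \<otimes> [b] \<cdot> \<one> = [a'] \<cdot> \<one> \<otimes> [b] \<cdot> \<one>"
    using assms(3) by (simp add: m_assoc m_comm[of "[b] \<cdot> \<one>"])
  then have "((x \<otimes> [b'] \<cdot> \<one>) \<otimes> [b] \<cdot> \<one>) \<otimes> inv ([b] \<cdot> \<one>) = ([a'] \<cdot> \<one> \<otimes> [b] \<cdot> \<one>) \<otimes> inv ([b] \<cdot> \<one>)"
    by simp
  then have "x \<otimes> [b'] \<cdot> \<one> = [a'] \<cdot> \<one>"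
    using U(2) assms(3) by (simp add: m_assoc)
  then have "[a'] \<cdot> \<one> \<otimes> inv ([b'] \<cdot> \<one>) = x"
    using U(1) assms(3) by (metis Units_closed Units_r_inv m_assoc r_one Units_inv_closed)
  then show ?thesis by (simp add: rat_emb_def q)
qed

lemma rat_emb_ex:
  obtains a b :: int where "0 < b" "c * of_int b = of_int a" "rat_emb c \<otimes> [b] \<cdot> \<one> = [a] \<cdot> \<one>"
    "rat_emb c \<in> carrier R"
proof -
  obtain a b where q: "quotient_of c = (a, b)" by force
  have b: "0 < b" using quotient_of_denom_pos[OF q] .
  show ?thesis
  proof (rule that[OF b])
    show "c * of_int b = of_int a" using quotient_of_div[OF q] b by simp
  qed (use int_Units[OF b] in \<open>simp_all add: rat_emb_def q m_assoc Units_closed\<close>)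
qed

lemma rat_emb_closed [simp, intro]: "rat_emb c \<in> carrier R"
  by (rule rat_emb_ex)

lemma rat_emb_add: "rat_emb (c + d) = rat_emb c \<oplus> rat_emb d"
proof -
  obtain a b :: int where 1: "0 < b" "c * of_int b = of_int a" "rat_emb c \<otimes> [b] \<cdot> \<one> = [a] \<cdot> \<one>"
    by (rule rat_emb_ex)
  obtain a' b' :: int where 2: "0 < b'" "d * of_int b' = of_int a'" "rat_emb d \<otimes> [b'] \<cdot> \<one> = [a'] \<cdot> \<one>"
    by (rule rat_emb_ex)
  show ?thesis
  proof (rule rat_emb_unique)
    show "(c + d) * of_int (b * b') = of_int (a * b' + a' * b)"
      using 1(2) 2(2) by (simp add: algebra_simps flip: 1(2) 2(2))
    show "(rat_emb c \<oplus> rat_emb d) \<otimes> [(b * b')] \<cdot> \<one> = [(a * b' + a' * b)] \<cdot> \<one>"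
      unfolding int_add int_mult 1(3)[symmetric] 2(3)[symmetric]
      by (simp add: l_distr m_assoc m_comm[of "[b'] \<cdot> \<one>" "[b] \<cdot> \<one>"])
  qed (use 1 2 in auto)
qed

lemma rat_emb_mult: "rat_emb (c * d) = rat_emb c \<otimes> rat_emb d"
proof -
  obtain a b :: int where 1: "0 < b" "c * of_int b = of_int a" "rat_emb c \<otimes> [b] \<cdot> \<one> = [a] \<cdot> \<one>"
    by (rule rat_emb_ex)
  obtain a' b' :: int where 2: "0 < b'" "d * of_int b' = of_int a'" "rat_emb d \<otimes> [b'] \<cdot> \<one> = [a'] \<cdot> \<one>"
    by (rule rat_emb_ex)
  show ?thesis
  proof (rule rat_emb_unique)
    show "(c * d) * of_int (b * b') = of_int (a * a')"
      by (simp flip: 1(2) 2(2))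
    show "(rat_emb c \<otimes> rat_emb d) \<otimes> [(b * b')] \<cdot> \<one> = [(a * a')] \<cdot> \<one>"
      unfolding int_mult 1(3)[symmetric] 2(3)[symmetric]
      by (simp add: m_ac)
  qed (use 1 2 in auto)
qed

lemma rat_emb_int: "rat_emb (of_int n) = [n] \<cdot> \<one>"
  by (rule rat_emb_unique[where b = 1 and a = n]) auto

lemma rat_emb_0 [simp]: "rat_emb 0 = \<zero>" and rat_emb_1 [simp]: "rat_emb 1 = \<one>"
  using rat_emb_int[of 0] rat_emb_int[of 1] by (auto simp: add_pow_int_ge)

lemma smult_rat_alg: "c \<odot>\<^bsub>rat_alg R\<^esub> x = rat_emb c \<otimes> x"
  by (simp add: rat_alg_def ring.defs rat_emb_def case_prod_unfold)

lemma finsum_rat_alg: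
  assumes "f \<in> F \<rightarrow> carrier R"
  shows "finsum (rat_alg R) f F = finsum R f F"
proof -
  interpret M: cring "rat_alg R" by (rule cring_rat_alg) (rule is_cring)
  show ?thesis
    using assms by (induction F rule: infinite_finite_induct) (auto simp: M.finsum_insert finsum_insert)
qed

lemma rat_span_eq:
  assumes "S \<subseteq> carrier R"
  shows "rat_span (rat_alg R) S = {\<Oplus>x\<in>F. rat_emb (c x) \<otimes> x | c F. finite F \<and> F \<subseteq> S}"
proof -
  have "(\<Oplus>\<^bsub>rat_alg R\<^esub>x\<in>F. c x \<odot>\<^bsub>rat_alg R\<^esub> x) = (\<Oplus>x\<in>F. rat_emb (c x) \<otimes> x)" if "F \<subseteq> S" for c F
    unfolding smult_rat_alg using that assms by (intro finsum_rat_alg) auto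
  then show ?thesis unfolding rat_span_def by (metis (no_types, lifting))
qed

lemma rat_span_carrier: "S \<subseteq> carrier R \<Longrightarrow> rat_span (rat_alg R) S \<subseteq> carrier R"
  by (auto simp: rat_span_eq intro!: finsum_closed)

lemma rat_span_incl:
  assumes "S \<subseteq> carrier R" "x \<in> S"
  shows "x \<in> rat_span (rat_alg R) S"
  unfolding rat_span_eq[OF assms(1)]
proof (intro CollectI exI conjI)
  show "x = (\<Oplus>x\<in>{x}. rat_emb 1 \<otimes> x)"
    using assms by auto
qed (use assms in auto)

lemma rat_span_zero: "S \<subseteq> carrier R \<Longrightarrow> \<zero> \<in> rat_span (rat_alg R) S"
  unfolding rat_span_eq by (intro CollectI exI[of _ "\<lambda>_. 0"] exI[of _ "{}"]) auto

lemma rat_span_add: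
  assumes S: "S \<subseteq> carrier R" and "x \<in> rat_span (rat_alg R) S" "y \<in> rat_span (rat_alg R) S"
  shows "x \<oplus> y \<in> rat_span (rat_alg R) S"
proof -
  obtain c F d G where x: "x = (\<Oplus>x\<in>F. rat_emb (c x) \<otimes> x)" "finite F" "F \<subseteq> S"
    and y: "y = (\<Oplus>x\<in>G. rat_emb (d x) \<otimes> x)" "finite G" "G \<subseteq> S"
    using assms(2,3) by (auto simp: rat_span_eq[OF S])
  have ext: "(\<Oplus>x\<in>F. rat_emb (c x) \<otimes> x) = (\<Oplus>x\<in>H. rat_emb (if x \<in> F then c x else 0) \<otimes> x)"
    if "finite H" "F \<subseteq> H" "H \<subseteq> S" for c :: "'a \<Rightarrow> rat" and F H
    using that S by (intro add.finprod_mono_neutral_cong_left) auto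
  have "x \<oplus> y = (\<Oplus>x\<in>F \<union> G. rat_emb (if x \<in> F then c x else 0) \<otimes> x)
      \<oplus> (\<Oplus>x\<in>F \<union> G. rat_emb (if x \<in> G then d x else 0) \<otimes> x)"
    unfolding x(1) y(1) using x y by (simp add: ext[of "F \<union> G" F] ext[of "F \<union> G" G])
  also have "\<dots> = (\<Oplus>x\<in>F \<union> G. rat_emb (if x \<in> F then c x else 0) \<otimes> x \<oplus> rat_emb (if x \<in> G then d x else 0) \<otimes> x)"
    using x y S by (intro finsum_addf[symmetric]) auto
  also have "\<dots> = (\<Oplus>x\<in>F \<union> G. rat_emb ((if x \<in> F then c x else 0) + (if x \<in> G then d x else 0)) \<otimes> x)"
    using x y S by (intro finsum_cong') (auto simp: rat_emb_add l_distr)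
  finally show ?thesis
    unfolding rat_span_eq[OF S] using x y
    by (intro CollectI exI[of _ "F \<union> G"] exI conjI) auto
qed

lemma rat_span_smult:
  assumes S: "S \<subseteq> carrier R" and "x \<in> rat_span (rat_alg R) S"
  shows "rat_emb c \<otimes> x \<in> rat_span (rat_alg R) S"
proof -
  obtain d F where x: "x = (\<Oplus>x\<in>F. rat_emb (d x) \<otimes> x)" "finite F" "F \<subseteq> S"
    using assms(2) by (auto simp: rat_span_eq[OF S])
  have "rat_emb c \<otimes> x = (\<Oplus>x\<in>F. rat_emb c \<otimes> (rat_emb (d x) \<otimes> x))"
    unfolding x(1) using x S by (intro finsum_rdistr) auto
  also have "\<dots> = (\<Oplus>x\<in>F. rat_emb (c * d x) \<otimes> x)"
    using x S by (intro finsum_cong') (auto simp: rat_emb_mult m_assoc)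
  finally show ?thesis
    unfolding rat_span_eq[OF S] using x
    by (intro CollectI exI[of _ F] exI conjI) auto
qed

lemma rat_span_uminus:
  assumes S: "S \<subseteq> carrier R" and x: "x \<in> rat_span (rat_alg R) S"
  shows "\<ominus> x \<in> rat_span (rat_alg R) S"
proof -
  have "x \<in> carrier R" using x rat_span_carrier[OF S] by auto
  have "rat_emb (- 1) = \<ominus> \<one>" using rat_emb_add[of "- 1" 1] by (intro minus_equality[symmetric]) auto
  then have "rat_emb (- 1) \<otimes> x = \<ominus> x" using \<open>x \<in> carrier R\<close> by (simp add: l_minus)
  with rat_span_smult[OF S x, of "- 1"] show ?thesis by simp
qed

lemma rat_span_induct [consumes 2, case_names zero smult add]:
  assumes S: "S \<subseteq> carrier R" and x: "x \<in> rat_span (rat_alg R) S"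
    and "P \<zero>" and "\<And>c x. x \<in> S \<Longrightarrow> P (rat_emb c \<otimes> x)"
    and add: "\<And>x y. x \<in> rat_span (rat_alg R) S \<Longrightarrow> y \<in> rat_span (rat_alg R) S \<Longrightarrow> P x \<Longrightarrow> P y \<Longrightarrow> P (x \<oplus> y)"
  shows "P x"
proof -
  obtain d F where x: "x = (\<Oplus>x\<in>F. rat_emb (d x) \<otimes> x)" "finite F" "F \<subseteq> S"
    using x by (auto simp: rat_span_eq[OF S])
  have "(\<Oplus>x\<in>F. rat_emb (d x) \<otimes> x) \<in> rat_span (rat_alg R) S \<and> P (\<Oplus>x\<in>F. rat_emb (d x) \<otimes> x)"
    using x(2,3)
  proof (induction F rule: finite_induct)
    case (insert y F)
    then have "y \<in> carrier R" "F \<subseteq> carrier R" using S by auto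
    then show ?case
      using insert S by (auto simp: rat_span_add rat_span_smult rat_span_incl subset_iff intro!: assms(4) add)
  qed (simp add: assms(3) rat_span_zero[OF S])
  then show ?thesis using x by simp
qed

lemma rat_span_mult:
  assumes S: "S \<subseteq> carrier R" and "x \<in> rat_span (rat_alg R) S" "y \<in> rat_span (rat_alg R) S"
    and prod: "\<And>x y. x \<in> S \<Longrightarrow> y \<in> S \<Longrightarrow> x \<otimes> y \<in> rat_span (rat_alg R) S"
  shows "x \<otimes> y \<in> rat_span (rat_alg R) S"
  using S assms(2)
proof (induction x rule: rat_span_induct)
  case zero
  then show ?case using assms(3) rat_span_carrier[OF S] by (auto simp: rat_span_zero[OF S])
next
  case (smult c x)
  have xc: "x \<in> carrier R" using smult S by auto
  have "x \<otimes> y \<in> rat_span (rat_alg R) S"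
    using S assms(3)
  proof (induction y rule: rat_span_induct)
    case (smult d y)
    then have "y \<in> carrier R" using S by auto
    then have "x \<otimes> (rat_emb d \<otimes> y) = rat_emb d \<otimes> (x \<otimes> y)" using xc by (simp add: m_lcomm)
    then show ?case using prod[OF \<open>x \<in> S\<close> smult] rat_span_smult[OF S] by simp
  next
    case (add y z)
    then show ?case using xc rat_span_carrier[OF S] by (auto simp: r_distr subset_iff intro!: rat_span_add[OF S])
  qed (use xc in \<open>simp add: rat_span_zero[OF S]\<close>)
  moreover have "y \<in> carrier R" using assms(3) rat_span_carrier[OF S] by auto
  ultimately show ?case using rat_span_smult[OF S] xc by (simp add: m_assoc)
next
  case (add x z)
  have "x \<in> carrier R" "y \<in> carrier R" "z \<in> carrier R" using add assms(3) rat_span_carrier[OF S] by auto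
  then show ?case using add by (auto simp: l_distr intro!: rat_span_add[OF S])
qed

lemma cring_rat_span:
  assumes S: "S \<subseteq> carrier R" "\<one> \<in> rat_span (rat_alg R) S"
    and prod: "\<And>x y. x \<in> S \<Longrightarrow> y \<in> S \<Longrightarrow> x \<otimes> y \<in> rat_span (rat_alg R) S"
  shows "cring ((rat_alg R)\<lparr>carrier := rat_span (rat_alg R) S\<rparr>)"
proof -
  interpret M: cring "rat_alg R" by (rule cring_rat_alg) (rule is_cring)
  have a_inv: "\<ominus>\<^bsub>rat_alg R\<^esub> x = \<ominus> x" if "x \<in> carrier R" for x
    using that by (intro M.minus_equality) (auto simp: l_neg)
  have "subring (rat_span (rat_alg R) S) (rat_alg R)"
    using assms rat_span_carrier[OF S(1)] rat_span_add[OF S(1)] rat_span_uminus[OF S(1)] rat_span_mult[OF S(1)]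
    by (intro M.subringI) (auto simp: a_inv)
  then show ?thesis
    by (intro M.subcring_iff[THEN iffD1] M.subcringI') (use rat_span_carrier[OF S(1)] in auto)
qed

end

section \<open>Homomorphisms of rational algebras\<close>

lemma ring_hom_int:
  fixes n :: int
  assumes "ring R" "ring S" "h \<in> ring_hom R S"
  shows "h ([n] \<cdot>\<^bsub>R\<^esub> \<one>\<^bsub>R\<^esub>) = [n] \<cdot>\<^bsub>S\<^esub> \<one>\<^bsub>S\<^esub>"
proof -
  interpret h: ring_hom_ring R S h by (rule ring_hom_ringI2[OF assms])
  show ?thesis
    using group_hom.hom_int_pow[OF h.a_group_hom, of "\<one>\<^bsub>R\<^esub>" n] by (simp add: add_pow_def)
qed

lemma ring_hom_rat_emb:
  assumes "rat_ring R" "rat_ring S" "h \<in> ring_hom R S"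
  shows "h (rat_ring.rat_emb R c) = rat_ring.rat_emb S c"
proof -
  interpret R: rat_ring R by fact
  interpret S: rat_ring S by fact
  interpret h: ring_hom_ring R S h by (rule ring_hom_ringI2[OF R.ring_axioms S.ring_axioms assms(3)])
  note int = ring_hom_int[OF R.ring_axioms S.ring_axioms assms(3)]
  obtain a b :: int where "0 < b" "c * of_int b = of_int a" "R.rat_emb c \<otimes>\<^bsub>R\<^esub> [b] \<cdot>\<^bsub>R\<^esub> \<one>\<^bsub>R\<^esub> = [a] \<cdot>\<^bsub>R\<^esub> \<one>\<^bsub>R\<^esub>"
    by (rule R.rat_emb_ex)
  then show ?thesis
    using h.hom_mult[of "R.rat_emb c" "[b] \<cdot>\<^bsub>R\<^esub> \<one>\<^bsub>R\<^esub>"]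
    by (intro S.rat_emb_unique[symmetric, of b c a]) (auto simp: int)
qed

text \<open>Equal kernels mean that \<open>f\<close> and \<open>g\<close> identify the same
  elements, so sending \<open>f x\<close> to \<open>g x\<close> is well defined and injective;
  surjectivity of the two maps makes it a bijection between the full carriers.\<close>

lemma rat_alg_iso_of_kernels_eq:
  assumes "ring A" "ring B" "ring C" and smult: "\<And>c x. x \<in> carrier A \<Longrightarrow> c \<odot>\<^bsub>A\<^esub> x \<in> carrier A"
    and f: "f \<in> rat_alg_hom A B" "f ` carrier A = carrier B"
    and g: "g \<in> rat_alg_hom A C" "g ` carrier A = carrier C"
    and ker: "a_kernel A C g = a_kernel A B f"
  shows "\<exists>k\<in>rat_alg_iso B C. \<forall>x\<in>carrier A. k (f x) = g x"
proof -
  interpret A: ring A by fact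
  interpret B: ring B by fact
  interpret C: ring C by fact
  have f': "\<And>x. x \<in> carrier A \<Longrightarrow> f x \<in> carrier B"
    "\<And>x y. x \<in> carrier A \<Longrightarrow> y \<in> carrier A \<Longrightarrow> f (x \<otimes>\<^bsub>A\<^esub> y) = f x \<otimes>\<^bsub>B\<^esub> f y"
    "\<And>x y. x \<in> carrier A \<Longrightarrow> y \<in> carrier A \<Longrightarrow> f (x \<oplus>\<^bsub>A\<^esub> y) = f x \<oplus>\<^bsub>B\<^esub> f y"
    "f \<one>\<^bsub>A\<^esub> = \<one>\<^bsub>B\<^esub>" "\<And>c x. x \<in> carrier A \<Longrightarrow> f (c \<odot>\<^bsub>A\<^esub> x) = c \<odot>\<^bsub>B\<^esub> f x"
    using f(1) by (auto simp: rat_alg_hom_def ring_hom_def)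
  have g': "\<And>x. x \<in> carrier A \<Longrightarrow> g x \<in> carrier C"
    "\<And>x y. x \<in> carrier A \<Longrightarrow> y \<in> carrier A \<Longrightarrow> g (x \<otimes>\<^bsub>A\<^esub> y) = g x \<otimes>\<^bsub>C\<^esub> g y"
    "\<And>x y. x \<in> carrier A \<Longrightarrow> y \<in> carrier A \<Longrightarrow> g (x \<oplus>\<^bsub>A\<^esub> y) = g x \<oplus>\<^bsub>C\<^esub> g y"
    "g \<one>\<^bsub>A\<^esub> = \<one>\<^bsub>C\<^esub>" "\<And>c x. x \<in> carrier A \<Longrightarrow> g (c \<odot>\<^bsub>A\<^esub> x) = c \<odot>\<^bsub>C\<^esub> g x"
    using g(1) by (auto simp: rat_alg_hom_def ring_hom_def)
  interpret f: ring_hom_ring A B f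
    using f by (intro ring_hom_ringI2 A.ring_axioms B.ring_axioms) (simp add: rat_alg_hom_def)
  interpret g: ring_hom_ring A C g
    using g by (intro ring_hom_ringI2 A.ring_axioms C.ring_axioms) (simp add: rat_alg_hom_def)
  have surj: "\<exists>x\<in>carrier A. y = f x" if "y \<in> carrier B" for y
    using that f(2) by auto
  have eq_iff: "f x = f y \<longleftrightarrow> g x = g y" if "x \<in> carrier A" "y \<in> carrier A" for x y
  proof -
    have "f (x \<ominus>\<^bsub>A\<^esub> y) = f x \<ominus>\<^bsub>B\<^esub> f y" "g (x \<ominus>\<^bsub>A\<^esub> y) = g x \<ominus>\<^bsub>C\<^esub> g y"
      using that by (simp_all add: a_minus_def)
    moreover have "f (x \<ominus>\<^bsub>A\<^esub> y) = \<zero>\<^bsub>B\<^esub> \<longleftrightarrow> g (x \<ominus>\<^bsub>A\<^esub> y) = \<zero>\<^bsub>C\<^esub>"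
      using ker A.minus_closed[OF that] unfolding a_kernel_def' by blast
    ultimately show ?thesis
      using B.r_right_minus_eq[OF f'(1) f'(1)] C.r_right_minus_eq[OF g'(1) g'(1)] that by simp
  qed
  define k where "k y = g (SOME x. x \<in> carrier A \<and> f x = y)" for y
  have k: "k (f x) = g x" if "x \<in> carrier A" for x
  proof -
    have "(SOME x'. x' \<in> carrier A \<and> f x' = f x) \<in> carrier A \<and> f (SOME x'. x' \<in> carrier A \<and> f x' = f x) = f x"
      using that by (rule_tac someI_ex) blast
    then show ?thesis using that eq_iff by (auto simp: k_def)
  qed
  have "k \<in> ring_hom B C"
  proof (rule ring_hom_memI)
    show "k y \<in> carrier C" if "y \<in> carrier B" for y
      using surj[OF that] k g'(1) by auto
    show "k (x \<otimes>\<^bsub>B\<^esub> y) = k x \<otimes>\<^bsub>C\<^esub> k y" if "x \<in> carrier B" "y \<in> carrier B" for x y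
    proof -
      from surj[OF that(1)] surj[OF that(2)]
      obtain x' y' where "x = f x'" "y = f y'" "x' \<in> carrier A" "y' \<in> carrier A" by blast
      then show ?thesis using k A.m_closed f'(2) g'(2) by metis
    qed
    show "k (x \<oplus>\<^bsub>B\<^esub> y) = k x \<oplus>\<^bsub>C\<^esub> k y" if "x \<in> carrier B" "y \<in> carrier B" for x y
    proof -
      from surj[OF that(1)] surj[OF that(2)]
      obtain x' y' where "x = f x'" "y = f y'" "x' \<in> carrier A" "y' \<in> carrier A" by blast
      then show ?thesis using k A.a_closed f'(3) g'(3) by metis
    qed
    show "k \<one>\<^bsub>B\<^esub> = \<one>\<^bsub>C\<^esub>" using k[OF A.one_closed] f'(4) g'(4) by simp
  qed
  moreover have "k (c \<odot>\<^bsub>B\<^esub> y) = c \<odot>\<^bsub>C\<^esub> k y" if "y \<in> carrier B" for c y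
  proof -
    obtain x where "y = f x" "x \<in> carrier A" using \<open>y \<in> carrier B\<close> f(2) by blast
    then show ?thesis using k smult f'(5) g'(5) by metis
  qed
  moreover have "bij_betw k (carrier B) (carrier C)"
    unfolding bij_betw_def
  proof
    show "inj_on k (carrier B)"
    proof (rule inj_onI)
      fix y z assume "y \<in> carrier B" "z \<in> carrier B" and e: "k y = k z"
      then obtain x w where "y = f x" "z = f w" "x \<in> carrier A" "w \<in> carrier A"
        using surj by metis
      then show "y = z" using e k eq_iff by auto
    qed
    show "k ` carrier B = carrier C"
      unfolding f(2)[symmetric] g(2)[symmetric] image_image using k by (intro image_cong) auto
  qed
  ultimately show ?thesis using k by (auto simp: rat_alg_iso_def rat_alg_hom_def)
qed

lemma rat_span_image:
  assumes R: "rat_ring R" and R': "rat_ring R'" and h: "h \<in> ring_hom R R'" and S: "S \<subseteq> carrier R"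
  shows "h ` rat_span (rat_alg R) S = rat_span (rat_alg R') (h ` S)"
proof -
  interpret R: rat_ring R by fact
  interpret R': rat_ring R' by fact
  interpret h: ring_hom_ring R R' h by (rule ring_hom_ringI2[OF R.ring_axioms R'.ring_axioms h])
  have S': "h ` S \<subseteq> carrier R'" using S by auto
  show ?thesis
  proof (intro equalityI subsetI)
    fix y assume "y \<in> h ` rat_span (rat_alg R) S"
    then obtain x where "x \<in> rat_span (rat_alg R) S" and y: "y = h x" by blast
    from S this(1) have "h x \<in> rat_span (rat_alg R') (h ` S)"
    proof (induction x rule: R.rat_span_induct)
      case (smult c x)
      then have "h (R.rat_emb c \<otimes>\<^bsub>R\<^esub> x) = R'.rat_emb c \<otimes>\<^bsub>R'\<^esub> h x"
        using S by (subst h.hom_mult) (auto simp: ring_hom_rat_emb[OF R R' h])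
      then show ?case using smult R'.rat_span_smult[OF S' R'.rat_span_incl[OF S'], of "h x" c] by auto
    next
      case (add x z)
      then have "h (x \<oplus>\<^bsub>R\<^esub> z) = h x \<oplus>\<^bsub>R'\<^esub> h z"
        using R.rat_span_carrier[OF S] by (intro h.hom_add) auto
      then show ?case using add R'.rat_span_add[OF S'] by simp
    qed (simp add: R'.rat_span_zero[OF S'])
    then show "y \<in> rat_span (rat_alg R') (h ` S)" using y by simp
  next
    fix y assume "y \<in> rat_span (rat_alg R') (h ` S)"
    with S' show "y \<in> h ` rat_span (rat_alg R) S"
    proof (induction y rule: R'.rat_span_induct)
      case zero
      show ?case by (rule image_eqI[of _ _ "\<zero>\<^bsub>R\<^esub>"]) (auto simp: R.rat_span_zero[OF S])
    next
      case (smult c y)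
      then obtain x where x: "x \<in> S" "y = h x" by blast
      then have "h (R.rat_emb c \<otimes>\<^bsub>R\<^esub> x) = R'.rat_emb c \<otimes>\<^bsub>R'\<^esub> y"
        using S by (subst h.hom_mult) (auto simp: ring_hom_rat_emb[OF R R' h])
      then show ?case
        using R.rat_span_smult[OF S R.rat_span_incl[OF S x(1)], of c] by (metis image_eqI)
    next
      case (add y y')
      then obtain x x' where x: "x \<in> rat_span (rat_alg R) S" "y = h x" "x' \<in> rat_span (rat_alg R) S" "y' = h x'" by blast
      then have "h (x \<oplus>\<^bsub>R\<^esub> x') = y \<oplus>\<^bsub>R'\<^esub> y'"
        using R.rat_span_carrier[OF S] h.hom_add[of x x'] by (auto simp: subset_iff)
      then show ?case using x R.rat_span_add[OF S, of x x'] by (metis image_eqI)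
    qed
  qed
qed

section \<open>Types as rational algebras\<close>

lemma ring_of_type_algebra_simps [simp]:
  "carrier ring_of_type_algebra = UNIV" "x \<otimes>\<^bsub>ring_of_type_algebra\<^esub> y = x * y"
  "\<one>\<^bsub>ring_of_type_algebra\<^esub> = 1" "\<zero>\<^bsub>ring_of_type_algebra\<^esub> = 0" "x \<oplus>\<^bsub>ring_of_type_algebra\<^esub> y = x + y"
  by (simp_all add: ring_of_type_algebra_def)

lemma int_ring_of_type_algebra:
  "[n] \<cdot>\<^bsub>ring_of_type_algebra\<^esub> (1 :: 'a::comm_ring_1) = of_int n"
proof -
  have nat: "[m] \<cdot>\<^bsub>ring_of_type_algebra\<^esub> (1 :: 'a) = of_nat m" for m :: nat
  proof (induction m)
    case (Suc m)
    have "[Suc m] \<cdot>\<^bsub>ring_of_type_algebra\<^esub> (1 :: 'a) = [m] \<cdot>\<^bsub>ring_of_type_algebra\<^esub> (1 :: 'a) + 1"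
      by (simp add: add_pow_def nat_pow_def)
    then show ?case by (simp only: Suc.IH of_nat_Suc ac_simps)
  qed (simp add: add_pow_def nat_pow_def)
  interpret cring "ring_of_type_algebra :: 'a ring" by (rule cring_from_type_algebra)
  have uminus: "\<ominus>\<^bsub>ring_of_type_algebra\<^esub> x = - x" for x :: 'a
    by (rule minus_equality) auto
  show ?thesis
  proof (cases "0 \<le> n")
    case True
    then show ?thesis by (simp only: add_pow_int_ge nat of_nat_nat)
  next
    case False
    then have "n < 0" "0 \<le> - n" by auto
    then show ?thesis by (simp only: add_pow_int_lt nat of_nat_nat uminus of_int_minus Groups.minus_minus)
  qed
qed

text \<open>A multiplicative map from the rationals that fixes the integers provides their inverses
  and is forced to be the structure map.\<close>

lemma rat_ring_type:
  fixes e :: "rat \<Rightarrow> 'a::comm_ring_1"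
  assumes "\<And>c d. e (c * d) = e c * e d" "\<And>n. e (of_int n) = of_int n"
  shows "rat_ring (ring_of_type_algebra :: 'a ring)" "rat_ring.rat_emb ring_of_type_algebra = e"
proof -
  show *: "rat_ring (ring_of_type_algebra :: 'a ring)"
    unfolding rat_ring_def rat_ring_axioms_def
  proof (intro conjI cring_from_type_algebra allI impI)
    fix n :: int assume "0 < n"
    then have "of_int n * e (1 / of_int n) = 1"
      using assms(1)[of "of_int n" "1 / of_int n"] assms(2)[of 1] assms(2)[of n] by simp
    then show "\<exists>y\<in>carrier ring_of_type_algebra. [n] \<cdot>\<^bsub>ring_of_type_algebra\<^esub> \<one>\<^bsub>ring_of_type_algebra\<^esub>
        \<otimes>\<^bsub>ring_of_type_algebra\<^esub> y = (\<one>\<^bsub>ring_of_type_algebra\<^esub> :: 'a)"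
      by (auto simp: int_ring_of_type_algebra)
  qed
  show "rat_ring.rat_emb ring_of_type_algebra = e"
  proof
    fix c
    obtain a b where q: "quotient_of c = (a, b)" by force
    have "0 < b" "c * of_int b = of_int a"
      using quotient_of_denom_pos[OF q] quotient_of_div[OF q] by auto
    then show "rat_ring.rat_emb ring_of_type_algebra c = e c"
      using assms(1)[of c "of_int b"] assms(2)
      by (intro rat_ring.rat_emb_unique[OF *, of b c a]) (auto simp: int_ring_of_type_algebra)
  qed
qed

lemmas rat_ring_real = rat_ring_type[of "of_rat :: rat \<Rightarrow> real", OF of_rat_mult of_rat_of_int_eq]

lemma rat_ring_poly:
  "rat_ring (ring_of_type_algebra :: real poly ring)"
  "rat_ring.rat_emb ring_of_type_algebra = (\<lambda>c. [:of_rat c :: real:])"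
  using rat_ring_type[of "\<lambda>c. [:of_rat c :: real:]"] by (simp_all add: of_rat_mult of_int_poly)

section \<open>The regularization homomorphism\<close>

definition lin_ext :: "(nat list \<Rightarrow> real poly) \<Rightarrow> (nat list \<Rightarrow>\<^sub>0 rat) \<Rightarrow> real poly" where
  "lin_ext f p = (\<Sum>w\<in>Poly_Mapping.keys p. Polynomial.smult (of_rat (Poly_Mapping.lookup p w)) (f w))"

lemma lin_ext_superset:
  assumes "finite S" "Poly_Mapping.keys p \<subseteq> S"
  shows "lin_ext f p = (\<Sum>w\<in>S. Polynomial.smult (of_rat (Poly_Mapping.lookup p w)) (f w))"
  unfolding lin_ext_def
  by (rule sum.mono_neutral_left) (use assms in \<open>auto simp: in_keys_iff\<close>)

lemma lin_ext_add: "lin_ext f (p + q) = lin_ext f p + lin_ext f q"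
proof -
  let ?S = "Poly_Mapping.keys p \<union> Poly_Mapping.keys q"
  have "lin_ext f r = (\<Sum>w\<in>?S. Polynomial.smult (of_rat (Poly_Mapping.lookup r w)) (f w))"
    if "Poly_Mapping.keys r \<subseteq> ?S" for r
    using that by (intro lin_ext_superset) auto
  moreover have "Poly_Mapping.keys (p + q) \<subseteq> ?S" by (rule Poly_Mapping.keys_add)
  ultimately show ?thesis
    by (simp add: lookup_add of_rat_add smult_add_left sum.distrib)
qed

lemma lin_ext_zero [simp]: "lin_ext f 0 = 0"
  by (simp add: lin_ext_def)

lemma lin_ext_sum: "lin_ext f (\<Sum>i\<in>I. p i) = (\<Sum>i\<in>I. lin_ext f (p i))"
  by (induction I rule: infinite_finite_induct) (auto simp: lin_ext_add)

lemma lin_ext_word [simp]: "lin_ext f (word w) = f w"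
  by (simp add: lin_ext_def word_def)

lemma lookup_scale: "Poly_Mapping.lookup (scale c p) w = c * Poly_Mapping.lookup p w"
  by (simp add: scale_def Poly_Mapping.map.rep_eq when_def)

lemma lin_ext_scale: "lin_ext f (scale c p) = Polynomial.smult (of_rat c) (lin_ext f p)"
proof -
  have "lin_ext f (scale c p)
      = (\<Sum>w\<in>Poly_Mapping.keys p. Polynomial.smult (of_rat (Poly_Mapping.lookup (scale c p) w)) (f w))"
    by (intro lin_ext_superset) (auto simp: in_keys_iff lookup_scale)
  moreover have "Polynomial.smult a (\<Sum>w\<in>S. g w) = (\<Sum>w\<in>S. Polynomial.smult a (g w))" for a S and g :: "nat list \<Rightarrow> real poly"
    by (induction S rule: infinite_finite_induct) (auto simp: smult_add_right)
  ultimately show ?thesis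
    by (simp add: lookup_scale lin_ext_def of_rat_mult)
qed

lemma lookup_prepend:
  "Poly_Mapping.lookup (prepend k p) w = (if w \<noteq> [] \<and> hd w = k then Poly_Mapping.lookup p (tl w) else 0)"
proof -
  have "Poly_Mapping.lookup (prepend k p) w
      = (\<Sum>v\<in>Poly_Mapping.keys p. if k # v = w then Poly_Mapping.lookup p v else 0)"
    by (auto simp: prepend_def lookup_sum lookup_scale word_def lookup_single when_def intro!: sum.cong)
  also have "\<dots> = (\<Sum>v\<in>Poly_Mapping.keys p. if v = tl w \<and> w \<noteq> [] \<and> hd w = k then Poly_Mapping.lookup p v else 0)"
    by (intro sum.cong) auto
  also have "\<dots> = (if w \<noteq> [] \<and> hd w = k then Poly_Mapping.lookup p (tl w) else 0)"
    by (auto simp: in_keys_iff)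
  finally show ?thesis .
qed

lemma stuffle_words_eq: "stuffle_words u v = stuf word u v"
proof (induction u v rule: stuffle_words.induct)
  case (3 k u l v)
  have "prepend k (stuf word u v) = stuf (\<lambda>w. word (k # w)) u v" for k u v
  proof -
    have "prepend k (word w) = word (k # w)" for w
    proof (rule poly_mapping_eqI)
      show "Poly_Mapping.lookup (prepend k (word w)) v = Poly_Mapping.lookup (word (k # w)) v" for v
        by (cases v) (auto simp: lookup_prepend word_def lookup_single when_def)
    qed
    moreover have "prepend k (p + q) = prepend k p + prepend k q" for p q
      by (rule poly_mapping_eqI) (auto simp: lookup_prepend lookup_add)
    moreover have "prepend k 0 = 0"
      by (rule poly_mapping_eqI) (auto simp: lookup_prepend)
    ultimately show ?thesis
      using quasi_hom[of "prepend k" "\<lambda>_. 0" "\<lambda>_. 0" word u v] by simp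
  qed
  with 3 show ?case by simp
qed auto

lemma lin_ext_stuffle_words: "lin_ext f (stuffle_words u v) = stuf f u v"
  unfolding stuffle_words_eq
  using quasi_hom[of "lin_ext f" "\<lambda>_. 0" "\<lambda>_. 0" word u v] by (simp add: lin_ext_add)

lemma lin_ext_stuffle:
  assumes "p \<in> carrier stuffle_alg" "q \<in> carrier stuffle_alg"
    and "\<And>u v. is_index u \<Longrightarrow> is_index v \<Longrightarrow> stuf f u v = f u * f v"
  shows "lin_ext f (stuffle p q) = lin_ext f p * lin_ext f q"
proof -
  have "lin_ext f (stuffle p q) = (\<Sum>u\<in>Poly_Mapping.keys p. \<Sum>v\<in>Poly_Mapping.keys q.
     Polynomial.smult (of_rat (Poly_Mapping.lookup p u * Poly_Mapping.lookup q v)) (stuf f u v))"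
    by (simp add: stuffle_def lin_ext_sum lin_ext_scale lin_ext_stuffle_words)
  also have "\<dots> = (\<Sum>u\<in>Poly_Mapping.keys p. \<Sum>v\<in>Poly_Mapping.keys q.
     Polynomial.smult (of_rat (Poly_Mapping.lookup p u)) (f u) * Polynomial.smult (of_rat (Poly_Mapping.lookup q v)) (f v))"
    using assms by (intro sum.cong refl) (auto simp: stuffle_alg_def of_rat_mult mult.commute)
  finally show ?thesis by (simp only: lin_ext_def sum_product)
qed

lemma stuffle_alg_simps [simp]:
  "p \<otimes>\<^bsub>stuffle_alg\<^esub> q = stuffle p q" "\<one>\<^bsub>stuffle_alg\<^esub> = word []" "\<zero>\<^bsub>stuffle_alg\<^esub> = 0"
  "p \<oplus>\<^bsub>stuffle_alg\<^esub> q = p + q" "c \<odot>\<^bsub>stuffle_alg\<^esub> p = scale c p"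
  by (simp_all add: stuffle_alg_def)

lemma word_carrier: "word w \<in> carrier stuffle_alg \<longleftrightarrow> is_index w"
  by (simp add: stuffle_alg_def word_def)

lemma stuffle_alg_closed:
  "p \<in> carrier stuffle_alg \<Longrightarrow> q \<in> carrier stuffle_alg \<Longrightarrow> p + q \<in> carrier stuffle_alg"
  "p \<in> carrier stuffle_alg \<Longrightarrow> scale c p \<in> carrier stuffle_alg"
  "0 \<in> carrier stuffle_alg"
  using Poly_Mapping.keys_add[of p q] by (auto simp: stuffle_alg_def in_keys_iff lookup_scale)

lemma stuffle_alg_sum:
  "(\<And>i. i \<in> I \<Longrightarrow> p i \<in> carrier stuffle_alg) \<Longrightarrow> (\<Sum>i\<in>I. p i) \<in> carrier stuffle_alg"
  by (induction I rule: infinite_finite_induct) (auto simp: stuffle_alg_closed)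

lemma poly_mapping_eq_sum_words:
  "p = (\<Sum>w\<in>Poly_Mapping.keys p. scale (Poly_Mapping.lookup p w) (word w))"
  by (rule poly_mapping_eqI)
    (auto simp: lookup_sum lookup_scale word_def lookup_single when_def in_keys_iff if_distrib cong: if_cong)

lemma scale_1 [simp]: "scale 1 p = p"
  by (rule poly_mapping_eqI) (simp add: lookup_scale)

lemma stuffle_word: "stuffle (word u) (word v) = stuf word u v"
  by (simp add: stuffle_def stuffle_words_eq) (simp add: word_def)

text \<open>The condition inside the definite description of \<open>regularization\<close>, named so
  that existence and uniqueness can be stated separately.\<close>

definition regularization_map :: "((nat list \<Rightarrow>\<^sub>0 rat) \<Rightarrow> real poly) \<Rightarrow> bool" where
  "regularization_map R \<longleftrightarrow> R \<in> extensional (carrier stuffle_alg) \<and>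
     R \<in> rat_alg_hom stuffle_alg (rat_alg ring_of_type_algebra) \<and>
     R (word [1]) = [:0, 1:] \<and> (\<forall>ks. admissible ks \<longrightarrow> R (word ks) = [:mzv ks:])"

lemma regularization_map_lin_ext:
  "regularization_map (restrict (lin_ext reg_poly) (carrier stuffle_alg))"
  unfolding regularization_map_def
proof (intro conjI allI impI)
  let ?R = "restrict (lin_ext reg_poly) (carrier stuffle_alg)"
  have stuffle_closed: "stuffle p q \<in> carrier stuffle_alg"
    if "p \<in> carrier stuffle_alg" "q \<in> carrier stuffle_alg" for p q
  proof -
    have "stuffle_words u v \<in> carrier stuffle_alg" if "is_index u" "is_index v" for u v
      unfolding stuffle_words_eq using that
      by (intro stuf_closed) (auto simp: stuffle_alg_closed word_carrier)
    then show ?thesis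
      unfolding stuffle_def using that
      by (intro stuffle_alg_sum stuffle_alg_closed) (auto simp: stuffle_alg_def)
  qed
  show "?R \<in> rat_alg_hom stuffle_alg (rat_alg ring_of_type_algebra)"
    unfolding rat_alg_hom_def
  proof (intro CollectI conjI ballI allI ring_hom_memI)
    show "?R (p \<otimes>\<^bsub>stuffle_alg\<^esub> q) = ?R p \<otimes>\<^bsub>rat_alg ring_of_type_algebra\<^esub> ?R q"
      if "p \<in> carrier stuffle_alg" "q \<in> carrier stuffle_alg" for p q
      using that stuffle_closed[OF that] lin_ext_stuffle[OF that, of reg_poly] reg_poly_mult
      by simp
  qed (auto simp: word_carrier stuffle_alg_closed lin_ext_add lin_ext_scale
      rat_ring.smult_rat_alg[OF rat_ring_poly(1)] rat_ring_poly(2))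
qed (auto simp: word_carrier reg_poly_1[simplified] admissible_def reg_poly_admissible)

text \<open>The elements on which two candidates agree satisfy the closure conditions of
  \<open>stuf_induct\<close>, so agreement spreads from the admissible words and the word 1 to all
  index words. Linearity covers the carrier, extensionality the rest.\<close>

lemma regularization_map_unique:
  assumes "regularization_map R" "regularization_map R'"
  shows "R = R'"
proof
  fix p
  have hom: "R \<in> ring_hom stuffle_alg (rat_alg ring_of_type_algebra)"
      "\<And>c p. p \<in> carrier stuffle_alg \<Longrightarrow> R (scale c p) = Polynomial.smult (of_rat c) (R p)"
    if "regularization_map R" for R
    using that unfolding regularization_map_def rat_alg_hom_def
    by (auto simp: rat_ring.smult_rat_alg[OF rat_ring_poly(1)] rat_ring_poly(2))
  have add: "R (p + q) = R p + R q" and mult: "R (stuffle p q) = R p * R q"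
    if "regularization_map R" "p \<in> carrier stuffle_alg" "q \<in> carrier stuffle_alg" for R p q
    using ring_hom_add[OF hom(1)[OF that(1)] that(2,3)] ring_hom_mult[OF hom(1)[OF that(1)] that(2,3)] by simp_all
  note h = hom(2)[OF assms(1)] hom(2)[OF assms(2)] add[OF assms(1)] add[OF assms(2)] mult[OF assms(1)] mult[OF assms(2)]
  let ?A = "{p \<in> carrier stuffle_alg. R p = R' p}"
  have zero: "R 0 = R' 0"
    using h(3,4)[OF stuffle_alg_closed(3) stuffle_alg_closed(3)] by simp
  have words: "word w \<in> ?A" if "is_index w" for w
    using that
  proof (rule stuf_induct[rotated -1])
    show "0 \<in> ?A" using zero stuffle_alg_closed(3) by simp
    show "x + y \<in> ?A" if "x \<in> ?A" "y \<in> ?A" for x y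
      using that by (simp add: h stuffle_alg_closed)
    show "x - y \<in> ?A" if "x \<in> ?A" "y \<in> ?A" for x y
    proof -
      have e: "x - y = x + scale (- 1) y" by (rule poly_mapping_eqI) (simp add: lookup_add lookup_minus lookup_scale)
      show ?thesis unfolding e using that by (simp add: h stuffle_alg_closed)
    qed
    show "x \<in> ?A" if "(\<Sum>i\<le>n. x) \<in> ?A" for n :: nat and x
    proof -
      have *: "x = scale (1 / of_nat (Suc n)) (\<Sum>i\<le>n. x)"
        by (rule poly_mapping_eqI) (simp add: lookup_sum lookup_scale field_simps)
      show ?thesis by (subst (1) *) (use that in \<open>simp add: h stuffle_alg_closed\<close>)
    qed
    show "word w \<in> ?A" if "admissible w" for w
      using that assms by (auto simp: regularization_map_def word_carrier admissible_def)
    show "stuf word [1] w \<in> ?A" if "is_index w" "word w \<in> ?A" for w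
    proof -
      have "stuf word [1] w \<in> carrier stuffle_alg"
        using that by (intro stuf_closed) (auto simp: stuffle_alg_closed word_carrier)
      moreover have "word [1] \<in> ?A" using assms by (auto simp: regularization_map_def word_carrier)
      ultimately show ?thesis using that h(5,6)[of "word [1]" "word w"] by (simp add: stuffle_word)
    qed
  qed
  have sums: "(\<Sum>i\<in>I. scale (c i) (word i)) \<in> ?A" if "\<And>i. i \<in> I \<Longrightarrow> is_index i" for I c
    using that
  proof (induction I rule: infinite_finite_induct)
    case (insert i I)
    then show ?case using words[of i] by (simp add: h stuffle_alg_closed)
  qed (use zero in \<open>auto simp: stuffle_alg_closed\<close>)
  show "R p = R' p"
  proof (cases "p \<in> carrier stuffle_alg")
    case True
    then have "(\<Sum>w\<in>Poly_Mapping.keys p. scale (Poly_Mapping.lookup p w) (word w)) \<in> ?A"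
      by (intro sums) (simp add: stuffle_alg_def)
    then have "p \<in> ?A" unfolding poly_mapping_eq_sum_words[symmetric] .
    then show ?thesis by simp
  next
    case False
    then show ?thesis using assms by (auto simp: regularization_map_def extensional_def)
  qed
qed

lemma reg_mzv_eq:
  assumes "is_index ks"
  shows "reg_mzv ks = reg_poly ks"
proof -
  have "regularization = restrict (lin_ext reg_poly) (carrier stuffle_alg)"
    unfolding regularization_def regularization_map_def[symmetric]
    by (rule the_equality) (auto intro: regularization_map_lin_ext regularization_map_unique)
  from fun_cong[OF this, of "word ks"] show ?thesis using assms by (simp add: reg_mzv_def word_carrier)
qed

lemma zeta_S_eq:
  assumes "is_index ks"
  shows "zeta_S ks = symm_val ks"
proof -
  have "(\<Sum>a\<le>length ks. (-1) ^ sum_list (take a ks) * reg_mzv (rev (take a ks)) * reg_mzv (drop a ks))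
      = [:symm_val ks:]"
    using assms by (simp add: reg_mzv_eq flip: symm_poly_def symm_poly_eq)
  then show ?thesis by (simp add: zeta_S_def)
qed

section \<open>Shuffle products\<close>

text \<open>\<open>shuf f u v\<close> is the value on the shuffle product of \<open>u\<close> and \<open>v\<close> of the additive extension of \<open>f\<close>.\<close>

fun shuf :: "('l list \<Rightarrow> 'v::comm_monoid_add) \<Rightarrow> 'l list \<Rightarrow> 'l list \<Rightarrow> 'v" where
  "shuf f [] v = f v"
| "shuf f (a # u) [] = f (a # u)"
| "shuf f (a # u) (b # v) = shuf (\<lambda>w. f (a # w)) u (b # v) + shuf (\<lambda>w. f (b # w)) (a # u) v"

lemma shuf_Nil2 [simp]: "shuf f u [] = f u"
  by (cases u) auto

lemma shuf_Nil1 [simp]: "shuf f [] = f"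
  by auto

lemma shuf_closed:
  assumes "\<And>x y. x \<in> A \<Longrightarrow> y \<in> A \<Longrightarrow> x + y \<in> A" and "\<And>w. w \<in> shuffles u v \<Longrightarrow> f w \<in> A"
  shows "shuf f u v \<in> A"
  using assms(2) by (induction f u v rule: shuf.induct) (auto intro!: assms(1))

lemma shuf_cong: "(\<And>w. w \<in> shuffles u v \<Longrightarrow> f w = g w) \<Longrightarrow> shuf f u v = shuf g u v"
proof (induction u v arbitrary: f g rule: shuffles.induct)
  case (3 a u b v)
  have "shuf (\<lambda>w. f (a # w)) u (b # v) = shuf (\<lambda>w. g (a # w)) u (b # v)"
    and "shuf (\<lambda>w. f (b # w)) (a # u) v = shuf (\<lambda>w. g (b # w)) (a # u) v"
    by (intro 3; use 3(3) in force)+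
  then show ?case by simp
qed auto

lemma shuf_hom:
  assumes "\<And>x y. h (x + y) = h x + h y"
  shows "h (shuf f u v) = shuf (\<lambda>w. h (f w)) u v"
  by (induction f u v rule: shuf.induct) (simp_all add: assms)

lemma shuf_add: "shuf (\<lambda>w. f w + g w) u v = shuf f u v + shuf g u v"
proof (induction "\<lambda>w. f w + g w" u v arbitrary: f g rule: shuf.induct)
  case (3 a u b v)
  then show ?case by (simp add: 3(1)[of "\<lambda>w. f (a # w)"] 3(2)[of "\<lambda>w. f (b # w)"] add_ac)
qed auto

lemma shuf_comm: "shuf f u v = shuf f v u"
  by (induction f u v rule: shuf.induct) (simp_all add: add.commute)

text \<open>Both sides are expanded by the origin of the first letter, which is \<open>a\<close>,
  \<open>b\<close> or \<open>c\<close>; each of the three groups is an instance for a shorter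
  triple.\<close>

lemma shuf_assoc:
  fixes f :: "'l list \<Rightarrow> 'v::comm_monoid_add"
  shows "shuf (\<lambda>w. shuf f w c) a b = shuf (\<lambda>w. shuf f a w) b c"
proof (induction "length a + length b + length c" arbitrary: a b c f rule: less_induct)
  case less
  show ?case
  proof (cases "a = [] \<or> b = [] \<or> c = []")
    case False
    then obtain x a' y b' z c' where abc: "a = x # a'" "b = y # b'" "c = z # c'"
      by (metis list.exhaust)
    have IH1: "shuf (\<lambda>w. shuf f w c') a b = shuf (\<lambda>w. shuf f a w) b c'" for f :: "'l list \<Rightarrow> 'v"
      by (rule less) (simp add: abc)
    have IH2: "shuf (\<lambda>w. shuf f w c) a' b = shuf (\<lambda>w. shuf f a' w) b c" for f :: "'l list \<Rightarrow> 'v"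
      by (rule less) (simp add: abc)
    have IH3: "shuf (\<lambda>w. shuf f w c) a b' = shuf (\<lambda>w. shuf f a w) b' c" for f :: "'l list \<Rightarrow> 'v"
      by (rule less) (simp add: abc)
    let ?f = "\<lambda>x w. f (x # w)"
    have "shuf (\<lambda>w. shuf f w c) a b
        = (shuf (\<lambda>w. shuf (?f x) w c) a' b + shuf (\<lambda>w. shuf (?f z) (x # w) c') a' b)
        + (shuf (\<lambda>w. shuf (?f y) w c) a b' + shuf (\<lambda>w. shuf (?f z) (y # w) c') a b')"
      by (simp add: abc shuf_add)
    also have "\<dots> = shuf (\<lambda>w. shuf (?f x) a' w) b c + shuf (\<lambda>w. shuf (?f y) a w) b' c
        + shuf (\<lambda>w. shuf (?f z) w c') a b"
      unfolding IH2 IH3 by (simp add: abc add_ac)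
    also have "\<dots> = shuf (\<lambda>w. shuf f a w) b c"
      unfolding IH1 by (simp add: abc shuf_add add_ac)
    finally show ?thesis .
  qed auto
qed

text \<open>The recursion splits off first letters; splitting off last letters as well is what makes
  the shuffle product commute with reversal.\<close>

lemma shuf_snoc:
  "shuf f (u @ [a]) (v @ [b]) = shuf (\<lambda>w. f (w @ [a])) u (v @ [b]) + shuf (\<lambda>w. f (w @ [b])) (u @ [a]) v"
proof (induction "length u + length v" arbitrary: u v f rule: less_induct)
  case less
  show ?case
  proof (cases u; cases v)
    assume "u = []" "v = []"
    then show ?thesis by (simp add: add.commute)
  next
    fix y v' assume uv: "u = []" "v = y # v'"
    have "shuf (\<lambda>w. f (y # w)) ([] @ [a]) (v' @ [b]) = shuf (\<lambda>w. f (y # w @ [a])) [] (v' @ [b])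
        + shuf (\<lambda>w. f (y # w @ [b])) ([] @ [a]) v'"
      by (rule less) (simp add: uv)
    then show ?thesis by (simp add: uv add_ac)
  next
    fix x u' assume uv: "u = x # u'" "v = []"
    have "shuf (\<lambda>w. f (x # w)) (u' @ [a]) ([] @ [b]) = shuf (\<lambda>w. f (x # w @ [a])) u' ([] @ [b])
        + shuf (\<lambda>w. f (x # w @ [b])) (u' @ [a]) []"
      by (rule less) (simp add: uv)
    then show ?thesis by (simp add: uv add_ac)
  next
    fix x u' y v' assume uv: "u = x # u'" "v = y # v'"
    have "shuf (\<lambda>w. f (x # w)) (u' @ [a]) (v @ [b]) = shuf (\<lambda>w. f (x # w @ [a])) u' (v @ [b])
        + shuf (\<lambda>w. f (x # w @ [b])) (u' @ [a]) v"
      by (rule less) (simp add: uv)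
    moreover have "shuf (\<lambda>w. f (y # w)) (u @ [a]) (v' @ [b]) = shuf (\<lambda>w. f (y # w @ [a])) u (v' @ [b])
        + shuf (\<lambda>w. f (y # w @ [b])) (u @ [a]) v'"
      by (rule less) (simp add: uv)
    ultimately show ?thesis by (simp add: uv add_ac)
  qed
qed

lemma shuf_rev: "shuf f (rev u) (rev v) = shuf (\<lambda>w. f (rev w)) u v"
proof (induction u v arbitrary: f rule: shuffles.induct)
  case (3 a u b v)
  from 3(1)[of "\<lambda>w. f (w @ [a])"] 3(2)[of "\<lambda>w. f (w @ [b])"] show ?case by (simp add: shuf_snoc)
qed auto

lemma shuf_map: "shuf f (map g u) (map g v) = shuf (\<lambda>w. f (map g w)) u v"
  by (induction u v arbitrary: f rule: shuffles.induct) auto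

lemma shuf_single_append:
  "shuf f [c] (u @ d # v) = shuf (\<lambda>w. f (w @ d # v)) [c] u + shuf (\<lambda>w. f (u @ d # w)) [c] v"
proof (induction u arbitrary: f)
  case (Cons b u)
  from Cons[of "\<lambda>w. f (b # w)"] show ?case by (simp add: add_ac)
qed auto

lemma shuf_single_replicate: "shuf f [c] (replicate a c) = (\<Sum>i\<le>a. f (replicate (Suc a) c))"
proof (induction a arbitrary: f)
  case (Suc a)
  from Suc[of "\<lambda>w. f (c # w)"] show ?case by (simp add: add.commute)
qed auto

lemma shuffles_singleE:
  assumes "w \<in> shuffles [c] y"
  obtains y1 y2 where "w = y1 @ c # y2" "y = y1 @ y2"
  using assms
proof (induction y arbitrary: w thesis)
  case Nil
  then show ?case by (metis append_Nil shuffles.simps(2) singletonD)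
next
  case (Cons b y)
  then consider "w = c # b # y" | w' where "w = b # w'" "w' \<in> shuffles [c] y" by auto
  then show ?case
  proof cases
    case 1
    then show ?thesis using Cons.prems(1)[of "[]" "b # y"] by simp
  next
    case 2
    then obtain y1 y2 where "w' = y1 @ c # y2" "y = y1 @ y2" using Cons.IH by blast
    then show ?thesis using Cons.prems(1)[of "b # y1" y2] 2 by simp
  qed
qed

text \<open>
  The shuffle analogue of \<open>stuf_induct\<close>: the shuffle algebra is generated by the letter \<open>c\<close> over
  the words that do not start with \<open>c\<close>.
\<close>

lemma shuf_induct:
  fixes g :: "'l list \<Rightarrow> 'v::ab_group_add"
  assumes A: "0 \<in> A" "\<And>x y. x \<in> A \<Longrightarrow> y \<in> A \<Longrightarrow> x + y \<in> A" "\<And>x y. x \<in> A \<Longrightarrow> y \<in> A \<Longrightarrow> x - y \<in> A"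
    and divide: "\<And>n x. (\<Sum>i\<le>(n::nat). x) \<in> A \<Longrightarrow> x \<in> A"
    and W: "\<And>u v. u @ v \<in> W \<Longrightarrow> u @ c # v \<in> W" "\<And>w. c # w \<in> W \<Longrightarrow> w \<in> W"
    and base: "\<And>w. w \<in> W \<Longrightarrow> w = [] \<or> hd w \<noteq> c \<Longrightarrow> g w \<in> A"
    and step: "\<And>w. w \<in> W \<Longrightarrow> g w \<in> A \<Longrightarrow> shuf g [c] w \<in> A"
    and "w \<in> W"
  shows "g w \<in> A"
proof -
  have *: "g (replicate a c @ v) \<in> A" if "replicate a c @ v \<in> W" "v = [] \<or> hd v \<noteq> c" for a v
    using that
  proof (induction a arbitrary: v)
    case (Suc a)
    have W': "replicate a c @ v \<in> W" using Suc.prems(1) W(2) by simp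
    have 1: "shuf g [c] (replicate a c @ v) \<in> A" by (intro step W' Suc.IH Suc.prems)
    have "(\<Sum>i\<le>a. g (replicate (Suc a) c @ v)) \<in> A"
    proof (cases v)
      case Nil
      then show ?thesis using 1 by (simp add: shuf_single_replicate)
    next
      case (Cons d y)
      \<comment> \<open>Insertions to the right of \<open>d\<close> leave only a leading copies of
        \<open>c\<close>, so the induction hypothesis covers them.\<close>
      have "shuf (\<lambda>w. g (replicate a c @ d # w)) [c] y \<in> A"
      proof (rule shuf_closed[OF A(2)])
        fix w assume "w \<in> shuffles [c] y"
        then obtain y1 y2 where y: "w = y1 @ c # y2" "y = y1 @ y2"
          using shuffles_singleE by metis
        have "replicate a c @ d # w \<in> W"
          using W(1)[of "replicate a c @ d # y1" y2] W' y Cons by simp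
        then show "g (replicate a c @ d # w) \<in> A" using Suc Cons by simp
      qed
      from A(3)[OF 1 this] show ?thesis
        by (simp add: Cons shuf_single_append shuf_single_replicate)
    qed
    then show ?case by (rule divide)
  qed (use base in auto)
  let ?t = "takeWhile (\<lambda>x. x = c) w" and ?d = "dropWhile (\<lambda>x. x = c) w"
  have "replicate (length ?t) c = ?t" by (rule replicate_length_same) (auto dest: set_takeWhileD)
  then have "w = replicate (length ?t) c @ ?d" by simp
  moreover have "?d = [] \<or> hd ?d \<noteq> c" using hd_dropWhile[of "\<lambda>x. x = c" w] by auto
  ultimately show ?thesis using *[of "length ?t" ?d] \<open>w \<in> W\<close> by simp
qed

section \<open>Functionals vanishing on shuffle products\<close>

text \<open>A functional on the shuffle algebra modulo products of nonempty words. The value on the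
  empty word stays free, since no such product contains it.\<close>

definition kills :: "('l list \<Rightarrow> 'v::comm_monoid_add) \<Rightarrow> bool" where
  "kills f \<longleftrightarrow> (\<forall>u v. u \<noteq> [] \<longrightarrow> v \<noteq> [] \<longrightarrow> shuf f u v = 0)"

text \<open>The shuffle of c u with a v vanishes and splits by its first letter, so a letter crosses
  from one side of \<open>a\<close> to the other at the cost of a sign.\<close>

lemma kills_rev:
  fixes f :: "'l list \<Rightarrow> real"
  assumes "kills f"
  shows "f (rev u @ a # v) = (- 1) ^ length u * shuf (\<lambda>w. f (a # w)) u v"
proof (induction u arbitrary: a v)
  case (Cons c u)
  have "f (rev (c # u) @ a # v) = f (rev u @ c # (a # v))" by simp
  also have "\<dots> = (- 1) ^ length u * shuf (\<lambda>w. f (c # w)) u (a # v)" by (rule Cons.IH)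
  also have "shuf (\<lambda>w. f (c # w)) u (a # v) = - shuf (\<lambda>w. f (a # w)) (c # u) v"
    using assms[unfolded kills_def, rule_format, of "c # u" "a # v"] by simp
  finally show ?case by simp
qed simp

text \<open>The antipode identity of the shuffle Hopf algebra: signed reversal is the convolution
  inverse of the identity. The first letter of each term is the last letter \<open>d\<close> or the
  first letter \<open>c\<close> of \<open>x\<close>, and each choice leaves the same identity for a
  word with one letter less.\<close>

lemma shuf_antipode:
  fixes g :: "'l list \<Rightarrow> real"
  assumes "x \<noteq> []"
  shows "(\<Sum>i\<le>length x. (- 1) ^ (length x - i) * shuf g (rev (drop i x)) (take i x)) = 0"
  using assms
proof (induction "length x" arbitrary: x g)
  case (Suc n)
  obtain c y where y: "x = c # y" using Suc.prems by (cases x) auto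
  obtain z d where z: "x = z @ [d]" using Suc.prems by (cases x rule: rev_cases) auto
  show ?case
  proof (cases "n = 0")
    case True
    then show ?thesis using Suc(2) y by simp
  next
    case False
    have len_y: "length y = n" using Suc(2) y by simp
    have len_z: "length z = n" using Suc(2) z by simp
    note len = len_y len_z
    let ?s = "\<lambda>i. (- 1) ^ (Suc n - i) :: real"
    let ?P = "\<lambda>i. shuf (\<lambda>w. g (d # w)) (rev (drop i z)) (take i z)"
    let ?Q = "\<lambda>i. shuf (\<lambda>w. g (c # w)) (rev (drop i y)) (take i y)"
    have "(\<Sum>i\<le>Suc n. ?s i * shuf g (rev (drop i x)) (take i x))
        = (\<Sum>i\<le>Suc n. ?s i * ((if i \<le> n then ?P i else 0) + (if i = 0 then 0 else ?Q (i - 1))))"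
    proof (intro sum.cong refl arg_cong2[where f = "(*)"])
      fix i assume i: "i \<in> {..Suc n}"
      consider "i = 0" | "0 < i" "i \<le> n" | "i = Suc n" using i by fastforce
      then show "shuf g (rev (drop i x)) (take i x)
          = (if i \<le> n then ?P i else 0) + (if i = 0 then 0 else ?Q (i - 1))"
      proof cases
        case 1
        then show ?thesis using z by simp
      next
        case 2
        then obtain j where j: "i = Suc j" by (cases i) auto
        have 1: "rev (drop i x) = d # rev (drop i z)" "take i x = take i z" using 2 len z by simp_all
        have 3: "take i x = c # take j y" "rev (drop i x) = rev (drop j y)" using y j by simp_all
        have "shuf g (rev (drop i x)) (take i x) = shuf (\<lambda>w. g (d # w)) (rev (drop i z)) (take i x)
            + shuf (\<lambda>w. g (c # w)) (rev (drop i x)) (take j y)"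
          unfolding 1(1) 3(1) by simp
        also have "\<dots> = ?P i + ?Q j" unfolding 3(2) unfolding 1(2) ..
        finally show ?thesis using 2 j by simp
      next
        case 3
        have "drop i x = []" "take i x = c # y" using y len 3 by simp_all
        then show ?thesis using len 3 by simp
      qed
    qed
    also have "\<dots> = (\<Sum>i\<le>Suc n. ?s i * (if i \<le> n then ?P i else 0)) + (\<Sum>i\<le>Suc n. ?s i * (if i = 0 then 0 else ?Q (i - 1)))"
      by (simp add: distrib_left sum.distrib)
    also have "(\<Sum>i\<le>Suc n. ?s i * (if i \<le> n then ?P i else 0)) = - (\<Sum>i\<le>n. (- 1) ^ (n - i) * ?P i)"
      by (simp add: sum_negf[symmetric] Suc_diff_le)
    also have "(\<Sum>i\<le>Suc n. ?s i * (if i = 0 then 0 else ?Q (i - 1))) = (\<Sum>i\<le>n. (- 1) ^ (n - i) * ?Q i)"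
      by (subst sum.atMost_Suc_shift) simp
    also have "(\<Sum>i\<le>n. (- 1) ^ (n - i) * ?P i) = 0"
      using Suc(1)[of z "\<lambda>w. g (d # w)"] len False by fastforce
    also have "(\<Sum>i\<le>n. (- 1) ^ (n - i) * ?Q i) = 0"
      using Suc(1)[of y "\<lambda>w. g (c # w)"] len False by fastforce
    finally show ?thesis using Suc(2) by simp
  qed
qed auto

text \<open>\<open>kills_rev\<close> turns each rotation of \<open>a # x\<close> into a signed
  shuffle, and their sum is the antipode identity for the functional that prepends
  \<open>a\<close>.\<close>

lemma kills_cyclic_sum:
  fixes f :: "'l list \<Rightarrow> real"
  assumes "kills f" "x \<noteq> []"
  shows "(\<Sum>i\<le>length x. f (drop i x @ a # take i x)) = 0"
proof -
  have "f (drop i x @ a # take i x) = (- 1) ^ (length x - i) * shuf (\<lambda>w. f (a # w)) (rev (drop i x)) (take i x)" for i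
    using kills_rev[OF assms(1), of "rev (drop i x)"] by simp
  then show ?thesis using shuf_antipode[OF assms(2)] by simp
qed

text \<open>All rotations take the same value, so their vanishing sum is n times \<open>f w\<close>.
  A single letter is no product and is not constrained, hence n \<ge> 2.\<close>

lemma kills_cyclic_0:
  fixes f :: "'l list \<Rightarrow> real"
  assumes "kills f" and cyc: "\<And>b x. Suc (length x) = n \<Longrightarrow> f (x @ [b]) = f (b # x)"
    and "length w = n" "2 \<le> n"
  shows "f w = 0"
proof -
  obtain a x where w: "w = a # x" "x \<noteq> []" using assms(3,4) by (cases w; cases "tl w") auto
  have rot: "f (u @ v) = f (v @ u)" if "length (u @ v) = n" for u v
    using that
  proof (induction u arbitrary: v)
    case (Cons b u)
    have "f ((b # u) @ v) = f ((u @ v) @ [b])" using Cons.prems cyc[of "u @ v" b] by simp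
    also have "\<dots> = f ((v @ [b]) @ u)" using Cons.IH[of "v @ [b]"] Cons.prems by simp
    finally show ?case by simp
  qed simp
  have "f (drop i x @ a # take i x) = f w" for i
    using rot[of "drop i x" "a # take i x"] assms(3) w by simp
  then show ?thesis using kills_cyclic_sum[OF assms(1) w(2), of a] by simp
qed

section \<open>Extension to words ending in \<open>False\<close>\<close>

text \<open>With \<open>True\<close> for dx / (1 - x) and \<open>False\<close> for dx / x, these are
  the words whose iterated integral from 0 converges.\<close>

definition ends_True :: "bool list set" where
  "ends_True = {w. w = [] \<or> last w}"

lemma ends_True_simps [simp]:
  "[] \<in> ends_True" "w @ [b] \<in> ends_True \<longleftrightarrow> b" "w @ a # v \<in> ends_True \<longleftrightarrow> a # v \<in> ends_True"
  "w \<noteq> [] \<Longrightarrow> a # w \<in> ends_True \<longleftrightarrow> w \<in> ends_True" "[a] \<in> ends_True \<longleftrightarrow> a"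
  by (auto simp: ends_True_def)

lemma ends_True_Cons: "a # w \<in> ends_True \<Longrightarrow> w \<in> ends_True"
  by (cases w) auto

lemma ends_True_shuffles: "w \<in> shuffles u v \<Longrightarrow> u \<in> ends_True \<Longrightarrow> v \<in> ends_True \<Longrightarrow> w \<in> ends_True"
proof (induction u v arbitrary: w rule: shuffles.induct)
  case (3 a u b v)
  then obtain w' where w: "w = a # w' \<and> w' \<in> shuffles u (b # v) \<or> w = b # w' \<and> w' \<in> shuffles (a # u) v"
    by auto
  then have "w' \<noteq> []" by (auto dest: length_shuffles)
  moreover have "w' \<in> ends_True" using w 3 by (auto dest: ends_True_Cons)
  ultimately show ?case using w by auto
qed auto

text \<open>Regularization at 0: the value on x 1 0^b is (-1)^b times that of (x shuffled with 0^b)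
  followed by 1. This is forced by the demand that shuffling with the letter 0 gives zero. Words
  without the letter 1 get the value 0.\<close>

fun False_ext :: "(bool list \<Rightarrow> real) \<Rightarrow> bool list \<Rightarrow> real" where
  "False_ext f w = (let b = length (takeWhile Not (rev w)) in
     if b = length w then 0
     else (- 1) ^ b * shuf (\<lambda>y. f (y @ [True])) (take (length w - Suc b) w) (replicate b False))"

declare False_ext.simps [simp del]

lemma False_ext_replicate: "False_ext f (replicate b False) = 0"
  by (simp add: False_ext.simps)

lemma False_ext_append:
  "False_ext f (x @ True # replicate b False)
     = (- 1) ^ b * shuf (\<lambda>y. f (y @ [True])) x (replicate b False)"
  by (simp add: False_ext.simps takeWhile_append)

lemma False_ext_eq: "w \<in> ends_True \<Longrightarrow> w \<noteq> [] \<Longrightarrow> False_ext f w = f w"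
  using False_ext_append[of f "butlast w" 0] by (cases w rule: rev_cases) auto

text \<open>Inserting 0 before the last 1 changes x, inserting it after that changes b. By
  associativity and commutativity both contributions are the shuffle of x, 0 and 0^b, with opposite
  signs.\<close>

lemma False_ext_shuf_False: "shuf (False_ext f) [False] w = 0"
proof (cases "\<exists>b. w = replicate b False")
  case True
  then obtain b where b: "w = replicate b False" ..
  show ?thesis using False_ext_replicate[of f "Suc b"] by (simp add: b shuf_single_replicate)
next
  case False
  have "(\<exists>b. w = replicate b False) \<or> (\<exists>x b. w = x @ True # replicate b False)"
  proof (induction w rule: rev_induct)
    case (snoc a w)
    show ?case
    proof (cases a)
      case True
      then have "w @ [a] = w @ True # replicate 0 False" by simp
      then show ?thesis by blast
    next
      case False
      from snoc.IH show ?thesis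
      proof (elim disjE exE)
        fix b assume "w = replicate b False"
        then have "w @ [a] = replicate (Suc b) False" using False by (simp add: replicate_append_same)
        then show ?thesis by blast
      next
        fix x b assume "w = x @ True # replicate b False"
        then have "w @ [a] = x @ True # replicate (Suc b) False" using False by (simp add: replicate_append_same)
        then show ?thesis by blast
      qed
    qed
  qed auto
  with False obtain x b where w: "w = x @ True # replicate b False" by blast
  let ?h = "\<lambda>y. f (y @ [True])"
  have "shuf (False_ext f) [False] w = shuf (\<lambda>y. (- 1) ^ b * shuf ?h y (replicate b False)) [False] x
      + shuf (\<lambda>y. False_ext f (x @ True # y)) [False] (replicate b False)"
    by (simp add: w shuf_single_append False_ext_append)
  also have "shuf (\<lambda>y. (- 1) ^ b * shuf ?h y (replicate b False)) [False] x
      = (- 1) ^ b * shuf (\<lambda>y. shuf ?h y (replicate b False)) [False] x"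
    by (rule shuf_hom[symmetric]) (rule distrib_left)
  also have "shuf (\<lambda>y. False_ext f (x @ True # y)) [False] (replicate b False)
     = (\<Sum>i\<le>b. (- 1) ^ Suc b * shuf ?h x (replicate (Suc b) False))"
    by (simp only: shuf_single_replicate False_ext_append)
  also have "\<dots> = (- 1) ^ Suc b * shuf (\<lambda>w. shuf ?h x w) [False] (replicate b False)"
    by (simp only: shuf_single_replicate sum_distrib_left)
  also have "shuf (\<lambda>w. shuf ?h x w) [False] (replicate b False) = shuf (\<lambda>y. shuf ?h y (replicate b False)) [False] x"
    by (subst shuf_assoc[symmetric]) (rule shuf_comm)
  finally show ?thesis by simp
qed

lemma trailing_induct:
  fixes g :: "bool list \<Rightarrow> real"
  assumes "\<And>w. w \<in> ends_True \<Longrightarrow> g w = 0" and "\<And>w. shuf g [False] w = 0"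
  shows "g w = 0"
proof -
  have "g (rev (rev w)) \<in> {0}"
  proof (rule shuf_induct[where g = "\<lambda>w. g (rev w)" and c = False and W = UNIV])
    show "shuf (\<lambda>w. g (rev w)) [False] w \<in> {0}" for w
      using assms(2)[of "rev w"] shuf_rev[of g "[False]" w] by simp
    show "g (rev w) \<in> {0}" if "w = [] \<or> hd w \<noteq> False" for w
      using that assms(1)[of "rev w"] by (cases w) auto
  qed auto
  then show ?thesis by simp
qed

text \<open>The hypothesis covers words ending in \<open>True\<close>. Trailing zeros are removed
  from one argument after the other, since by associativity shuffling 0 into an argument gives zero;
  the value 0 on empty arguments makes \<open>trailing_induct\<close> applicable in each
  variable.\<close>

lemma kills_False_ext:
  assumes "\<And>u v. u \<in> ends_True \<Longrightarrow> v \<in> ends_True \<Longrightarrow> u \<noteq> [] \<Longrightarrow> v \<noteq> [] \<Longrightarrow> shuf f u v = 0"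
  shows "kills (False_ext f)"
proof -
  let ?g = "\<lambda>u v. if u = [] \<or> v = [] then 0 else shuf (False_ext f) u v"
  have step: "shuf (\<lambda>u. ?g u v) [False] u = 0" for u v
  proof (cases "v = []")
    case False
    have "shuf (\<lambda>u. ?g u v) [False] u = shuf (\<lambda>u. shuf (False_ext f) u v) [False] u"
      using False by (intro shuf_cong) (auto dest: length_shuffles)
    also have "\<dots> = shuf (\<lambda>w. shuf (False_ext f) [False] w) u v" by (rule shuf_assoc)
    also have "\<dots> = 0" unfolding False_ext_shuf_False using shuf_hom[of "\<lambda>_. 0 :: real" "\<lambda>_. 0" u v] by simp
    finally show ?thesis .
  qed (use shuf_hom[of "\<lambda>_. 0 :: real" "\<lambda>_. 0" "[False]" u] in simp)
  have sym: "?g u v = ?g v u" for u v using shuf_comm[of "False_ext f" u v] by auto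
  have 1: "?g u v = 0" if "u \<in> ends_True" "v \<in> ends_True" for u v
  proof (cases "u = [] \<or> v = []")
    case False
    have "shuf (False_ext f) u v = shuf f u v"
      using that False
      by (intro shuf_cong False_ext_eq) (auto intro: ends_True_shuffles)
    then show ?thesis using assms that False by simp
  qed auto
  have 2: "?g u v = 0" if "v \<in> ends_True" for u v
    by (rule trailing_induct) (use 1 that step in auto)
  have "?g u v = 0" for u v
    by (rule trailing_induct[of "\<lambda>u. ?g u v"]) (use 2 sym step in metis)+
  then show ?thesis unfolding kills_def by metis
qed

text \<open>Shuffling with \<open>False\<close> removes trailing zeros, shuffling with
  \<open>True\<close> removes leading ones; a word 0 x 1 or a single letter remains. The guard in
  the proof replaces the unconstrained value on the empty word by 0.\<close>

lemma kills_determined: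
  fixes f :: "bool list \<Rightarrow> real"
  assumes "kills f" "f [True] = 0" "f [False] = 0" and adm: "\<And>x. f (False # x @ [True]) = 0" and "w \<noteq> []"
  shows "f w = 0"
proof -
  let ?g = "\<lambda>w. if w = [] then 0 else f w"
  have step: "shuf ?g [b] w = 0" for b w
  proof (cases "w = []")
    case False
    then have "shuf ?g [b] w = shuf f [b] w" by (intro shuf_cong) (auto dest: length_shuffles)
    then show ?thesis using assms(1) False by (simp add: kills_def)
  qed (use assms in \<open>cases b; simp\<close>)
  have "?g w \<in> {0}" if "w \<in> ends_True" for w
  proof (rule shuf_induct[where g = ?g and c = True and W = ends_True])
    show "u @ True # v \<in> ends_True" if "u @ v \<in> ends_True" for u v
      using that by (cases v) auto
    show "?g w \<in> {0}" if "w \<in> ends_True" "w = [] \<or> hd w \<noteq> True" for w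
    proof (cases w)
      case (Cons a y)
      then have a: "\<not> a" "y \<noteq> []" using that by auto
      then obtain z b where y: "y = z @ [b]" by (cases y rule: rev_cases) auto
      then have "b" using that(1) Cons ends_True_simps(2)[of "a # z" b] by simp
      then show ?thesis using adm[of z] a y Cons by simp
    qed simp
    show "shuf ?g [True] w \<in> {0}" for w using step[of True w] by blast
    show "w \<in> ends_True" if "True # w \<in> ends_True" for w using that by (rule ends_True_Cons)
  qed (use that in simp_all)
  from singletonD[OF this] have base: "?g v = 0" if "v \<in> ends_True" for v using that .
  have "?g w = 0" by (rule trailing_induct[of ?g, OF base step])
  then show ?thesis using \<open>w \<noteq> []\<close> by (simp only: if_False)
qed

section \<open>Multiple polylogarithms\<close>

text \<open>
  Since \<open>harm_sum\<close> accumulates the coefficients of the usual series \<open>\<Sum> z\<^bsup>m\<^sub>1\<^esup> / m\<^sub>1\<^bsup>k\<^sub>1\<^esup> \<cdots> m\<^sub>r\<^bsup>k\<^sub>r\<^esup>\<close>,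
  multiplication by \<open>1 - z\<close> recovers it, including the empty index.
\<close>

definition polylog :: "nat list \<Rightarrow> real \<Rightarrow> real" where
  "polylog ks z = (1 - z) * (suminf (\<lambda>n. harm_sum ks n * z ^ n))"

lemma summable_linear_bound:
  fixes z :: real
  assumes "\<And>n. \<bar>a n\<bar> \<le> C * (real n + 1)" "\<bar>z\<bar> < 1"
  shows "summable (\<lambda>n. a n * z ^ n)"
proof (rule summable_comparison_test')
  have "summable (\<lambda>n. of_nat (Suc n) * \<bar>z\<bar> ^ n)"
    using geometric_deriv_sums[of "\<bar>z\<bar>"] assms(2) by (auto simp: sums_iff)
  then show "summable (\<lambda>n. C * (of_nat (Suc n) * \<bar>z\<bar> ^ n))" by (rule summable_mult)
  fix n
  have "norm (a n * z ^ n) = \<bar>a n\<bar> * \<bar>z\<bar> ^ n" by (simp add: abs_mult power_abs)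
  also have "\<dots> \<le> (C * (real n + 1)) * \<bar>z\<bar> ^ n" by (intro mult_right_mono assms) auto
  finally show "norm (a n * z ^ n) \<le> C * (of_nat (Suc n) * \<bar>z\<bar> ^ n)" by (simp add: mult_ac add_ac)
qed

lemma harm_sum_linear_bound:
  assumes "is_index ks"
  shows "\<exists>C\<ge>0. \<forall>n. harm_sum ks n \<le> C * (real n + 1)"
proof -
  obtain C where C: "0 \<le> C" "\<And>n. harm n ^ length ks \<le> C * sqrt (real n + 1)"
    using harm_pow_le_sqrt by blast
  have "harm_sum ks n \<le> C * (real n + 1)" for n
  proof -
    have "harm_sum ks n \<le> C * sqrt (real n + 1)" using harm_sum_le[OF assms, of n] C(2)[of n] by simp
    also have "\<dots> \<le> C * (real n + 1)" using C(1) by (intro mult_left_mono real_le_lsqrt) (auto simp: power2_eq_square)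
    finally show ?thesis .
  qed
  then show ?thesis using C(1) by blast
qed

lemma summable_harm_sum:
  assumes "is_index ks" "\<bar>z\<bar> < 1"
  shows "summable (\<lambda>n. harm_sum ks n * z ^ n)"
proof -
  obtain C where C: "\<And>n. harm_sum ks n \<le> C * (real n + 1)"
    using harm_sum_linear_bound[OF assms(1)] by blast
  show ?thesis
    by (rule summable_linear_bound[of _ C, OF _ assms(2)]) (simp add: C abs_of_nonneg harm_sum_nonneg)
qed

lemma polylog_Nil:
  assumes "\<bar>z\<bar> < 1"
  shows "polylog [] z = 1"
  using assms suminf_geometric[of z] by (simp add: polylog_def)

text \<open>The coefficient of z^n in the usual series: m_1 = n keeps the other indices below n,
  hence \<open>harm_sum ks m\<close> with m = n - 1.\<close>

definition polylog_coeff :: "nat \<Rightarrow> nat list \<Rightarrow> nat \<Rightarrow> real" where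
  "polylog_coeff k ks n = (case n of 0 \<Rightarrow> 0 | Suc m \<Rightarrow> inverse (real n ^ k) * harm_sum ks m)"

lemma summable_polylog_coeff:
  assumes "is_index ks" "\<bar>z\<bar> < 1"
  shows "summable (\<lambda>n. polylog_coeff k ks n * z ^ n)"
proof -
  obtain C where C: "0 \<le> C" "\<And>n. harm_sum ks n \<le> C * (real n + 1)"
    using harm_sum_linear_bound[OF assms(1)] by blast
  have "\<bar>polylog_coeff k ks n\<bar> \<le> C * (real n + 1)" for n
  proof (cases n)
    case (Suc m)
    have "inverse (real n ^ k) * harm_sum ks m \<le> 1 * (C * (real m + 1))"
      using C Suc by (intro mult_mono C(2)) (auto intro!: harm_sum_nonneg simp: inverse_le_1_iff one_le_power)
    also have "\<dots> \<le> C * (real n + 1)" using C(1) Suc by (simp add: mult_left_mono)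
    finally show ?thesis using Suc by (simp add: polylog_coeff_def abs_mult harm_sum_nonneg)
  qed (simp add: polylog_coeff_def C)
  then show ?thesis using assms(2) by (rule summable_linear_bound)
qed

lemma polylog_Cons:
  assumes "is_index (k # ks)" "\<bar>z\<bar> < 1"
  shows "polylog (k # ks) z = (suminf (\<lambda>n. polylog_coeff k ks n * z ^ n))"
proof -
  let ?H = "harm_sum (k # ks)"
  have S: "summable (\<lambda>n. ?H n * z ^ n)" by (rule summable_harm_sum[OF assms])
  have S': "summable (\<lambda>n. ?H (Suc n) * z ^ Suc n)" using S by (subst summable_Suc_iff)
  have S'': "summable (\<lambda>n. z * (?H n * z ^ n))" using S by (rule summable_mult)
  have "(suminf (\<lambda>n. ?H n * z ^ n)) = (suminf (\<lambda>n. ?H (Suc n) * z ^ Suc n))"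
    using suminf_split_head[OF S] by simp
  moreover have "z * (suminf (\<lambda>n. ?H n * z ^ n)) = (suminf (\<lambda>n. z * (?H n * z ^ n)))"
    using S by (rule suminf_mult[symmetric])
  ultimately have "polylog (k # ks) z = (suminf (\<lambda>n. ?H (Suc n) * z ^ Suc n - z * (?H n * z ^ n)))"
    using suminf_diff[OF S' S''] by (simp add: polylog_def left_diff_distrib)
  also have "\<dots> = (suminf (\<lambda>n. polylog_coeff k ks (Suc n) * z ^ Suc n))"
    by (simp add: polylog_coeff_def algebra_simps)
  also have "\<dots> = (suminf (\<lambda>n. polylog_coeff k ks n * z ^ n))"
    using suminf_split_head[OF summable_polylog_coeff[of ks z k]] assms by (simp add: polylog_coeff_def)
  finally show ?thesis .
qed

lemma DERIV_polylog:
  assumes "is_index (k # ks)" "\<bar>x\<bar> < 1"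
  shows "(polylog (k # ks) has_real_derivative (suminf (\<lambda>n. inverse (real (Suc n) ^ (k - 1)) * harm_sum ks n * x ^ n))) (at x)"
proof -
  obtain K where K: "\<bar>x\<bar> < K" "K < 1" using dense assms(2) by blast
  have "diffs (polylog_coeff k ks) n = inverse (real (Suc n) ^ (k - 1)) * harm_sum ks n" for n
    using assms(1) by (cases k) (simp_all add: diffs_def polylog_coeff_def del: of_nat_Suc)
  then have "((\<lambda>x. suminf (\<lambda>n. polylog_coeff k ks n * x ^ n)) has_real_derivative
      (suminf (\<lambda>n. inverse (real (Suc n) ^ (k - 1)) * harm_sum ks n * x ^ n))) (at x)"
    using termdiffs_strong[of "polylog_coeff k ks" K x] summable_polylog_coeff[of ks K k] assms(1) K by simp
  moreover have "eventually (\<lambda>x. polylog (k # ks) x = (suminf (\<lambda>n. polylog_coeff k ks n * x ^ n))) (nhds x)"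
    using assms by (intro eventually_nhds_in_open[of "{-1<..<1}", THEN eventually_mono]) (auto intro!: polylog_Cons)
  ultimately show ?thesis by (subst DERIV_cong_ev[OF refl _ refl])
qed

lemma DERIV_polylog_1:
  assumes "is_index ks" "\<bar>x\<bar> < 1"
  shows "(polylog (1 # ks) has_real_derivative polylog ks x / (1 - x)) (at x)"
  using DERIV_polylog[of 1 ks x] assms by (simp add: polylog_def)

lemma DERIV_polylog_Suc:
  assumes "is_index (k # ks)" "\<bar>x\<bar> < 1" "x \<noteq> 0"
  shows "(polylog (Suc k # ks) has_real_derivative polylog (k # ks) x / x) (at x)"
proof -
  have "polylog (k # ks) x = (suminf (\<lambda>n. polylog_coeff k ks (Suc n) * x ^ Suc n))"
    using polylog_Cons[OF assms(1,2)] suminf_split_head[OF summable_polylog_coeff[of ks x k]] assms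
    by (simp add: polylog_coeff_def)
  also have "\<dots> = (suminf (\<lambda>n. x * (inverse (real (Suc n) ^ k) * harm_sum ks n * x ^ n)))"
    by (simp add: polylog_coeff_def mult_ac)
  also have "\<dots> = x * (suminf (\<lambda>n. inverse (real (Suc n) ^ k) * harm_sum ks n * x ^ n))"
  proof (rule suminf_mult)
    have "summable (\<lambda>n. polylog_coeff k ks (Suc n) * x ^ Suc n)"
      using summable_polylog_coeff[of ks x k] assms by (subst summable_Suc_iff) auto
    then have "summable (\<lambda>n. x * (inverse (real (Suc n) ^ k) * harm_sum ks n * x ^ n))"
      by (simp add: polylog_coeff_def mult_ac)
    then show "summable (\<lambda>n. inverse (real (Suc n) ^ k) * harm_sum ks n * x ^ n)"
      using assms(3) by (subst (asm) summable_cmult_iff) auto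
  qed
  finally show ?thesis
    using DERIV_polylog[of "Suc k" ks x] assms by simp
qed

lemma polylog_0: "polylog (k # ks) 0 = 0"
  using powser_zero[of "harm_sum (k # ks)"] by (simp add: polylog_def)

subsection \<open>Words\<close>

text \<open>A trailing block of \<open>False\<close> is dropped, so this inverts
  \<open>index_word\<close> only on \<open>ends_True\<close>.\<close>

fun word_index :: "bool list \<Rightarrow> nat list" where
  "word_index [] = []"
| "word_index (True # w) = 1 # word_index w"
| "word_index (False # w) = (case word_index w of [] \<Rightarrow> [] | k # ks \<Rightarrow> Suc k # ks)"

definition polylog_word :: "bool list \<Rightarrow> real \<Rightarrow> real" where
  "polylog_word w = polylog (word_index w)"

definition kernel_form :: "bool \<Rightarrow> real \<Rightarrow> real" where
  "kernel_form b x = (if b then 1 / (1 - x) else 1 / x)"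

lemma is_index_word_index: "is_index (word_index w)"
  by (induction w rule: word_index.induct) (auto split: list.splits)

lemma word_index_eq_Nil: "w \<in> ends_True \<Longrightarrow> word_index w = [] \<longleftrightarrow> w = []"
proof (induction w rule: word_index.induct)
  case (3 w)
  then have "w \<noteq> []" "w \<in> ends_True" by (auto intro: ends_True_Cons)
  with 3 show ?case by (auto split: list.splits)
qed auto

lemma DERIV_polylog_word:
  assumes "b # w \<in> ends_True" "0 < x" "x < 1"
  shows "(polylog_word (b # w) has_real_derivative kernel_form b x * polylog_word w x) (at x)"
proof (cases b)
  case True
  then show ?thesis
    using DERIV_polylog_1[OF is_index_word_index[of w], of x] assms by (simp add: polylog_word_def kernel_form_def)
next
  case False
  then have "w \<noteq> []" "w \<in> ends_True" using assms(1) by (auto intro: ends_True_Cons)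
  then obtain k ks where k: "word_index w = k # ks" using word_index_eq_Nil by (cases "word_index w") auto
  have "is_index (k # ks)" using is_index_word_index[of w] k by simp
  then show ?thesis
    using DERIV_polylog_Suc[of k ks x] False k assms by (simp add: polylog_word_def kernel_form_def)
qed

lemma polylog_word_Nil: "\<bar>z\<bar> < 1 \<Longrightarrow> polylog_word [] z = 1"
  by (simp add: polylog_word_def polylog_Nil)

lemma polylog_word_0:
  assumes "w \<in> ends_True" "w \<noteq> []"
  shows "polylog_word w 0 = 0"
  using assms word_index_eq_Nil[of w] by (cases "word_index w") (auto simp: polylog_word_def polylog_0)

lemma differentiable_polylog:
  assumes "is_index ks" "\<bar>x\<bar> < 1"
  shows "\<exists>D. (polylog ks has_real_derivative D) (at x)"
proof (cases ks)
  case Nil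
  have "eventually (\<lambda>x. polylog [] x = 1) (nhds x)"
    using assms by (intro eventually_nhds_in_open[of "{-1<..<1}", THEN eventually_mono]) (auto intro!: polylog_Nil)
  then have "(polylog [] has_real_derivative 0) (at x)" by (subst DERIV_cong_ev[OF refl _ refl]) auto
  then show ?thesis using Nil by auto
next
  case (Cons k ls)
  then show ?thesis using DERIV_polylog[of k ls x] assms by auto
qed

lemma isCont_polylog_word: "\<bar>x\<bar> < 1 \<Longrightarrow> isCont (polylog_word w) x"
  using differentiable_polylog[OF is_index_word_index[of w]] DERIV_isCont unfolding polylog_word_def by blast

text \<open>For nonempty words both sides vanish at 0 and have the same derivative on the open
  interval: the product rule splits by the factor just as a shuffle splits by its first letter, and
  the induction hypothesis does the rest.\<close>

lemma polylog_word_shuf: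
  assumes "u \<in> ends_True" "v \<in> ends_True" "0 \<le> z" "z < 1"
  shows "polylog_word u z * polylog_word v z = shuf polylog_word u v z"
  using assms
proof (induction "length u + length v" arbitrary: u v z rule: less_induct)
  case less
  note IH = less.hyps
  show ?case
  proof (cases "u = [] \<or> v = []")
    case True
    then show ?thesis using less.prems by (auto simp: polylog_word_Nil)
  next
    case False
    then obtain a u' b v' where uv: "u = a # u'" "v = b # v'" by (meson list.exhaust)
    define D where "D x = polylog_word u x * polylog_word v x - shuf polylog_word u v x" for x
    \<comment> \<open>The last condition excludes the word \<open>[False]\<close>, whose integral
      diverges at 0.\<close>
    have shuf_deriv: "(shuf (\<lambda>w. polylog_word (c # w)) u'' v'' has_real_derivative
        kernel_form c x * (polylog_word u'' x * polylog_word v'' x)) (at x)"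
      if "0 < x" "x < 1" "length u'' + length v'' < length u + length v" "u'' \<in> ends_True" "v'' \<in> ends_True"
        "u'' \<noteq> [] \<or> v'' \<noteq> [] \<or> c" for c u'' v'' x
    proof -
      let ?A = "{(f, D). (f has_real_derivative D) (at x)}"
      let ?p = "shuf (\<lambda>w. (polylog_word (c # w), kernel_form c x * polylog_word w x)) u'' v''"
      have "?p \<in> ?A"
      proof (rule shuf_closed)
        fix w assume w: "w \<in> shuffles u'' v''"
        then have "c # w \<in> ends_True"
          using that(4-6) ends_True_shuffles[OF w] by (cases w) (auto dest: length_shuffles)
        then show "(polylog_word (c # w), kernel_form c x * polylog_word w x) \<in> ?A"
          using DERIV_polylog_word that(1,2) by simp
      qed (auto simp: plus_fun_def intro: DERIV_add)
      moreover have "fst ?p = shuf (\<lambda>w. polylog_word (c # w)) u'' v''"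
        by (subst shuf_hom[where h = fst]) auto
      moreover have "snd ?p = kernel_form c x * (polylog_word u'' x * polylog_word v'' x)"
      proof -
        have "snd ?p = shuf (\<lambda>w. kernel_form c x * polylog_word w x) u'' v''"
          by (subst shuf_hom[where h = snd]) auto
        also have "\<dots> = kernel_form c x * shuf polylog_word u'' v'' x"
          by (rule shuf_hom[symmetric, where h = "\<lambda>f. kernel_form c x * f x"]) (simp add: distrib_left)
        also have "shuf polylog_word u'' v'' x = polylog_word u'' x * polylog_word v'' x"
          using that by (intro IH[symmetric]) auto
        finally show ?thesis .
      qed
      ultimately show ?thesis by (simp add: case_prod_unfold)
    qed
    have u'v': "u' \<in> ends_True" "v' \<in> ends_True" using less.prems uv by (auto intro: ends_True_Cons)
    have D': "(D has_real_derivative 0) (at x)" if x: "0 < x" "x < 1" for x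
    proof -
      have "(D has_real_derivative
          (kernel_form a x * polylog_word u' x * polylog_word v x + kernel_form b x * polylog_word v' x * polylog_word u x)
          - (kernel_form a x * (polylog_word u' x * polylog_word v x) + kernel_form b x * (polylog_word u x * polylog_word v' x))) (at x)"
        unfolding D_def[abs_def] uv shuf.simps plus_fun_apply
        using x less.prems u'v' uv
        by (intro DERIV_diff DERIV_mult DERIV_add DERIV_polylog_word shuf_deriv[unfolded uv]) auto
      then show ?thesis by (simp add: algebra_simps)
    qed
    have cont: "isCont D x" if "0 \<le> x" "x < 1" for x
    proof -
      have "isCont (shuf polylog_word u v) x"
        using shuf_closed[of "{f. isCont f x}" u v polylog_word] that
        by (auto simp: plus_fun_def isCont_polylog_word)
      then show ?thesis
        unfolding D_def[abs_def] using that by (intro continuous_intros isCont_polylog_word) auto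
    qed
    have D0: "D 0 = 0"
    proof -
      have "shuf polylog_word u v \<in> {f. f 0 = 0}"
      proof (rule shuf_closed)
        fix w assume "w \<in> shuffles u v"
        then show "polylog_word w \<in> {f. f 0 = 0}"
          using ends_True_shuffles[of w u v] less.prems uv
          by (auto dest: length_shuffles intro!: polylog_word_0)
      qed auto
      then show ?thesis using polylog_word_0[of u] less.prems uv by (simp add: D_def)
    qed
    have "D z = 0"
    proof (cases "z = 0")
      case False
      then have "D z = D 0"
        using less.prems by (intro DERIV_isconst_end[of 0 z D]) (auto intro!: D' cont continuous_at_imp_continuous_on)
      then show ?thesis using D0 by simp
    qed (use D0 in simp)
    then show ?thesis by (simp add: D_def)
  qed
qed

section \<open>Behaviour of polylogarithms at \<open>1\<close>\<close>

abbreviation neg_log :: "real \<Rightarrow> real" where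
  "neg_log z \<equiv> - ln (1 - z)"

lemma eventually_at_left_1: "eventually (\<lambda>z::real. 0 < z \<and> z < 1) (at_left 1)"
  using eventually_at_left_real[of 0 1] by (auto elim: eventually_mono)

lemma filterlim_neg_log: "filterlim neg_log at_top (at_left 1)"
  by real_asymp

lemma neg_log_series:
  assumes "0 \<le> z" "z < 1"
  shows "(\<lambda>n. z ^ Suc n / real (Suc n)) sums neg_log z"
proof -
  have "(\<lambda>n. - ((- (- z)) ^ n) / real n) sums ln (1 + - z)"
    by (rule ln_series') (use assms in auto)
  from sums_minus[OF this] have "(\<lambda>n. z ^ n / real n) sums neg_log z" by simp
  then show ?thesis by (subst sums_Suc_iff) simp
qed

lemma abs_suminf_le:
  fixes f g :: "nat \<Rightarrow> real"
  assumes "\<And>n. \<bar>f n\<bar> \<le> g n" "g sums G"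
  shows "\<bar>suminf f\<bar> \<le> G"
proof -
  have "summable (\<lambda>n. \<bar>f n\<bar>)"
    by (rule summable_comparison_test'[OF sums_summable[OF assms(2)]]) (use assms(1) in auto)
  then have "\<bar>suminf f\<bar> \<le> suminf (\<lambda>n. \<bar>f n\<bar>)" by (rule summable_rabs)
  also have "\<dots> \<le> suminf g"
    by (rule suminf_le[OF assms(1) \<open>summable (\<lambda>n. \<bar>f n\<bar>)\<close> sums_summable[OF assms(2)]])
  finally show ?thesis using sums_unique[OF assms(2)] by simp
qed

text \<open>With d = sqrt (1 - z) one has 1 / sqrt (n + 1) \<le> d + 1 / (d (n + 1)), by the
  inequality between the two means. The two parts sum to a geometric and a logarithmic series, so a
  rate n^(-1/2) becomes sqrt (1 - z) up to a logarithm.\<close>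

lemma abel_bound:
  assumes z: "0 < z" "z < 1" and a: "\<And>n. \<bar>a n\<bar> \<le> C / sqrt (real n + 1)" and "0 \<le> C"
  shows "\<bar>(1 - z) * (suminf (\<lambda>n. a n * z ^ n))\<bar> \<le> C * sqrt (1 - z) * (1 + neg_log z / z)"
proof -
  define d where "d = sqrt (1 - z)"
  have d: "0 < d" "1 - z = d * d" using z by (auto simp: d_def)
  have b: "C / sqrt (real n + 1) \<le> C * d + C / d * (1 / (real n + 1))" for n
  proof -
    define s where "s = 1 / sqrt (real n + 1)"
    have s: "0 < s" "s * s = 1 / (real n + 1)" by (auto simp: s_def)
    have "0 \<le> (d - s) * (d - s)" by simp
    moreover have "0 \<le> d * s" using s d by simp
    ultimately have "s * d \<le> d * d + s * s" by (simp add: algebra_simps)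
    then have "s \<le> (d * d + s * s) / d" using d(1) by (subst pos_le_divide_eq)
    also have "\<dots> = d + 1 / d * (s * s)" using d by (simp add: add_divide_distrib)
    finally have "C * s \<le> C * (d + 1 / d * (s * s))"
      using \<open>0 \<le> C\<close> by (rule mult_left_mono)
    then show ?thesis unfolding s(2) by (simp add: s_def distrib_left)
  qed
  let ?b = "\<lambda>n. C * d * z ^ n + C / d / z * (z ^ Suc n / real (Suc n))"
  have sums: "?b sums (C * d * (1 / (1 - z)) + C / d / z * neg_log z)"
    using z by (intro sums_add sums_mult geometric_sums neg_log_series) auto
  have le: "\<bar>a n * z ^ n\<bar> \<le> ?b n" for n
  proof -
    have "\<bar>a n * z ^ n\<bar> \<le> (C * d + C / d * (1 / (real n + 1))) * z ^ n"
      unfolding abs_mult using order_trans[OF a[of n] b[of n]] z by (intro mult_mono) auto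
    also have "\<dots> = ?b n" using z by (simp add: distrib_right add.commute)
    finally show ?thesis .
  qed
  have "(1 - z) * \<bar>suminf (\<lambda>n. a n * z ^ n)\<bar> \<le> (1 - z) * (C * d * (1 / (1 - z)) + C / d / z * neg_log z)"
    using z by (intro mult_left_mono abs_suminf_le[OF le sums]) auto
  also have "\<dots> = C * d * (1 + neg_log z / z)"
    unfolding d(2) using d(1) z(1) by (simp add: field_simps)
  finally show ?thesis using z by (simp add: abs_mult d_def)
qed

lemma suminf_geometric_shift:
  assumes "is_index ks" "\<bar>z\<bar> < 1"
  shows "polylog ks z - c = (1 - z) * (suminf (\<lambda>n. (harm_sum ks n - c) * z ^ n))"
proof -
  have "(\<lambda>n. harm_sum ks n * z ^ n - c * z ^ n) sums ((suminf (\<lambda>n. harm_sum ks n * z ^ n)) - c * (1 / (1 - z)))"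
    using assms by (intro sums_diff sums_mult summable_sums summable_harm_sum geometric_sums) auto
  then have "(suminf (\<lambda>n. (harm_sum ks n - c) * z ^ n)) = (suminf (\<lambda>n. harm_sum ks n * z ^ n)) - c * (1 / (1 - z))"
    by (simp add: sums_iff left_diff_distrib)
  then show ?thesis using assms(2) by (simp add: polylog_def right_diff_distrib)
qed

text \<open>The Abel mean of a constant is that constant, so \<open>abel_bound\<close> applies to
  the difference of the truncated sums and their limit, and the square root of 1 - z beats all
  powers of the logarithm.\<close>

lemma asymp_poly_polylog_admissible:
  assumes "admissible ks"
  shows "asymp_poly (at_left 1) neg_log (polylog ks) [:mzv ks:]"
  unfolding asymp_poly_def
proof
  fix m
  obtain C where C: "0 \<le> C" "\<And>n. harm_sum ks n \<le> mzv ks" "\<And>n. mzv ks - harm_sum ks n \<le> C / sqrt (real n + 1)"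
    using harm_sum_tendsto_mzv[OF assms] by blast
  have ks: "is_index ks" using assms by (simp add: admissible_def)
  show "((\<lambda>z. (polylog ks z - poly [:mzv ks:] (neg_log z)) * neg_log z ^ m) \<longlongrightarrow> 0) (at_left 1)"
  proof (rule Lim_null_comparison)
    show "eventually (\<lambda>z. norm ((polylog ks z - poly [:mzv ks:] (neg_log z)) * neg_log z ^ m)
        \<le> C * sqrt (1 - z) * (1 + neg_log z / z) * neg_log z ^ m) (at_left 1)"
    proof (rule eventually_mono[OF eventually_at_left_1])
      fix z :: real assume z: "0 < z \<and> z < 1"
      have "\<bar>polylog ks z - mzv ks\<bar> \<le> C * sqrt (1 - z) * (1 + neg_log z / z)"
        using z C ks suminf_geometric_shift[of ks z "mzv ks"]
          abel_bound[of z "\<lambda>n. harm_sum ks n - mzv ks" C] by (simp add: abs_le_iff)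
      moreover have "0 \<le> neg_log z" using z by simp
      ultimately show "norm ((polylog ks z - poly [:mzv ks:] (neg_log z)) * neg_log z ^ m)
        \<le> C * sqrt (1 - z) * (1 + neg_log z / z) * neg_log z ^ m"
        using mult_right_mono[of "\<bar>polylog ks z - mzv ks\<bar>" _ "neg_log z ^ m"] by (simp add: abs_mult power_abs)
    qed
    show "((\<lambda>z. C * sqrt (1 - z) * (1 + neg_log z / z) * neg_log z ^ m) \<longlongrightarrow> 0) (at_left 1)"
      by real_asymp
  qed
qed

text \<open>The first N terms contribute at most a multiple of 1 - z, the others at most e / 2,
  since the weights (1 - z) z^n sum to 1.\<close>

lemma abel_null:
  fixes a :: "nat \<Rightarrow> real"
  assumes "a \<longlonglongrightarrow> 0"
  shows "((\<lambda>z. (1 - z) * (suminf (\<lambda>n. a n * z ^ n))) \<longlongrightarrow> 0) (at_left 1)"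
proof (rule tendstoI)
  fix e :: real assume e: "0 < e"
  obtain B where B: "\<And>n. \<bar>a n\<bar> \<le> B" "0 < B"
    using convergent_imp_Bseq[OF convergentI[OF assms]] by (auto simp: Bseq_def)
  obtain N where N: "\<And>n. n \<ge> N \<Longrightarrow> \<bar>a n\<bar> < e / 2"
    using LIMSEQ_D[OF assms, of "e / 2"] e by auto
  have bound: "\<bar>(1 - z) * (suminf (\<lambda>n. a n * z ^ n))\<bar> \<le> e / 2 + (1 - z) * (real N * B)" if z: "0 < z" "z < 1" for z
  proof -
    let ?b = "\<lambda>n. e / 2 * z ^ n + (if n < N then B else 0)"
    have sums: "?b sums (e / 2 * (1 / (1 - z)) + (\<Sum>n<N. B))"
      using z sums_If_finite_set[of "{..<N}" "\<lambda>_. B"] by (intro sums_add sums_mult geometric_sums) auto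
    have "\<bar>a n * z ^ n\<bar> \<le> ?b n" for n
    proof (cases "n < N")
      case True
      have "\<bar>a n * z ^ n\<bar> \<le> B * 1" unfolding abs_mult using B z by (intro mult_mono) (auto simp: power_le_one)
      then show ?thesis using True e z by (simp add: add_increasing)
    next
      case False
      then show ?thesis using N[of n] z by (simp add: abs_mult mult_right_mono)
    qed
    then have "(1 - z) * \<bar>suminf (\<lambda>n. a n * z ^ n)\<bar> \<le> (1 - z) * (e / 2 * (1 / (1 - z)) + (\<Sum>n<N. B))"
      using z by (intro mult_left_mono abs_suminf_le[OF _ sums]) auto
    also have "\<dots> = e / 2 + (1 - z) * (real N * B)" using z by (simp add: field_simps)
    finally show ?thesis using z by (simp add: abs_mult)
  qed
  have "((\<lambda>z. e / 2 + (1 - z) * (real N * B)) \<longlongrightarrow> e / 2) (at_left 1)"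
  proof -
    have "((\<lambda>z. e / 2 + (1 - z) * (real N * B)) \<longlongrightarrow> e / 2 + (1 - 1) * (real N * B)) (at_left 1)"
      by (rule tendsto_intros)+
    then show ?thesis by simp
  qed
  then have "eventually (\<lambda>z. e / 2 + (1 - z) * (real N * B) < e) (at_left 1)"
    by (rule order_tendstoD(2)) (use e in simp)
  then show "eventually (\<lambda>z. dist ((1 - z) * (suminf (\<lambda>n. a n * z ^ n))) 0 < e) (at_left 1)"
    using eventually_at_left_1 by eventually_elim (use bound in \<open>force simp: dist_real_def\<close>)
qed

lemma polylog_1: "0 \<le> z \<Longrightarrow> z < 1 \<Longrightarrow> polylog [1] z = neg_log z"
proof -
  assume z: "0 \<le> z" "z < 1"
  have "polylog [1] z = (suminf (\<lambda>n. polylog_coeff 1 [] n * z ^ n))"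
    using z by (intro polylog_Cons) auto
  also have "\<dots> = (suminf (\<lambda>n. polylog_coeff 1 [] (Suc n) * z ^ Suc n))"
    using suminf_split_head[OF summable_polylog_coeff[of "[]" z 1]] z by (simp add: polylog_coeff_def)
  also have "\<dots> = neg_log z"
    using neg_log_series[OF z] by (simp add: polylog_coeff_def sums_iff field_simps)
  finally show ?thesis .
qed

lemma word_index_admissible:
  assumes "w \<in> ends_True" "w = [] \<or> \<not> hd w"
  shows "admissible (word_index w)"
proof (cases w)
  case (Cons a y)
  then have "y \<noteq> []" "y \<in> ends_True" using assms by (auto intro: ends_True_Cons)
  then obtain k ks where "word_index y = k # ks" using word_index_eq_Nil by (cases "word_index y") auto
  then show ?thesis
    using is_index_word_index[of y] Cons assms by (auto simp: admissible_def)
qed (simp add: admissible_def)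

text \<open>Here the letter \<open>True\<close> plays the role that the index 1 has for harmonic
  sums: shuffling with it multiplies by \<open>- ln (1 - z)\<close>.\<close>

lemma polylog_word_asymp_poly:
  assumes "w \<in> ends_True"
  shows "\<exists>P. asymp_poly (at_left 1) neg_log (polylog_word w) P"
proof -
  let ?A = "{f. \<exists>P. asymp_poly (at_left 1) neg_log f P}"
  have "polylog_word w \<in> ?A"
  proof (rule shuf_induct[where c = True and W = ends_True])
    show "0 \<in> ?A" by (auto intro!: exI[of _ 0] asymp_poly_exact)
    show "x + y \<in> ?A" if "x \<in> ?A" "y \<in> ?A" for x y
      using that asymp_poly_add by (fastforce simp: plus_fun_def)
    show "x - y \<in> ?A" if "x \<in> ?A" "y \<in> ?A" for x y
      using that asymp_poly_diff by (fastforce simp: fun_diff_def)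
    show "x \<in> ?A" if "(\<Sum>i\<le>n. x) \<in> ?A" for n :: nat and x
      using that asymp_poly_harm_divide by blast
    show "u @ True # v \<in> ends_True" if "u @ v \<in> ends_True" for u v
      using that by (cases v) auto
    show "w \<in> ends_True" if "True # w \<in> ends_True" for w using that by (rule ends_True_Cons)
    show "polylog_word w \<in> ?A" if "w \<in> ends_True" "w = [] \<or> hd w \<noteq> True" for w
      using asymp_poly_polylog_admissible[OF word_index_admissible[of w]] that unfolding polylog_word_def by blast
    show "shuf polylog_word [True] w \<in> ?A" if "w \<in> ends_True" and "polylog_word w \<in> ?A" for w
    proof -
      obtain P where P: "asymp_poly (at_left 1) neg_log (polylog_word w) P" using \<open>polylog_word w \<in> ?A\<close> by blast
      have lim: "asymp_poly (at_left 1) neg_log (\<lambda>z. neg_log z * polylog_word w z) ([:0, 1:] * P)"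
        by (rule asymp_poly_mult[OF asymp_poly_exact P]) simp
      have ev: "eventually (\<lambda>z. neg_log z * polylog_word w z = shuf polylog_word [True] w z) (at_left 1)"
        using eventually_at_left_1
      proof eventually_elim
        case (elim z)
        then show ?case
          using polylog_word_shuf[of "[True]" w z] \<open>w \<in> ends_True\<close> by (simp add: polylog_word_def polylog_1[simplified])
      qed
      from lim have "asymp_poly (at_left 1) neg_log (shuf polylog_word [True] w) ([:0, 1:] * P)"
        using asymp_poly_cong[OF ev] by simp
      then show ?thesis by blast
    qed
  qed (rule assms)
  then show ?thesis by blast
qed

text \<open>The shuffle regularization, with the letter \<open>True\<close> sent to T.\<close>

definition word_poly :: "bool list \<Rightarrow> real poly" where
  "word_poly w = (THE P. asymp_poly (at_left 1) neg_log (polylog_word w) P)"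

lemma at_left_1_neq_bot: "at_left (1::real) \<noteq> bot"
  by simp

lemma word_poly_eqI: "asymp_poly (at_left 1) neg_log (polylog_word w) P \<Longrightarrow> word_poly w = P"
  unfolding word_poly_def
  by (rule the_equality) (auto intro: asymp_poly_unique[OF _ _ filterlim_neg_log] asymp_polyD)

lemma asymp_poly_word_poly:
  "w \<in> ends_True \<Longrightarrow> asymp_poly (at_left 1) neg_log (polylog_word w) (word_poly w)"
  using polylog_word_asymp_poly[of w] word_poly_eqI[of w] by auto

lemma word_poly_False: "w \<in> ends_True \<Longrightarrow> w = [] \<or> \<not> hd w \<Longrightarrow> word_poly w = [:mzv (word_index w):]"
  using asymp_poly_polylog_admissible[OF word_index_admissible[of w]]
  by (intro word_poly_eqI) (simp add: polylog_word_def)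

lemma word_poly_True: "word_poly [True] = [:0, 1:]"
proof (rule word_poly_eqI)
  have "eventually (\<lambda>z. neg_log z = polylog_word [True] z) (at_left 1)"
    using eventually_at_left_1 by eventually_elim (simp add: polylog_word_def polylog_1[simplified])
  then show "asymp_poly (at_left 1) neg_log (polylog_word [True]) [:0, 1:]"
    by (subst asymp_poly_cong[symmetric]) (auto intro: asymp_poly_exact)
qed

lemma word_poly_shuf:
  assumes "u \<in> ends_True" "v \<in> ends_True"
  shows "word_poly u * word_poly v = shuf word_poly u v"
proof -
  let ?A = "{(f, P). asymp_poly (at_left 1) neg_log f P}"
  let ?p = "shuf (\<lambda>w. (polylog_word w, word_poly w)) u v"
  have "?p \<in> ?A"
    using assms asymp_poly_add
    by (intro shuf_closed) (auto simp: plus_fun_def intro: asymp_poly_word_poly ends_True_shuffles)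
  moreover have "fst ?p = shuf polylog_word u v" by (subst shuf_hom[where h = fst]) auto
  moreover have "snd ?p = shuf word_poly u v" by (subst shuf_hom[where h = snd]) auto
  ultimately have 1: "asymp_poly (at_left 1) neg_log (shuf polylog_word u v) (shuf word_poly u v)"
    by (auto simp: case_prod_unfold)
  have "eventually (\<lambda>z. polylog_word u z * polylog_word v z = shuf polylog_word u v z) (at_left 1)"
    using eventually_at_left_1 by eventually_elim (simp add: polylog_word_shuf assms)
  then have "asymp_poly (at_left 1) neg_log (shuf polylog_word u v) (word_poly u * word_poly v)"
    using assms by (subst asymp_poly_cong[symmetric]) (auto intro: asymp_poly_mult asymp_poly_word_poly)
  then show ?thesis
    using 1 by (auto intro: asymp_poly_unique[OF _ _ filterlim_neg_log] asymp_polyD)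
qed

section \<open>Duality\<close>

text \<open>The effect of substituting 1 - x for x in an iterated integral: the two forms are
  exchanged and the path is reversed.\<close>

definition dual_word :: "bool list \<Rightarrow> bool list" where
  "dual_word w = map Not (rev w)"

lemma dual_word_simps [simp]:
  "dual_word [] = []" "dual_word (u @ v) = dual_word v @ dual_word u" "dual_word (a # v) = dual_word v @ [\<not> a]"
  "length (dual_word w) = length w" "dual_word (dual_word w) = w" "dual_word w = [] \<longleftrightarrow> w = []"
  by (auto simp: dual_word_def rev_map comp_def)

text \<open>The polylogarithm of a nonempty word vanishes at 0 and is differentiable there, so its
  value at 1 - z is O(1 - z), which beats every power of the logarithm.\<close>

lemma polylog_word_decay:
  assumes w: "w \<in> ends_True" "w \<noteq> []" and f: "asymp_poly (at_left 1) neg_log f P"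
  shows "((\<lambda>z. polylog_word w (1 - z) * f z) \<longlongrightarrow> 0) (at_left 1)"
proof -
  obtain D where D: "(polylog_word w has_real_derivative D) (at 0)"
    using differentiable_polylog[OF is_index_word_index[of w], of 0] by (auto simp: polylog_word_def)
  have "((\<lambda>h. polylog_word w h / h) \<longlongrightarrow> D) (at 0)"
    using D polylog_word_0[OF w] by (simp add: DERIV_def)
  moreover have "filterlim (\<lambda>z::real. 1 - z) (at 0) (at_left 1)" by real_asymp
  ultimately have 1: "((\<lambda>z. polylog_word w (1 - z) / (1 - z)) \<longlongrightarrow> D) (at_left 1)"
    by (rule filterlim_compose)
  have "((\<lambda>z::real. (1 - z) * neg_log z ^ m) \<longlongrightarrow> 0) (at_left 1)" for m :: nat
  proof -
    have "((\<lambda>z::real. sqrt (1 - z) * (sqrt (1 - z) * neg_log z ^ m)) \<longlongrightarrow> 0) (at_left 1)" by real_asymp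
    then show ?thesis
      by (rule Lim_transform_eventually)
        (rule eventually_mono[OF eventually_at_left_1], simp add: mult.assoc[symmetric])
  qed
  from tendsto_poly_mult_zero[of "\<lambda>z. 1 - z", OF this, of P 0]
  have 2: "((\<lambda>z. (1 - z) * poly P (neg_log z)) \<longlongrightarrow> 0) (at_left 1)" by simp
  have "((\<lambda>z. 1 - z) \<longlongrightarrow> 1 - (1::real)) (at_left 1)" by (intro tendsto_intros)
  then have "((\<lambda>z. (polylog_word w (1 - z) / (1 - z)) *
      ((1 - z) * (f z - poly P (neg_log z)) + (1 - z) * poly P (neg_log z))) \<longlongrightarrow> D * ((1 - 1) * 0 + 0)) (at_left 1)"
    by (intro tendsto_mult tendsto_add 1 2 asymp_polyD[OF f])
  then have "((\<lambda>z. (polylog_word w (1 - z) / (1 - z)) *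
      ((1 - z) * (f z - poly P (neg_log z)) + (1 - z) * poly P (neg_log z))) \<longlongrightarrow> 0) (at_left 1)" by simp
  then show ?thesis
    by (rule Lim_transform_eventually) (rule eventually_mono[OF eventually_at_left_1], simp add: field_simps)
qed

lemma False_True_ends:
  assumes w: "w = False # x @ [True]"
  shows "dual_word (take i w) \<in> ends_True" "drop i w \<in> ends_True"
proof -
  show "dual_word (take i w) \<in> ends_True" using w by (cases i) (auto simp: ends_True_def)
  show "drop i w \<in> ends_True" using w last_drop[of i w] by (cases "i < length w") (auto simp: ends_True_def)
qed

lemma DERIV_polylog_Nil:
  assumes "\<bar>x\<bar> < 1"
  shows "(polylog_word [] has_real_derivative 0) (at x)"
proof -
  have "eventually (\<lambda>x. polylog_word [] x = 1) (nhds x)"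
    using assms by (intro eventually_nhds_in_open[of "{-1<..<1}", THEN eventually_mono]) (auto intro!: polylog_word_Nil)
  then show ?thesis by (subst DERIV_cong_ev[OF refl _ refl]) auto
qed

text \<open>
  The concatenation of the paths from \<open>0\<close> to \<open>z\<close> and from \<open>z\<close> to \<open>1\<close>: the sum is independent of
  \<open>z\<close> and tends to the zeta value of \<open>w\<close> as \<open>z\<close> tends to \<open>1\<close>.
\<close>

definition path_sum :: "bool list \<Rightarrow> real \<Rightarrow> real" where
  "path_sum w z = (\<Sum>i\<le>length w. polylog_word (dual_word (take i w)) (1 - z) * polylog_word (drop i w) z)"

text \<open>The derivative of the right factor in term i cancels that of the left factor in term i +
  1, because the reflection z to 1 - z exchanges the two forms and brings in a minus sign.\<close>

lemma path_sum_const: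
  assumes w: "w = False # x @ [True]" and z: "0 < z" "z < 1" "0 < y" "y < 1"
  shows "path_sum w z = path_sum w y"
proof -
  let ?n = "length w"
  define G where "G i z = polylog_word (dual_word (take i w)) (1 - z)" for i and z :: real
  define K where "K i = polylog_word (drop i w)" for i
  note ends = False_True_ends[OF w]
  have K0: "(K ?n has_real_derivative 0) (at z)" if "0 < z" "z < 1" for z
    using that DERIV_polylog_Nil[of z] by (simp add: K_def)
  have K1: "(K i has_real_derivative kernel_form (w ! i) z * K (Suc i) z) (at z)" if "0 < z" "z < 1" "i < ?n" for i z
    using DERIV_polylog_word[of "w ! i" "drop (Suc i) w" z] ends(2)[of i] that by (simp add: K_def Cons_nth_drop_Suc)
  have G1: "(G (Suc i) has_real_derivative - kernel_form (w ! i) z * G i z) (at z)" if "0 < z" "z < 1" "i < ?n" for i z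
  proof -
    have d: "dual_word (take (Suc i) w) = (\<not> w ! i) # dual_word (take i w)"
      using that by (simp add: take_Suc_conv_app_nth)
    have "(polylog_word (dual_word (take (Suc i) w)) has_real_derivative
        kernel_form (\<not> w ! i) (1 - z) * polylog_word (dual_word (take i w)) (1 - z)) (at (1 - z))"
      unfolding d by (rule DERIV_polylog_word) (use ends(1)[of "Suc i", unfolded d] that in auto)
    moreover have "((\<lambda>z. 1 - z) has_real_derivative - 1) (at z)" by (auto intro!: derivative_eq_intros)
    ultimately have "((\<lambda>z. polylog_word (dual_word (take (Suc i) w)) (1 - z)) has_real_derivative
        kernel_form (\<not> w ! i) (1 - z) * polylog_word (dual_word (take i w)) (1 - z) * - 1) (at z)"
      by (rule DERIV_chain2[where g = "\<lambda>z. 1 - z"])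
    then have "(G (Suc i) has_real_derivative kernel_form (\<not> w ! i) (1 - z) * polylog_word (dual_word (take i w)) (1 - z) * - 1) (at z)"
      unfolding G_def[abs_def] .
    moreover have "kernel_form (\<not> w ! i) (1 - z) = kernel_form (w ! i) z" by (simp add: kernel_form_def)
    ultimately show ?thesis by (simp add: G_def)
  qed
  have G0: "(G 0 has_real_derivative 0) (at z)" if "0 < z" "z < 1" for z
  proof -
    have "(polylog_word [] has_real_derivative 0) (at (1 - z))" using that by (intro DERIV_polylog_Nil) auto
    moreover have "((\<lambda>z. 1 - z) has_real_derivative - 1) (at z)" by (auto intro!: derivative_eq_intros)
    ultimately have "((\<lambda>z. polylog_word [] (1 - z)) has_real_derivative 0 * - 1) (at z)"
      by (rule DERIV_chain2[where g = "\<lambda>z. 1 - z"])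
    then show ?thesis by (simp add: G_def[abs_def])
  qed
  define G' where "G' i z = (if i = 0 then 0 else - kernel_form (w ! (i - 1)) z * G (i - 1) z)" for i z
  define K' where "K' i z = (if i = ?n then 0 else kernel_form (w ! i) z * K (Suc i) z)" for i z
  have G: "(G i has_real_derivative G' i z) (at z)" if "0 < z" "z < 1" "i \<le> ?n" for i z
    using G0[of z] G1[of z "i - 1"] that by (cases i) (auto simp: G'_def)
  have K: "(K i has_real_derivative K' i z) (at z)" if "0 < z" "z < 1" "i \<le> ?n" for i z
    using K0[of z] K1[of z i] that by (auto simp: K'_def)
  have deriv: "(path_sum w has_real_derivative 0) (at z)" if "0 < z" "z < 1" for z
  proof -
    have "((\<lambda>z. \<Sum>i\<le>?n. G i z * K i z) has_real_derivative (\<Sum>i\<le>?n. G' i z * K i z + K' i z * G i z)) (at z)"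
      using that by (intro DERIV_sum DERIV_mult G K) auto
    also have "(\<Sum>i\<le>?n. G' i z * K i z + K' i z * G i z) = (\<Sum>i\<le>?n. G' i z * K i z) + (\<Sum>i\<le>?n. K' i z * G i z)"
      by (rule sum.distrib)
    also have "(\<Sum>i\<le>?n. G' i z * K i z) = (\<Sum>i<?n. G' (Suc i) z * K (Suc i) z)"
      by (simp add: sum.atMost_shift G'_def)
    also have "(\<Sum>i\<le>?n. K' i z * G i z) = (\<Sum>i<?n. K' i z * G i z)"
      by (simp add: lessThan_Suc_atMost[symmetric] K'_def)
    also have "(\<Sum>i<?n. G' (Suc i) z * K (Suc i) z) + (\<Sum>i<?n. K' i z * G i z) = 0"
      unfolding sum.distrib[symmetric] by (rule sum.neutral) (simp add: G'_def K'_def)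
    finally show ?thesis by (simp add: path_sum_def[abs_def] G_def K_def)
  qed
  show ?thesis
  proof (cases z y rule: linorder_cases)
    case less
    then show ?thesis
      using z deriv by (intro DERIV_isconst_end[of z y "path_sum w", symmetric])
        (auto intro!: continuous_at_imp_continuous_on DERIV_isCont[OF deriv])
  next
    case greater
    then show ?thesis
      using z deriv by (intro DERIV_isconst_end[of y z "path_sum w"])
        (auto intro!: continuous_at_imp_continuous_on DERIV_isCont[OF deriv])
  qed simp
qed

text \<open>For i > 0 the left factor decays while the right one grows at most like a power of the
  logarithm; the term i = 0 alone survives.\<close>

lemma path_sum_tendsto:
  assumes w: "w = False # x @ [True]"
  shows "(path_sum w \<longlongrightarrow> mzv (word_index w)) (at_left 1)"
proof -
  note ends = False_True_ends[OF w]
  have "((\<lambda>z. \<Sum>i\<le>length w. polylog_word (dual_word (take i w)) (1 - z) * polylog_word (drop i w) z)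
      \<longlongrightarrow> (\<Sum>i\<le>length w. if i = 0 then mzv (word_index w) else 0)) (at_left 1)"
  proof (rule tendsto_sum)
    fix i assume i: "i \<in> {..length w}"
    show "((\<lambda>z. polylog_word (dual_word (take i w)) (1 - z) * polylog_word (drop i w) z)
      \<longlongrightarrow> (if i = 0 then mzv (word_index w) else 0)) (at_left 1)"
    proof (cases "i = 0")
      case True
      have "asymp_poly (at_left 1) neg_log (polylog_word w) [:mzv (word_index w):]"
        using asymp_poly_polylog_admissible[OF word_index_admissible[of w]] w by (simp add: polylog_word_def)
      from asymp_polyD[OF this] have "(polylog_word w \<longlongrightarrow> mzv (word_index w)) (at_left 1)"
        by (simp add: LIM_zero_iff)
      then have "((\<lambda>z. polylog_word [] (1 - z) * polylog_word w z) \<longlongrightarrow> mzv (word_index w)) (at_left 1)"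
        by (rule Lim_transform_eventually) (rule eventually_mono[OF eventually_at_left_1], simp add: polylog_word_Nil)
      then show ?thesis using True by simp
    next
      case False
      then show ?thesis
        using polylog_word_decay[OF ends(1)[of i] _ asymp_poly_word_poly[OF ends(2)[of i]]] w by simp
    qed
  qed
  then show ?thesis unfolding path_sum_def[abs_def] by simp
qed

lemma path_sum_dual: "path_sum (dual_word w) z = path_sum w (1 - z)"
proof -
  have "path_sum (dual_word w) z
     = (\<Sum>i\<le>length w. polylog_word (drop (length w - i) w) (1 - z) * polylog_word (dual_word (take (length w - i) w)) z)"
  proof -
    have "dual_word (take i (dual_word w)) = drop (length w - i) w"
      and "drop i (dual_word w) = dual_word (take (length w - i) w)" if "i \<le> length w" for i
    proof -
      have "dual_word w = dual_word (drop (length w - i) w) @ dual_word (take (length w - i) w)"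
        by (metis append_take_drop_id dual_word_simps(2))
      moreover have "length (dual_word (drop (length w - i) w)) = i" using that by simp
      ultimately have "take i (dual_word w) = dual_word (drop (length w - i) w)"
        and "drop i (dual_word w) = dual_word (take (length w - i) w)" by simp_all
      then show "dual_word (take i (dual_word w)) = drop (length w - i) w"
        and "drop i (dual_word w) = dual_word (take (length w - i) w)" by simp_all
    qed
    then show ?thesis by (simp add: path_sum_def)
  qed
  also have "\<dots> = (\<Sum>i\<le>length w. polylog_word (drop i w) (1 - z) * polylog_word (dual_word (take i w)) z)"
    by (rule sum.reindex_bij_witness[of _ "\<lambda>i. length w - i" "\<lambda>i. length w - i"]) auto
  finally show ?thesis by (simp add: path_sum_def mult.commute)
qed

text \<open>The constant \<open>path_sum\<close> is evaluated at 1/2, the fixed point of the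
  reflection that replaces the word by its dual.\<close>

lemma mzv_dual:
  assumes w: "w = False # x @ [True]"
  shows "mzv (word_index (dual_word w)) = mzv (word_index w)"
proof -
  have *: "path_sum w (1 / 2) = mzv (word_index w)" if w: "w = False # x @ [True]" for w x
  proof -
    have "((\<lambda>_. path_sum w (1 / 2)) \<longlongrightarrow> mzv (word_index w)) (at_left (1::real))"
      using path_sum_tendsto[OF w]
    proof (rule Lim_transform_eventually)
      show "eventually (\<lambda>z. path_sum w z = path_sum w (1 / 2)) (at_left 1)"
        using eventually_at_left_1 by eventually_elim (use path_sum_const[OF w] in auto)
    qed
    then show ?thesis using tendsto_const_iff[OF at_left_1_neq_bot] by metis
  qed
  have "dual_word w = False # dual_word x @ [True]" using w by simp
  from *[OF this] *[OF w] path_sum_dual[of w "1 / 2"] show ?thesis by simp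
qed

section \<open>Rational subspaces of the reals\<close>

abbreviation real_span :: "real set \<Rightarrow> real set" where
  "real_span \<equiv> rat_span (rat_alg ring_of_type_algebra)"

lemma real_span_incl: "x \<in> U \<Longrightarrow> x \<in> real_span U"
  by (rule rat_ring.rat_span_incl[OF rat_ring_real(1)]) auto

lemma real_span_zero: "0 \<in> real_span U"
  using rat_ring.rat_span_zero[OF rat_ring_real(1), of U] by simp

lemma real_span_add: "x \<in> real_span U \<Longrightarrow> y \<in> real_span U \<Longrightarrow> x + y \<in> real_span U"
  using rat_ring.rat_span_add[OF rat_ring_real(1), of U x y] by simp

lemma real_span_scale: "x \<in> real_span U \<Longrightarrow> of_rat q * x \<in> real_span U"
  using rat_ring.rat_span_smult[OF rat_ring_real(1), of U x q] by (simp add: rat_ring_real(2))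

lemma real_span_uminus: "x \<in> real_span U \<Longrightarrow> - x \<in> real_span U"
  using real_span_scale[of x U "- 1"] by simp

lemma real_span_diff: "x \<in> real_span U \<Longrightarrow> y \<in> real_span U \<Longrightarrow> x - y \<in> real_span U"
  using real_span_add[of x U "- y"] real_span_uminus[of y U] by simp

lemma real_span_divide: "x \<in> real_span U \<Longrightarrow> x / of_nat n \<in> real_span U"
  using real_span_scale[of x U "1 / of_nat n"] by (simp add: of_rat_divide)

lemma real_span_sum: "(\<And>i. i \<in> I \<Longrightarrow> f i \<in> real_span U) \<Longrightarrow> (\<Sum>i\<in>I. f i) \<in> real_span U"
  by (induction I rule: infinite_finite_induct) (auto intro: real_span_add real_span_zero)

lemma real_span_sign: "x \<in> real_span U \<Longrightarrow> (- 1) ^ n * x \<in> real_span U"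
  by (cases "even n") (auto intro: real_span_uminus)

lemma real_span_subset:
  assumes "U \<subseteq> real_span Y"
  shows "real_span U \<subseteq> real_span Y"
proof
  fix x assume "x \<in> real_span U"
  then have x: "U \<subseteq> carrier ring_of_type_algebra" "x \<in> real_span U" by auto
  show "x \<in> real_span Y"
    by (rule rat_ring.rat_span_induct[OF rat_ring_real(1) x])
      (use assms in \<open>auto simp: rat_ring_real(2) intro: real_span_zero real_span_scale real_span_add\<close>)
qed

lemma real_span_mult:
  assumes "x \<in> real_span U" "y \<in> real_span U" and "\<And>x y. x \<in> U \<Longrightarrow> y \<in> U \<Longrightarrow> x * y \<in> real_span U"
  shows "x * y \<in> real_span U"
  using rat_ring.rat_span_mult[OF rat_ring_real(1), of U x y] assms by simp

text \<open>The reals are taken as a rational vector space: a basis of the span stays independent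
  when \<open>x\<close> is added, and the functional is prescribed on it.\<close>

lemma separating_functional:
  assumes "x \<notin> real_span U"
  obtains l :: "real \<Rightarrow> real" where "\<And>a b. l (a + b) = l a + l b" "\<And>a. a \<in> real_span U \<Longrightarrow> l a = 0" "l x = 1"
proof -
  interpret V: vector_space "\<lambda>(q::rat) (x::real). of_rat q * x"
    by unfold_locales (auto simp: algebra_simps of_rat_add of_rat_mult)
  interpret VV: vector_space_pair "\<lambda>(q::rat) (x::real). of_rat q * x" "\<lambda>(q::rat) (x::real). of_rat q * x"
    by unfold_locales
  obtain B where B: "B \<subseteq> real_span U" "V.independent B" "real_span U \<subseteq> V.span B"
    using V.basis_exists by metis
  have "V.span B \<subseteq> real_span U"
    by (rule V.span_minimal[OF B(1)]) (auto simp: V.subspace_def intro: real_span_zero real_span_add real_span_scale)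
  then have "V.independent (insert x B)" using assms B(2) by (auto simp: V.independent_insert)
  then obtain g where g: "Vector_Spaces.linear (\<lambda>(q::rat) (x::real). of_rat q * x) (\<lambda>(q::rat) (x::real). of_rat q * x) g"
      "\<And>b. b \<in> insert x B \<Longrightarrow> g b = (if b = x then 1 else 0)"
    using VV.linear_independent_extend[of "insert x B" "\<lambda>b. if b = x then 1 else 0"] by blast
  interpret g: Vector_Spaces.linear "\<lambda>(q::rat) (x::real). of_rat q * x" "\<lambda>(q::rat) (x::real). of_rat q * x" g by fact
  have "x \<notin> B" using assms B(1) by auto
  show ?thesis
  proof (rule that[of g])
    show "g (a + b) = g a + g b" for a b by (rule g.add)
    show "g x = 1" using g(2) by simp
    show "g a = 0" if "a \<in> real_span U" for a
    proof (rule VV.linear_eq_0_on_span[OF g(1), of B])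
      show "g b = 0" if "b \<in> B" for b using g(2)[of b] that \<open>x \<notin> B\<close> by auto
      show "a \<in> V.span B" using that B(3) by auto
    qed
  qed
qed

section \<open>Indices as words\<close>

fun index_word :: "nat list \<Rightarrow> bool list" where
  "index_word [] = []"
| "index_word (k # ks) = replicate (k - 1) False @ True # index_word ks"

lemma word_index_block: "word_index (replicate j False @ True # w) = Suc j # word_index w"
  by (induction j) auto

lemma word_index_index_word: "is_index ks \<Longrightarrow> word_index (index_word ks) = ks"
  by (induction ks) (auto simp: word_index_block)

lemma ends_True_index_word: "index_word ks \<in> ends_True"
  by (induction ks) (auto simp: ends_True_def)

lemma index_word_word_index: "w \<in> ends_True \<Longrightarrow> index_word (word_index w) = w"
proof (induction w rule: word_index.induct)
  case (2 w)
  then show ?case using ends_True_Cons[of True w] by simp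
next
  case (3 w)
  then have w: "w \<noteq> []" "w \<in> ends_True" by (auto intro: ends_True_Cons)
  then obtain k ks where k: "word_index w = k # ks" using word_index_eq_Nil by (cases "word_index w") auto
  then have "0 < k" using is_index_word_index[of w] by simp
  then obtain m where "k = Suc m" by (cases k) auto
  then have "index_word (word_index (False # w)) = False # index_word (word_index w)" using k by simp
  then show ?case using 3 w by simp
qed auto

lemma sum_list_word_index: "w \<in> ends_True \<Longrightarrow> sum_list (word_index w) = length w"
proof (induction w rule: word_index.induct)
  case (2 w)
  then show ?case using ends_True_Cons[of True w] by simp
next
  case (3 w)
  then have w: "w \<noteq> []" "w \<in> ends_True" by (auto intro: ends_True_Cons)
  then obtain k ks where "word_index w = k # ks" using word_index_eq_Nil by (cases "word_index w") auto
  then show ?case using 3 w by simp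
qed auto

lemma length_index_word: "is_index ks \<Longrightarrow> length (index_word ks) = sum_list ks"
  by (induction ks) auto

text \<open>Reversal turns a block 0^(k-1) 1 into 1 0^(k-1); a \<open>True\<close> appended at the
  end regroups the letters into blocks.\<close>

lemma rev_index_word: "rev (index_word ks) @ [True] = True # index_word (rev ks)"
proof -
  have append: "index_word (u @ v) = index_word u @ index_word v" for u v
    by (induction u) auto
  show ?thesis
  proof (induction ks)
    case (Cons k ks)
    then show ?case by (simp add: append)
  qed simp
qed

lemma word_index_rev: "word_index (rev x @ [True]) = rev (word_index (x @ [True]))"
proof -
  let ?ks = "word_index (x @ [True])"
  have "True # index_word (rev ?ks) = rev (x @ [True]) @ [True]"
    using rev_index_word[of ?ks] by (simp add: index_word_word_index)
  then have "index_word (rev ?ks) = rev x @ [True]" by simp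
  then show ?thesis using word_index_index_word[of "rev ?ks"] is_index_word_index[of "x @ [True]"] by simp
qed

section \<open>Comparison of the two regularizations\<close>

definition abel_mean :: "(nat \<Rightarrow> real) \<Rightarrow> real \<Rightarrow> real" where
  "abel_mean g z = (1 - z) * suminf (\<lambda>n. g n * z ^ n)"

text \<open>Sequences whose Abel means have an expansion at 1 with constant term in
  \<open>S\<close>; summability is included so that Abel means add.\<close>

definition abel_reg :: "real set \<Rightarrow> (nat \<Rightarrow> real) set" where
  "abel_reg S = {g. (\<forall>z. 0 < z \<longrightarrow> z < 1 \<longrightarrow> summable (\<lambda>n. g n * z ^ n)) \<and>
     (\<exists>P. asymp_poly (at_left 1) neg_log (abel_mean g) P \<and> poly P 0 \<in> S)}"

lemma abel_reg_add:
  assumes "g \<in> abel_reg (real_span U)" "h \<in> abel_reg (real_span U)"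
  shows "g + h \<in> abel_reg (real_span U)"
proof -
  obtain P Q where P: "asymp_poly (at_left 1) neg_log (abel_mean g) P" "poly P 0 \<in> real_span U"
    and Q: "asymp_poly (at_left 1) neg_log (abel_mean h) Q" "poly Q 0 \<in> real_span U"
    and sum: "\<And>z. 0 < z \<Longrightarrow> z < 1 \<Longrightarrow> summable (\<lambda>n. g n * z ^ n)" "\<And>z. 0 < z \<Longrightarrow> z < 1 \<Longrightarrow> summable (\<lambda>n. h n * z ^ n)"
    using assms by (auto simp: abel_reg_def)
  have "eventually (\<lambda>z. abel_mean g z + abel_mean h z = abel_mean (g + h) z) (at_left 1)"
    using eventually_at_left_1
  proof eventually_elim
    case (elim z)
    then have "abel_mean (g + h) z = (1 - z) * (suminf (\<lambda>n. g n * z ^ n) + suminf (\<lambda>n. h n * z ^ n))"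
      using suminf_add[OF sum(1)[of z] sum(2)[of z]] by (simp add: abel_mean_def distrib_right)
    then show ?case by (simp add: abel_mean_def distrib_left)
  qed
  from asymp_poly_cong[OF this] asymp_poly_add[OF P(1) Q(1)]
  have "asymp_poly (at_left 1) neg_log (abel_mean (g + h)) (P + Q)" by simp
  moreover have "poly (P + Q) 0 \<in> real_span U" using P Q by (simp add: real_span_add)
  moreover have "summable (\<lambda>n. (g + h) n * z ^ n)" if "0 < z" "z < 1" for z
    using summable_add[OF sum(1)[OF that] sum(2)[OF that]] by (simp add: distrib_right)
  ultimately show ?thesis by (auto simp: abel_reg_def)
qed

lemma word_poly_word_index:
  assumes "is_index l"
  shows "asymp_poly (at_left 1) neg_log (polylog l) (word_poly (index_word l))"
  using asymp_poly_word_poly[OF ends_True_index_word[of l]] assms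
  by (simp add: polylog_word_def word_index_index_word)

text \<open>Repeated stuffle products with 1 turn the sequence into a sum of truncated sums of
  weight \<open>i\<close>, and the Abel mean of a truncated sum is its polylogarithm.\<close>

lemma harm_power_abel_reg:
  assumes Q: "\<And>w. w \<in> ends_True \<Longrightarrow> length w = i \<Longrightarrow> poly (word_poly w) 0 \<in> real_span U"
    and "is_index l" "sum_list l + j = i"
  shows "(\<lambda>n. harm n ^ j * harm_sum l n) \<in> abel_reg (real_span U)"
  using assms(2,3)
proof (induction j arbitrary: l)
  case 0
  have "asymp_poly (at_left 1) neg_log (abel_mean (harm_sum l)) (word_poly (index_word l))"
    using word_poly_word_index[OF 0(1)] by (simp add: abel_mean_def[abs_def] polylog_def[abs_def])
  moreover have "poly (word_poly (index_word l)) 0 \<in> real_span U"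
    using 0 by (intro Q ends_True_index_word) (simp add: length_index_word)
  ultimately show ?case using summable_harm_sum[OF 0(1)] by (auto simp: abel_reg_def)
next
  case (Suc j)
  have "(\<lambda>n. harm n ^ Suc j * harm_sum l n) = (\<lambda>n. harm n ^ j * stuf harm_sum [1] l n)"
    using harm_sum_mult[of "[1]" l] Suc.prems(1) unfolding harm_sum_1 by (auto simp: mult_ac)
  also have "\<dots> = stuf (\<lambda>w n. harm n ^ j * harm_sum w n) [1] l"
    by (rule quasi_hom[where h = "\<lambda>f n. harm n ^ j * f n"]) (auto simp: distrib_left)
  also have "\<dots> \<in> abel_reg (real_span U)"
    using Suc.prems by (intro stuf_closed abel_reg_add Suc.IH) auto
  finally show ?case .
qed

text \<open>Each derivative deletes a leading one or gives zero. A letter other than 1 is never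
  deleted, so the weight of \<open>w\<close> stays positive.\<close>

lemma higher_pderiv_reg_poly:
  assumes "is_index ks" "\<exists>k\<in>set ks. k \<noteq> 1"
  shows "(pderiv ^^ i) (reg_poly ks) = 0 \<or>
    (\<exists>w. is_index w \<and> sum_list w + i = sum_list ks \<and> (\<exists>k\<in>set w. k \<noteq> 1) \<and> (pderiv ^^ i) (reg_poly ks) = reg_poly w)"
proof (induction i)
  case (Suc i)
  from Suc.IH show ?case
  proof (elim disjE exE conjE)
    fix w assume w: "is_index w" "sum_list w + i = sum_list ks" "\<exists>k\<in>set w. k \<noteq> 1"
      "(pderiv ^^ i) (reg_poly ks) = reg_poly w"
    show ?thesis
    proof (cases "w \<noteq> [] \<and> hd w = 1")
      case True
      then obtain v where v: "w = 1 # v" by (cases w) auto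
      then show ?thesis using w pderiv_reg_poly[OF w(1)] by (intro disjI2 exI[of _ v]) auto
    next
      case False
      then show ?thesis using w pderiv_reg_poly[OF w(1)] by auto
    qed
  qed auto
qed (use assms in auto)

text \<open>Abel means turn the expansion with coefficients r_i in powers of the harmonic number
  into one of the polylogarithm, with constant term the sum of r_i P_i(0). As P_0 = 1, the term i =
  0 is the stuffle value; for i > 0 the factors come from weights n - i and i, so the term lies in
  \<open>S\<close>. The letter other than 1 ensures i < n.\<close>

lemma regularizations_agree:
  fixes U :: "real set"
  defines "S \<equiv> real_span U"
  assumes mult: "\<And>x y. x \<in> S \<Longrightarrow> y \<in> S \<Longrightarrow> x * y \<in> S"
    and R: "\<And>l. is_index l \<Longrightarrow> sum_list l < n \<Longrightarrow> poly (reg_poly l) 0 \<in> S"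
    and Q: "\<And>w. w \<in> ends_True \<Longrightarrow> length w < n \<Longrightarrow> poly (word_poly w) 0 \<in> S"
    and ks: "is_index ks" "sum_list ks = n" "\<exists>k\<in>set ks. k \<noteq> 1"
  shows "poly (word_poly (index_word ks)) 0 - poly (reg_poly ks) 0 \<in> S"
proof -
  define r where "r i = coeff (reg_poly ks) i" for i
  let ?d = "degree (reg_poly ks)"
  have r: "r i = 0 \<or> i < n \<and> r i \<in> S" if "0 < i" for i
  proof -
    have "poly ((pderiv ^^ i) (reg_poly ks)) 0 = fact i * r i"
      by (simp add: poly_0_coeff_0 coeff_higher_pderiv pochhammer_fact r_def)
    then have r: "r i = poly ((pderiv ^^ i) (reg_poly ks)) 0 / of_nat (fact i)" by simp
    from higher_pderiv_reg_poly[OF ks(1,3), of i] show ?thesis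
    proof (elim disjE exE conjE)
      fix w assume w: "is_index w" "sum_list w + i = sum_list ks" "\<exists>k\<in>set w. k \<noteq> 1"
        "(pderiv ^^ i) (reg_poly ks) = reg_poly w"
      then obtain k where "k \<in> set w" "0 < k" by (auto simp: is_index_def)
      then have "0 < sum_list w" using member_le_sum_list[of k w] by linarith
      then have "i < n" using w ks(2) by linarith
      moreover have "r i \<in> S"
        unfolding r w(4) S_def using R[OF w(1)] w(2) ks(2) that by (intro real_span_divide) (simp add: S_def)
      ultimately show ?thesis by simp
    qed (simp add: r)
  qed
  have "\<exists>P. asymp_poly (at_left 1) neg_log (abel_mean (\<lambda>n. harm n ^ i)) P \<and> poly P 0 \<in> S" if "i < n" for i
    using harm_power_abel_reg[of i U "[]" i] Q that by (auto simp: abel_reg_def S_def)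
  then obtain P where P: "\<And>i. i < n \<Longrightarrow> asymp_poly (at_left 1) neg_log (abel_mean (\<lambda>n. harm n ^ i)) (P i)"
      "\<And>i. i < n \<Longrightarrow> poly (P i) 0 \<in> S" by metis
  have "0 < n" using ks by (cases ks) auto
  have summable: "summable (\<lambda>n. harm n ^ i * z ^ n)" if "i < n" "0 < z" "z < (1::real)" for i z
    using harm_power_abel_reg[of i U "[]" i] Q that by (auto simp: abel_reg_def S_def)
  let ?I = "{i. i \<le> ?d \<and> r i \<noteq> 0}"
  have fin: "finite ?I" by simp
  have I: "i < n" if "i \<in> ?I" for i using r[of i] that \<open>0 < n\<close> by (cases "i = 0") auto
  have poly_r: "poly (reg_poly ks) t = (\<Sum>i\<in>?I. r i * t ^ i)" for t
    unfolding poly_altdef r_def[symmetric] by (rule sum.mono_neutral_right) auto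
  have null: "(\<lambda>m. harm_sum ks m - (\<Sum>i\<in>?I. r i * harm m ^ i)) \<longlonglongrightarrow> 0"
    using asymp_polyD[OF asymp_poly_reg_poly[OF ks(1)]] by (simp add: poly_r)
  let ?W = "\<Sum>i\<in>?I. Polynomial.smult (r i) (P i)"
  have E: "asymp_poly (at_left 1) neg_log (\<lambda>z. \<Sum>i\<in>?I. r i * abel_mean (\<lambda>n. harm n ^ i) z) ?W"
    using I by (intro asymp_poly_sum asymp_poly_cmult P) auto
  have "((\<lambda>z. polylog ks z - (\<Sum>i\<in>?I. r i * abel_mean (\<lambda>n. harm n ^ i) z)) \<longlongrightarrow> 0) (at_left 1)"
    using abel_null[OF null]
  proof (rule Lim_transform_eventually)
    show "eventually (\<lambda>z. (1 - z) * suminf (\<lambda>m. (harm_sum ks m - (\<Sum>i\<in>?I. r i * harm m ^ i)) * z ^ m)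
        = polylog ks z - (\<Sum>i\<in>?I. r i * abel_mean (\<lambda>n. harm n ^ i) z)) (at_left 1)"
      using eventually_at_left_1
    proof eventually_elim
      case (elim z)
      have 1: "(\<lambda>m. harm_sum ks m * z ^ m) sums suminf (\<lambda>m. harm_sum ks m * z ^ m)"
        using elim ks(1) by (intro summable_sums summable_harm_sum) auto
      have 2: "(\<lambda>m. \<Sum>i\<in>?I. r i * (harm m ^ i * z ^ m)) sums (\<Sum>i\<in>?I. r i * suminf (\<lambda>m. harm m ^ i * z ^ m))"
        using elim I by (intro sums_sum sums_mult summable_sums summable) auto
      have "suminf (\<lambda>m. (harm_sum ks m - (\<Sum>i\<in>?I. r i * harm m ^ i)) * z ^ m)
          = suminf (\<lambda>m. harm_sum ks m * z ^ m) - (\<Sum>i\<in>?I. r i * suminf (\<lambda>m. harm m ^ i * z ^ m))"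
        using sums_unique[OF sums_diff[OF 1 2]]
        by (simp add: left_diff_distrib sum_distrib_right mult.assoc)
      then show ?case
        by (simp add: polylog_def abel_mean_def right_diff_distrib sum_distrib_left mult_ac)
    qed
  qed
  from tendsto_add[OF this asymp_polyD[OF E]]
  have "((\<lambda>z. polylog ks z - poly ?W (neg_log z)) \<longlongrightarrow> 0) (at_left 1)" by simp
  \<comment> \<open>One expansion of \<open>polylog ks\<close> beats all powers, the other holds
    only as a limit; uniqueness admits this.\<close>
  with word_poly_word_index[OF ks(1)] have "word_poly (index_word ks) = ?W"
    by (rule asymp_poly_unique[OF _ _ filterlim_neg_log]) simp
  then have W: "poly (word_poly (index_word ks)) 0 = (\<Sum>i\<in>?I. r i * poly (P i) 0)" by (simp add: poly_sum)
  have P0: "poly (P 0) 0 = 1"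
  proof -
    have "eventually (\<lambda>z. 1 = abel_mean (\<lambda>n. harm n ^ 0) z) (at_left 1)"
      using eventually_at_left_1
    proof eventually_elim
      case (elim z)
      then show ?case using polylog_Nil[of z] by (simp add: abel_mean_def polylog_def)
    qed
    then have "asymp_poly (at_left 1) neg_log (abel_mean (\<lambda>n. harm n ^ 0)) 1"
      by (subst asymp_poly_cong[symmetric]) (auto intro: asymp_poly_exact)
    then have "P 0 = 1"
      using asymp_poly_unique[OF P(1)[OF \<open>0 < n\<close>] asymp_polyD filterlim_neg_log] by simp
    then show ?thesis by simp
  qed
  have "poly (word_poly (index_word ks)) 0 = (\<Sum>i\<in>insert 0 ?I. r i * poly (P i) 0)"
    unfolding W by (rule sum.mono_neutral_left) auto
  also have "\<dots> = r 0 * poly (P 0) 0 + (\<Sum>i\<in>?I - {0}. r i * poly (P i) 0)"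
    using fin by (simp add: sum.insert_remove)
  also have "r 0 * poly (P 0) 0 = poly (reg_poly ks) 0" unfolding P0 by (simp add: r_def poly_0_coeff_0)
  finally have "poly (word_poly (index_word ks)) 0 - poly (reg_poly ks) 0 = (\<Sum>i\<in>?I - {0}. r i * poly (P i) 0)"
    by simp
  also have "\<dots> \<in> S"
    unfolding S_def
  proof (rule real_span_sum)
    fix i assume "i \<in> ?I - {0}"
    then show "r i * poly (P i) 0 \<in> real_span U" using r[of i] mult[of "r i"] P(2)[of i] by (auto simp: S_def)
  qed
  finally show ?thesis .
qed

section \<open>Yasuda's theorem\<close>

text \<open>
  Modulo the span of symmetric values, which contains all products of values of lower weight, the
  shuffle regularized values form a functional on words that vanishes on shuffle products, is invariant
  under duality, and satisfies \<open>f (x 1) = f (1 x)\<close>. Duality gives \<open>f (x 0) = f (0 x)\<close>, so \<open>f\<close> is invariant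
  under rotation, while its sum over all rotations of a word is zero.
\<close>

definition symm_span :: "real set" where
  "symm_span = real_span {symm_val ks | ks. is_index ks}"

lemma symm_span_mult:
  assumes "x \<in> symm_span" "y \<in> symm_span"
  shows "x * y \<in> symm_span"
  unfolding symm_span_def
proof (rule real_span_mult)
  fix x y assume "x \<in> {symm_val ks | ks. is_index ks}" "y \<in> {symm_val ks | ks. is_index ks}"
  then obtain u v where uv: "x = symm_val u" "y = symm_val v" "is_index u" "is_index v" by blast
  have "stuf symm_val u v \<in> real_span {symm_val ks | ks. is_index ks}"
    using uv by (intro stuf_closed real_span_add) (auto intro: real_span_incl)
  then show "x * y \<in> real_span {symm_val ks | ks. is_index ks}" using symm_val_mult uv by simp
qed (use assms in \<open>simp_all add: symm_span_def\<close>)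

lemma symm_val_in_span: "is_index ks \<Longrightarrow> symm_val ks \<in> symm_span"
  unfolding symm_span_def by (rule real_span_incl) blast

text \<open>At T = 0 the symmetric value is a sum over all cuts of the index. The two extreme cuts
  give the stated terms, every inner cut a product of two values of lower weight.\<close>

lemma reg_reversal:
  assumes R: "\<And>l. is_index l \<Longrightarrow> sum_list l < n \<Longrightarrow> poly (reg_poly l) 0 \<in> symm_span"
    and ks: "is_index ks" "sum_list ks = n" "ks \<noteq> []"
  shows "poly (reg_poly ks) 0 + (- 1) ^ n * poly (reg_poly (rev ks)) 0 \<in> symm_span"
proof -
  let ?R = "\<lambda>l. poly (reg_poly l) 0" and ?r = "length ks"
  let ?t = "\<lambda>a. (- 1) ^ sum_list (take a ks) * ?R (rev (take a ks)) * ?R (drop a ks)"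
  have split: "sum_list (take a ks) + sum_list (drop a ks) = n" for a
    using ks(2) by (metis append_take_drop_id sum_list_append)
  have pos: "0 < sum_list l" if "is_index l" "l \<noteq> []" for l
    using that by (cases l) auto
  have mid: "?t a \<in> symm_span" if "a \<in> {0<..<?r}" for a
  proof -
    have "0 < sum_list (take a ks)" "0 < sum_list (drop a ks)" using that ks by (auto intro!: pos)
    then have "sum_list (take a ks) < n" "sum_list (drop a ks) < n" using split[of a] by linarith+
    then have "?R (rev (take a ks)) \<in> symm_span" "?R (drop a ks) \<in> symm_span"
      using ks(1) by (auto intro!: R simp: sum_list_rev)
    from real_span_sign[OF symm_span_mult[OF this, unfolded symm_span_def]]
    show ?thesis by (simp add: symm_span_def mult.assoc)
  qed
  have "symm_val ks = (\<Sum>a\<le>?r. ?t a)"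
    by (simp add: symm_val_def symm_poly_def poly_sum poly_power)
  also have "{..?r} = insert 0 (insert ?r {0<..<?r})" using ks(3) by auto
  also have "(\<Sum>a\<in>insert 0 (insert ?r {0<..<?r}). ?t a)
      = ?R ks + ((- 1) ^ n * ?R (rev ks) + (\<Sum>a\<in>{0<..<?r}. ?t a))"
    using ks by simp
  finally have "?R ks + (- 1) ^ n * ?R (rev ks) = symm_val ks - (\<Sum>a\<in>{0<..<?r}. ?t a)" by simp
  also have "\<dots> \<in> symm_span"
    using mid symm_val_in_span[OF ks(1)] unfolding symm_span_def by (intro real_span_diff real_span_sum) auto
  finally show ?thesis .
qed

text \<open>A functional \<open>l\<close> separating the value from the span would give a functional
  on words that takes the value 1 at \<open>w\<close>, although kill of products and invariance
  under rotation force 0.\<close>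

lemma word_poly_in_symm_span:
  assumes n: "2 \<le> n"
    and R: "\<And>l. is_index l \<Longrightarrow> sum_list l < n \<Longrightarrow> poly (reg_poly l) 0 \<in> symm_span"
    and Q: "\<And>w. w \<in> ends_True \<Longrightarrow> length w < n \<Longrightarrow> poly (word_poly w) 0 \<in> symm_span"
    and w: "w \<in> ends_True" "length w = n"
  shows "poly (word_poly w) 0 \<in> symm_span"
proof (rule ccontr)
  assume "poly (word_poly w) 0 \<notin> symm_span"
  then obtain l :: "real \<Rightarrow> real" where l: "\<And>a b. l (a + b) = l a + l b"
      "\<And>a. a \<in> symm_span \<Longrightarrow> l a = 0" "l (poly (word_poly w) 0) = 1"
    unfolding symm_span_def by (rule separating_functional) (use that in blast)
  have l0: "l 0 = 0" using l(1)[of 0 0] by simp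
  have l_minus: "l (- a) = - l a" for a using l(1)[of a "- a"] l0 by simp
  have l_diff: "l (a - b) = l a - l b" for a b using l(1)[of a "- b"] l_minus by simp
  have l_sign: "l ((- 1) ^ m * a) = (- 1) ^ m * l a" for m a by (cases "even m") (auto simp: l_minus)
  \<comment> \<open>Cut off outside length n, so that shuffles of any other total length vanish
    trivially.\<close>
  define f0 where "f0 w = (if length w = n then l (poly (word_poly w) 0) else 0)" for w
  define f where "f = False_ext f0"
  have shuf_zero: "shuf (\<lambda>_. 0) u v = (0::real)" for u v :: "bool list"
    using shuf_closed[of "{0::real}" u v "\<lambda>_. 0"] by simp
  have kills: "kills f"
    unfolding f_def
  proof (rule kills_False_ext)
    fix u v assume uv: "u \<in> ends_True" "v \<in> ends_True" "u \<noteq> []" "v \<noteq> []"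
    show "shuf f0 u v = 0"
    proof (cases "length u + length v = n")
      case True
      have "shuf f0 u v = shuf (\<lambda>w. l (poly (word_poly w) 0)) u v"
        using True by (intro shuf_cong) (auto simp: f0_def dest: length_shuffles)
      also have "\<dots> = l (poly (shuf word_poly u v) 0)"
        by (rule shuf_hom[symmetric, where h = "\<lambda>p. l (poly p 0)"]) (simp add: l)
      also have "\<dots> = l (poly (word_poly u) 0 * poly (word_poly v) 0)"
        using uv by (simp add: word_poly_shuf[symmetric])
      also have "poly (word_poly u) 0 * poly (word_poly v) 0 \<in> symm_span"
        using uv True by (intro symm_span_mult Q) (auto simp flip: length_greater_0_conv)
      then have "l (poly (word_poly u) 0 * poly (word_poly v) 0) = 0" by (rule l)
      finally show ?thesis .
    next
      case False
      then have "shuf f0 u v = shuf (\<lambda>_. 0) u v"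
        by (intro shuf_cong) (auto simp: f0_def dest: length_shuffles)
      then show ?thesis by (simp add: shuf_zero)
    qed
  qed
  have f_eq: "f v = f0 v" if "v \<in> ends_True" "v \<noteq> []" for v
    unfolding f_def using that by (rule False_ext_eq)
  have f_letters: "f [True] = 0" "f [False] = 0"
    using f_eq[of "[True]"] n False_ext_replicate[of f0 1] by (auto simp: f0_def f_def)
  \<comment> \<open>Duality is known on words 0 x 1 only. The difference of the two sides kills
    products as well, so \<open>kills_determined\<close> extends it to all nonempty words.\<close>
  have dual: "f (dual_word v) = f v" if "v \<noteq> []" for v
  proof -
    have "(\<lambda>w. f (dual_word w) - f w) v = 0"
    proof (rule kills_determined)
      show "kills (\<lambda>w. f (dual_word w) - f w)"
        unfolding kills_def
      proof (intro allI impI)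
        fix u v :: "bool list" assume uv: "u \<noteq> []" "v \<noteq> []"
        have "shuf (\<lambda>w. f (dual_word w) - f w + f w) u v = shuf (\<lambda>w. f (dual_word w) - f w) u v + shuf f u v"
          by (rule shuf_add)
        moreover have "shuf (\<lambda>w. f (dual_word w)) u v = shuf f (dual_word u) (dual_word v)"
          unfolding dual_word_def shuf_map shuf_rev ..
        ultimately show "shuf (\<lambda>w. f (dual_word w) - f w) u v = 0"
          using kills uv by (simp add: kills_def)
      qed
      show "f (dual_word (False # x @ [True])) - f (False # x @ [True]) = 0" for x
      proof -
        let ?v = "False # x @ [True]"
        have v: "?v \<in> ends_True" "dual_word ?v \<in> ends_True" by (simp_all add: ends_True_def)
        have "poly (word_poly (dual_word ?v)) 0 = poly (word_poly ?v) 0"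
          using word_poly_False[OF v(1)] word_poly_False[OF v(2)] mzv_dual[of ?v x] by simp
        then show ?thesis using v by (simp add: f_eq f0_def)
      qed
    qed (use f_letters that in simp_all)
    then show ?thesis by simp
  qed
  have rot_True: "f (x @ [True]) = f (True # x)" if x: "Suc (length x) = n" for x
  proof (cases "\<forall>a\<in>set x. a")
    \<comment> \<open>The comparison of the regularizations does not reach words of ones alone, but
      there the rotation is trivial.\<close>
    case True
    then have "x = replicate (length x) True" by (metis replicate_length_same)
    then have "x @ [True] = True # x" by (metis replicate_append_same)
    then show ?thesis by simp
  next
    case False
    let ?ks = "word_index (x @ [True])"
    have ends: "x @ [True] \<in> ends_True" "rev x @ [True] \<in> ends_True" by simp_all
    have ks: "is_index ?ks" "sum_list ?ks = n" "?ks \<noteq> []"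
      using is_index_word_index x word_index_eq_Nil[OF ends(1)] sum_list_word_index[OF ends(1)] by auto
    have not_ones: "\<exists>k\<in>set ?ks. k \<noteq> 1"
    proof (rule ccontr)
      assume "\<not> ?thesis"
      moreover have "set (index_word k) \<subseteq> {True}" if "\<forall>i\<in>set k. i = 1" for k
        using that by (induction k) auto
      ultimately have "set (index_word ?ks) \<subseteq> {True}" by blast
      then show False using False index_word_word_index[OF ends(1)] by auto
    qed
    have agree: "l (poly (word_poly (index_word k)) 0) = l (poly (reg_poly k) 0)"
      if "is_index k" "sum_list k = n" "\<exists>i\<in>set k. i \<noteq> 1" for k
    proof -
      have "poly (word_poly (index_word k)) 0 - poly (reg_poly k) 0 \<in> symm_span"
        using that R Q symm_span_mult unfolding symm_span_def by (intro regularizations_agree) auto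
      then show ?thesis using l(2) l_diff by fastforce
    qed
    \<comment> \<open>The word is read as an index, \<open>reg_reversal\<close> reverses the index,
      and \<open>kills_rev\<close> reverses the word back. The signs (-1)^n and (-1)^(n-1) cancel
      the remaining minus sign.\<close>
    have "f (x @ [True]) = l (poly (word_poly (x @ [True])) 0)" using x by (simp add: f_eq f0_def)
    also have "\<dots> = l (poly (reg_poly ?ks) 0)"
      using agree[OF ks(1,2) not_ones] index_word_word_index[OF ends(1)] by simp
    also have "\<dots> = - ((- 1) ^ n * l (poly (reg_poly (rev ?ks)) 0))"
    proof -
      have "l (poly (reg_poly ?ks) 0 + (- 1) ^ n * poly (reg_poly (rev ?ks)) 0) = 0"
        by (intro l(2) reg_reversal R ks) auto
      then show ?thesis by (simp add: l(1) l_sign)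
    qed
    also have "l (poly (reg_poly (rev ?ks)) 0) = l (poly (word_poly (rev x @ [True])) 0)"
      using agree[of "rev ?ks"] ks not_ones index_word_word_index[OF ends(2)] by (simp add: sum_list_rev word_index_rev)
    also have "\<dots> = f (rev x @ [True])" using x by (simp add: f_eq f0_def)
    also have "\<dots> = (- 1) ^ length x * f (True # x)" using kills_rev[OF kills, of x True "[]"] by simp
    also have "- ((- 1) ^ n * ((- 1) ^ length x * f (True # x))) = f (True # x)"
      using x by (auto simp flip: power_mult_distrib mult.assoc)
    finally show ?thesis .
  qed
  \<comment> \<open>Duality turns the final 0 into a leading 1, which is rotated to the end; duality
    then turns it into a leading 0.\<close>
  have rot_False: "f (x @ [False]) = f (False # x)" if "Suc (length x) = n" for x
    using dual[of "False # x"] dual[of "True # dual_word x"] rot_True[of "dual_word x"] that by simp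
  have "f w = 0"
  proof (rule kills_cyclic_0[OF kills])
    show "f (x @ [b]) = f (b # x)" if "Suc (length x) = n" for b x
      using rot_True[OF that] rot_False[OF that] by (cases b) auto
  qed (use w n in auto)
  moreover have "w \<noteq> []" using w n by auto
  then have "f w = 1" using f_eq[of w] w l(3) by (simp add: f0_def)
  ultimately show False by simp
qed

text \<open>Each weight uses both regularizations in all lower weights, so the two statements are
  proved together. Within one weight the shuffle values are settled by rotation and the stuffle
  values follow by comparison.\<close>

lemma reg_in_symm_span:
  "(\<forall>ks. is_index ks \<and> sum_list ks = n \<longrightarrow> poly (reg_poly ks) 0 \<in> symm_span)
   \<and> (\<forall>w\<in>ends_True. length w = n \<longrightarrow> poly (word_poly w) 0 \<in> symm_span)"
proof (induction n rule: less_induct)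
  case (less n)
  have R: "poly (reg_poly l) 0 \<in> symm_span" if "is_index l" "sum_list l < n" for l using less that by blast
  have Q: "poly (word_poly w) 0 \<in> symm_span" if "w \<in> ends_True" "length w < n" for w using less that by blast
  have zero: "0 \<in> symm_span" and one: "1 \<in> symm_span"
    using real_span_zero symm_val_in_span[of "[]"] by (auto simp: symm_span_def)
  consider "n = 0" | "n = 1" | "2 \<le> n" by linarith
  then show ?case
  proof cases
    case 1
    have "poly (reg_poly ks) 0 \<in> symm_span" if "is_index ks" "sum_list ks = n" for ks
      using that 1 one by (cases ks) auto
    moreover have "word_poly [] = 1"
      using word_poly_False[of "[]"] reg_poly_admissible[of "[]"] by (simp add: admissible_def)
    ultimately show ?thesis using 1 one by auto
  next
    \<comment> \<open>In weight 1 both regularizations are T, which is 0 at T = 0.\<close>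
    case 2
    have "ks = [1]" if "is_index ks" "sum_list ks = 1" for ks
    proof (cases ks)
      case (Cons k ls)
      then show ?thesis using that by (cases ls) auto
    qed (use that in simp)
    moreover have "w = [True]" if "w \<in> ends_True" "length w = 1" for w using that by (cases w) auto
    ultimately show ?thesis using 2 zero word_poly_True reg_poly_1 by auto
  next
    case 3
    have Qn: "poly (word_poly w) 0 \<in> symm_span" if "w \<in> ends_True" "length w = n" for w
      using word_poly_in_symm_span[OF 3 R Q that] .
    have Rn: "poly (reg_poly ks) 0 \<in> symm_span" if ks: "is_index ks" "sum_list ks = n" "\<exists>k\<in>set ks. k \<noteq> 1" for ks
    proof -
      have "poly (word_poly (index_word ks)) 0 - poly (reg_poly ks) 0 \<in> symm_span"
        using ks R Q symm_span_mult unfolding symm_span_def by (intro regularizations_agree) auto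
      moreover have "poly (word_poly (index_word ks)) 0 \<in> symm_span"
        using ks by (intro Qn ends_True_index_word) (simp add: length_index_word)
      ultimately show ?thesis unfolding symm_span_def using real_span_diff by fastforce
    qed
    \<comment> \<open>The comparison leaves out n ones. The product of 1 with n - 1 ones is 0 at T =
      0 and equals n times the wanted value plus values already covered.\<close>
    have ones: "poly (reg_poly (replicate n 1)) 0 \<in> symm_span"
    proof -
      let ?R = "\<lambda>ks. poly (reg_poly ks) 0"
      obtain m where m: "n = Suc m" "0 < m" using 3 by (cases n) auto
      have "stuf (\<lambda>v. ?R (replicate 0 1 @ v)) [1] (replicate m 1 @ [])
          - (\<Sum>i\<le>m. ?R (replicate (Suc (m + 0)) 1 @ [])) \<in> symm_span"
      proof (rule stuf_1_replicate)
        fix b v assume b: "b \<le> m + 0" "admissible v" "b + sum_list v = Suc (m + 0 + sum_list [])"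
        then have "v \<noteq> []" by auto
        then have "\<exists>k\<in>set v. k \<noteq> 1" using b(2) by (cases v) (auto simp: admissible_def)
        then show "?R (replicate b 1 @ v) \<in> symm_span"
          using b m by (intro Rn) (auto simp: admissible_def sum_list_replicate)
      qed (auto simp: admissible_def symm_span_def intro: real_span_add real_span_zero)
      moreover have "stuf ?R [1] (replicate m 1) = 0"
      proof -
        have "stuf ?R [1] (replicate m 1) = poly (stuf reg_poly [1] (replicate m 1)) 0"
          by (rule quasi_hom[symmetric, where h = "\<lambda>p. poly p 0"]) auto
        also have "stuf reg_poly [1] (replicate m 1) = reg_poly [1] * reg_poly (replicate m 1)"
          by (rule reg_poly_mult[symmetric]) auto
        finally show ?thesis unfolding reg_poly_1 by simp
      qed
      ultimately have "- (of_nat n * ?R (replicate n 1)) \<in> symm_span" using m by simp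
      then have "- (- (of_nat n * ?R (replicate n 1))) / of_nat n \<in> symm_span"
        unfolding symm_span_def by (rule real_span_divide[OF real_span_uminus])
      then show ?thesis using m by simp
    qed
    have "poly (reg_poly ks) 0 \<in> symm_span" if ks: "is_index ks" "sum_list ks = n" for ks
    proof (cases "\<exists>k\<in>set ks. k \<noteq> 1")
      case False
      then have "ks = replicate (length ks) 1" by (metis replicate_length_same)
      moreover from this have "length ks = n" using ks(2) by (metis sum_list_replicate mult.right_neutral of_nat_id)
      ultimately show ?thesis using ones by simp
    qed (use Rn ks in blast)
    then show ?thesis using Qn by blast
  qed
qed

section \<open>The ring of multiple zeta values and its spanning by symmetric values\<close>

definition mzv_span :: "real set" where
  "mzv_span = real_span {mzv ks | ks. admissible ks}"

lemma mzv_in_span: "admissible ks \<Longrightarrow> mzv ks \<in> mzv_span"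
  unfolding mzv_span_def by (rule real_span_incl) blast

lemma mzv_Nil: "mzv [] = 1"
  using reg_poly_admissible[of "[]"] by (simp add: admissible_def one_pCons)

lemma one_in_mzv_span: "1 \<in> mzv_span"
  using mzv_in_span[of "[]"] by (simp add: mzv_Nil admissible_def)

text \<open>The first letter of a word in the product is that of one factor or the sum of both,
  hence at least 2.\<close>

lemma stuf_admissible:
  assumes "\<And>x y. x \<in> A \<Longrightarrow> y \<in> A \<Longrightarrow> x + y \<in> A" and "admissible u" "admissible v"
    and f: "\<And>w. admissible w \<Longrightarrow> f w \<in> A"
    and "0 \<in> A"
  shows "stuf f u v \<in> A"
proof (cases u; cases v)
  fix k u' l v' assume uv: "u = k # u'" "v = l # v'"
  show ?thesis
    unfolding uv quasi.simps using assms(2,3) uv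
    by (intro assms(1) stuf_closed) (auto intro!: f assms(1,5) simp: admissible_def)
qed (use assms in auto)

lemma mzv_span_mult:
  assumes "x \<in> mzv_span" "y \<in> mzv_span"
  shows "x * y \<in> mzv_span"
  unfolding mzv_span_def
proof (rule real_span_mult)
  fix x y assume "x \<in> {mzv ks | ks. admissible ks}" "y \<in> {mzv ks | ks. admissible ks}"
  then obtain u v where uv: "x = mzv u" "y = mzv v" "admissible u" "admissible v" by blast
  let ?A = "{P. poly P 0 \<in> real_span {mzv ks | ks. admissible ks}}"
  have "stuf reg_poly u v \<in> ?A"
    using uv by (intro stuf_admissible) (auto intro: real_span_add real_span_incl real_span_zero simp: reg_poly_admissible)
  moreover have "poly (stuf reg_poly u v) 0 = x * y"
    using uv reg_poly_mult[of u v] by (simp add: admissible_def reg_poly_admissible flip: reg_poly_mult)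
  ultimately show "x * y \<in> real_span {mzv ks | ks. admissible ks}" by simp
qed (use assms in \<open>simp_all add: mzv_span_def\<close>)

text \<open>In the induction step the product with 1 contributes 0, since the index 1 has value 0 at
  T = 0.\<close>

lemma reg_in_mzv_span:
  assumes "is_index ks"
  shows "poly (reg_poly ks) 0 \<in> mzv_span"
proof -
  let ?A = "{P. poly P 0 \<in> mzv_span}"
  have "reg_poly ks \<in> ?A"
    using assms
  proof (rule stuf_induct[rotated -1])
    show "P \<in> ?A" if "(\<Sum>i\<le>n. P) \<in> ?A" for n :: nat and P
    proof -
      have "poly (\<Sum>i\<le>n. P) 0 / of_nat (Suc n) \<in> mzv_span"
        using that unfolding mzv_span_def by (intro real_span_divide) simp
      then show ?thesis by (simp add: poly_sum)
    qed
    show "stuf reg_poly [1] w \<in> ?A" if "is_index w" for w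
      using reg_poly_mult[of "[1]" w, symmetric] that real_span_zero unfolding reg_poly_1 by (simp add: mzv_span_def)
    show "reg_poly w \<in> ?A" if "admissible w" for w
      using that by (simp add: reg_poly_admissible mzv_in_span)
  qed (auto simp: mzv_span_def intro: real_span_add real_span_diff real_span_zero)
  then show ?thesis by simp
qed

theorem symm_span_eq: "symm_span = mzv_span"
proof
  show "symm_span \<subseteq> mzv_span"
    unfolding symm_span_def mzv_span_def
  proof (rule real_span_subset, rule subsetI)
    fix x assume "x \<in> {symm_val ks | ks. is_index ks}"
    then obtain ks where ks: "x = symm_val ks" "is_index ks" by blast
    have "x = (\<Sum>a\<le>length ks. (- 1) ^ sum_list (take a ks) *
        (poly (reg_poly (rev (take a ks))) 0 * poly (reg_poly (drop a ks)) 0))"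
      by (simp add: ks symm_val_def symm_poly_def poly_sum poly_power mult.assoc)
    also have "\<dots> \<in> mzv_span"
      unfolding mzv_span_def
      by (intro real_span_sum real_span_sign mzv_span_mult[unfolded mzv_span_def] reg_in_mzv_span[unfolded mzv_span_def])
        (use ks in auto)
    finally show "x \<in> real_span {mzv ks | ks. admissible ks}" by (simp add: mzv_span_def)
  qed
  show "mzv_span \<subseteq> symm_span"
    unfolding symm_span_def mzv_span_def
  proof (rule real_span_subset, rule subsetI)
    fix x assume "x \<in> {mzv ks | ks. admissible ks}"
    then obtain ks where ks: "x = mzv ks" "admissible ks" by blast
    then have "poly (reg_poly ks) 0 \<in> symm_span"
      using reg_in_symm_span[of "sum_list ks"] by (simp only: admissible_def)
    then show "x \<in> real_span {symm_val ks | ks. is_index ks}"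
      using ks by (simp add: reg_poly_admissible symm_span_def)
  qed
qed

section \<open>Families over the primes modulo finitely many primes\<close>

lemma primes_iff: "p \<in> primes \<longleftrightarrow> Factorial_Ring.prime p"
  by (simp add: primes_def)

lemma prime_class_cong: "(\<And>p. p \<in> primes \<Longrightarrow> f p = g p) \<Longrightarrow> prime_class R f = prime_class R g"
  by (simp add: prime_class_def cong: restrict_cong)

lemma (in cring) int_invertible_mod:
  fixes p n :: int
  assumes "[p] \<cdot> \<one> = \<zero>" "coprime n p"
  shows "\<exists>y\<in>carrier R. [n] \<cdot> \<one> \<otimes> y = \<one>"
proof -
  obtain a b where ab: "a * n + b * p = 1" using assms(2) bezout_int[of n p] by auto
  have "[n] \<cdot> \<one> \<otimes> [a] \<cdot> \<one> = [(a * n)] \<cdot> \<one>"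
    by (simp add: add_pow_ldistr_int add.int_pow_pow mult.commute)
  also have "a * n = 1 + (- b) * p" using ab by simp
  also have "[(1 + (- b) * p)] \<cdot> \<one> = [(1::int)] \<cdot> \<one> \<oplus> [((- b) * p)] \<cdot> \<one>"
    by (rule add.int_pow_mult) simp
  also have "[((- b) * p)] \<cdot> \<one> = [(- b)] \<cdot> ([p] \<cdot> \<one>)"
    by (simp add: add.int_pow_pow mult.commute)
  finally show ?thesis using assms(1) by (intro bexI[of _ "[a] \<cdot> \<one>"]) auto
qed

text \<open>The condition on the characteristic makes every integer prime to p invertible in the
  p-th ring, and hence the quotient a rational algebra.\<close>

locale prime_family =
  fixes R :: "nat \<Rightarrow> 'a ring"
  assumes cring_R: "p \<in> primes \<Longrightarrow> cring (R p)"
    and char_R: "p \<in> primes \<Longrightarrow> [int p] \<cdot>\<^bsub>R p\<^esub> \<one>\<^bsub>R p\<^esub> = \<zero>\<^bsub>R p\<^esub>"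
begin

lemma prime_prod_simps [simp]:
  "f \<otimes>\<^bsub>prime_prod R\<^esub> g = (\<lambda>p\<in>primes. f p \<otimes>\<^bsub>R p\<^esub> g p)" "\<one>\<^bsub>prime_prod R\<^esub> = (\<lambda>p\<in>primes. \<one>\<^bsub>R p\<^esub>)"
  "\<zero>\<^bsub>prime_prod R\<^esub> = (\<lambda>p\<in>primes. \<zero>\<^bsub>R p\<^esub>)" "f \<oplus>\<^bsub>prime_prod R\<^esub> g = (\<lambda>p\<in>primes. f p \<oplus>\<^bsub>R p\<^esub> g p)"
  by (simp_all add: prime_prod_def)

lemma carrier_prime_prod: "carrier (prime_prod R) = (\<Pi>\<^sub>E p\<in>primes. carrier (R p))"
  by (simp add: prime_prod_def)

lemma closed:
  assumes "p \<in> primes"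
  shows "x \<in> carrier (R p) \<Longrightarrow> y \<in> carrier (R p) \<Longrightarrow> x \<oplus>\<^bsub>R p\<^esub> y \<in> carrier (R p)"
    "x \<in> carrier (R p) \<Longrightarrow> y \<in> carrier (R p) \<Longrightarrow> x \<otimes>\<^bsub>R p\<^esub> y \<in> carrier (R p)"
    "\<one>\<^bsub>R p\<^esub> \<in> carrier (R p)" "\<zero>\<^bsub>R p\<^esub> \<in> carrier (R p)" "x \<in> carrier (R p) \<Longrightarrow> \<ominus>\<^bsub>R p\<^esub> x \<in> carrier (R p)"
proof -
  interpret cring "R p" using cring_R assms .
  show "x \<in> carrier (R p) \<Longrightarrow> y \<in> carrier (R p) \<Longrightarrow> x \<oplus>\<^bsub>R p\<^esub> y \<in> carrier (R p)"
    "x \<in> carrier (R p) \<Longrightarrow> y \<in> carrier (R p) \<Longrightarrow> x \<otimes>\<^bsub>R p\<^esub> y \<in> carrier (R p)"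
    "\<one>\<^bsub>R p\<^esub> \<in> carrier (R p)" "\<zero>\<^bsub>R p\<^esub> \<in> carrier (R p)" "x \<in> carrier (R p) \<Longrightarrow> \<ominus>\<^bsub>R p\<^esub> x \<in> carrier (R p)"
    by auto
qed

lemma one_right: "p \<in> primes \<Longrightarrow> x \<in> carrier (R p) \<Longrightarrow> x \<otimes>\<^bsub>R p\<^esub> \<one>\<^bsub>R p\<^esub> = x"
  using cring_R[of p] by (simp add: cring_def ring_def monoid.r_one)

lemma cring_prime_prod: "cring (prime_prod R)"
proof (intro cringI abelian_groupI comm_monoidI)
  fix f assume f: "f \<in> carrier (prime_prod R)"
  show "\<exists>g\<in>carrier (prime_prod R). g \<oplus>\<^bsub>prime_prod R\<^esub> f = \<zero>\<^bsub>prime_prod R\<^esub>"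
  proof (intro bexI)
    show "(\<lambda>p\<in>primes. \<ominus>\<^bsub>R p\<^esub> f p) \<oplus>\<^bsub>prime_prod R\<^esub> f = \<zero>\<^bsub>prime_prod R\<^esub>"
      using f cring_R by (auto simp: carrier_prime_prod PiE_iff cring.cring_simprules intro!: restrict_ext)
    show "(\<lambda>p\<in>primes. \<ominus>\<^bsub>R p\<^esub> f p) \<in> carrier (prime_prod R)"
      using f by (auto simp: carrier_prime_prod PiE_iff closed)
  qed
qed (auto simp: carrier_prime_prod PiE_iff closed one_right extensional_def fun_eq_iff cring.cring_simprules[OF cring_R])

lemma prime_sum_iff:
  "f \<in> prime_sum R \<longleftrightarrow> f \<in> carrier (prime_prod R) \<and> finite {p \<in> primes. f p \<noteq> \<zero>\<^bsub>R p\<^esub>}"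
  by (simp add: prime_sum_def)

lemma ideal_prime_sum: "ideal (prime_sum R) (prime_prod R)"
proof -
  interpret P: cring "prime_prod R" by (rule cring_prime_prod)
  have uminus: "\<ominus>\<^bsub>prime_prod R\<^esub> f = (\<lambda>p\<in>primes. \<ominus>\<^bsub>R p\<^esub> f p)" if "f \<in> carrier (prime_prod R)" for f
  proof (rule P.minus_equality)
    show "(\<lambda>p\<in>primes. \<ominus>\<^bsub>R p\<^esub> f p) \<oplus>\<^bsub>prime_prod R\<^esub> f = \<zero>\<^bsub>prime_prod R\<^esub>"
      using that cring_R by (auto simp: carrier_prime_prod PiE_iff cring.cring_simprules intro!: restrict_ext)
  qed (use that in \<open>auto simp: carrier_prime_prod PiE_iff closed\<close>)
  have mult: "g \<otimes>\<^bsub>prime_prod R\<^esub> f \<in> prime_sum R" if "f \<in> prime_sum R" "g \<in> carrier (prime_prod R)" for f g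
  proof -
    have "{p \<in> primes. (g \<otimes>\<^bsub>prime_prod R\<^esub> f) p \<noteq> \<zero>\<^bsub>R p\<^esub>} \<subseteq> {p \<in> primes. f p \<noteq> \<zero>\<^bsub>R p\<^esub>}"
      using that cring_R by (auto simp: carrier_prime_prod PiE_iff cring.cring_simprules)
    then show ?thesis using that P.m_closed unfolding prime_sum_iff by (meson finite_subset)
  qed
  show ?thesis
  proof (rule idealI)
    show "subgroup (prime_sum R) (add_monoid (prime_prod R))"
    proof (rule P.add.subgroupI)
      show "\<ominus>\<^bsub>prime_prod R\<^esub> f \<in> prime_sum R" if "f \<in> prime_sum R" for f
      proof -
        have "{p \<in> primes. (\<ominus>\<^bsub>prime_prod R\<^esub> f) p \<noteq> \<zero>\<^bsub>R p\<^esub>} \<subseteq> {p \<in> primes. f p \<noteq> \<zero>\<^bsub>R p\<^esub>}"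
          using that cring_R by (auto simp: uminus prime_sum_iff cring.cring_simprules)
        then show ?thesis using that by (auto simp: prime_sum_iff intro: finite_subset)
      qed
      show "f \<oplus>\<^bsub>prime_prod R\<^esub> g \<in> prime_sum R" if "f \<in> prime_sum R" "g \<in> prime_sum R" for f g
      proof -
        have "{p \<in> primes. (f \<oplus>\<^bsub>prime_prod R\<^esub> g) p \<noteq> \<zero>\<^bsub>R p\<^esub>}
            \<subseteq> {p \<in> primes. f p \<noteq> \<zero>\<^bsub>R p\<^esub>} \<union> {p \<in> primes. g p \<noteq> \<zero>\<^bsub>R p\<^esub>}"
          using cring_R by (auto simp: cring.cring_simprules)
        then show ?thesis using that P.a_closed unfolding prime_sum_iff by (meson finite_subset finite_UnI)
      qed
      have "\<zero>\<^bsub>prime_prod R\<^esub> \<in> prime_sum R" using P.zero_closed by (simp add: prime_sum_iff)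
      then show "prime_sum R \<noteq> {}" by blast
    qed (auto simp: prime_sum_iff)
    show "f \<otimes>\<^bsub>prime_prod R\<^esub> g \<in> prime_sum R" if "f \<in> prime_sum R" "g \<in> carrier (prime_prod R)" for f g
      using mult[OF that] that P.m_comm[of f g] by (simp add: prime_sum_iff)
  qed (use mult P.ring_axioms in auto)
qed

lemma int_closed: "[n] \<cdot>\<^bsub>R p\<^esub> \<one>\<^bsub>R p\<^esub> \<in> carrier (R p)" if "p \<in> primes" for n :: int
proof -
  interpret cring "R p" using cring_R that .
  show ?thesis by simp
qed

abbreviation quot :: "(nat \<Rightarrow> 'a) set ring" where
  "quot \<equiv> prime_prod R Quot prime_sum R"

definition fam :: "(nat \<Rightarrow> 'a) set" where
  "fam = {f. \<forall>p\<in>primes. f p \<in> carrier (R p)}"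

lemma restrict_fam: "f \<in> fam \<Longrightarrow> restrict f primes \<in> carrier (prime_prod R)"
  by (auto simp: fam_def carrier_prime_prod)

lemma cring_quot: "cring quot"
  by (rule ideal.quotient_is_cring[OF ideal_prime_sum cring_prime_prod])

lemma class_closed: "f \<in> fam \<Longrightarrow> prime_class R f \<in> carrier quot"
  using restrict_fam[of f] by (auto simp: prime_class_def FactRing_def A_RCOSETS_def')

lemma class_surj:
  assumes "x \<in> carrier quot"
  obtains f where "f \<in> fam" "x = prime_class R f"
proof -
  obtain f where f: "f \<in> carrier (prime_prod R)" "x = prime_sum R +>\<^bsub>prime_prod R\<^esub> f"
    using assms by (auto simp: FactRing_def A_RCOSETS_def')
  then have "restrict f primes = f" by (auto simp: carrier_prime_prod PiE_iff extensional_restrict)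
  then show ?thesis using f that[of f] by (auto simp: prime_class_def fam_def carrier_prime_prod)
qed

lemma class_hom: "(\<lambda>f. prime_sum R +>\<^bsub>prime_prod R\<^esub> f) \<in> ring_hom (prime_prod R) quot"
  by (rule ideal.rcos_ring_hom[OF ideal_prime_sum])

lemma class_add:
  assumes "f \<in> fam" "g \<in> fam"
  shows "prime_class R (\<lambda>p. f p \<oplus>\<^bsub>R p\<^esub> g p) = prime_class R f \<oplus>\<^bsub>quot\<^esub> prime_class R g"
  using ring_hom_add[OF class_hom restrict_fam[OF assms(1)] restrict_fam[OF assms(2)]]
  by (simp add: prime_class_def cong: restrict_cong)

lemma class_mult:
  assumes "f \<in> fam" "g \<in> fam"
  shows "prime_class R (\<lambda>p. f p \<otimes>\<^bsub>R p\<^esub> g p) = prime_class R f \<otimes>\<^bsub>quot\<^esub> prime_class R g"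
  using ring_hom_mult[OF class_hom restrict_fam[OF assms(1)] restrict_fam[OF assms(2)]]
  by (simp add: prime_class_def cong: restrict_cong)

lemma class_one: "prime_class R (\<lambda>p. \<one>\<^bsub>R p\<^esub>) = \<one>\<^bsub>quot\<^esub>"
  using ring_hom_one[OF class_hom] by (simp add: prime_class_def)

lemma class_eq_iff:
  assumes "f \<in> fam" "g \<in> fam"
  shows "prime_class R f = prime_class R g \<longleftrightarrow> finite {p \<in> primes. f p \<noteq> g p}"
proof -
  interpret P: cring "prime_prod R" by (rule cring_prime_prod)
  let ?f = "restrict f primes" and ?g = "restrict g primes"
  have g': "(\<lambda>p\<in>primes. \<ominus>\<^bsub>R p\<^esub> g p) \<in> carrier (prime_prod R)"
    using assms by (auto simp: fam_def carrier_prime_prod closed)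
  have "\<ominus>\<^bsub>prime_prod R\<^esub> ?g = (\<lambda>p\<in>primes. \<ominus>\<^bsub>R p\<^esub> g p)"
  proof (rule P.minus_equality[OF _ restrict_fam[OF assms(2)] g'])
    show "(\<lambda>p\<in>primes. \<ominus>\<^bsub>R p\<^esub> g p) \<oplus>\<^bsub>prime_prod R\<^esub> ?g = \<zero>\<^bsub>prime_prod R\<^esub>"
      using assms cring_R by (auto simp: fam_def cring.cring_simprules intro!: restrict_ext)
  qed
  then have diff: "?f \<ominus>\<^bsub>prime_prod R\<^esub> ?g = (\<lambda>p\<in>primes. f p \<ominus>\<^bsub>R p\<^esub> g p)"
    by (auto simp: a_minus_def intro!: restrict_ext)
  have "f p \<ominus>\<^bsub>R p\<^esub> g p = \<zero>\<^bsub>R p\<^esub> \<longleftrightarrow> f p = g p" if "p \<in> primes" for p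
  proof -
    interpret cring "R p" using cring_R that .
    show ?thesis using assms that by (intro r_right_minus_eq) (auto simp: fam_def)
  qed
  then have "{p \<in> primes. (?f \<ominus>\<^bsub>prime_prod R\<^esub> ?g) p \<noteq> \<zero>\<^bsub>R p\<^esub>} = {p \<in> primes. f p \<noteq> g p}"
    by (auto simp: diff)
  moreover have "prime_class R f = prime_class R g \<longleftrightarrow> ?f \<ominus>\<^bsub>prime_prod R\<^esub> ?g \<in> prime_sum R"
    unfolding prime_class_def
    by (rule P.quotient_eq_iff_same_a_r_cos[OF ideal_prime_sum restrict_fam[OF assms(1)] restrict_fam[OF assms(2)], symmetric])
  moreover have "?f \<ominus>\<^bsub>prime_prod R\<^esub> ?g \<in> carrier (prime_prod R)"
    using restrict_fam[OF assms(1)] restrict_fam[OF assms(2)] by (rule P.minus_closed)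
  ultimately show ?thesis by (simp only: prime_sum_iff simp_thms)
qed

lemma class_rep:
  assumes "f \<in> fam"
  shows "restrict f primes \<in> prime_class R f"
proof -
  interpret I: ideal "prime_sum R" "prime_prod R" by (rule ideal_prime_sum)
  show ?thesis unfolding prime_class_def by (rule I.a_rcos_self) (rule restrict_fam[OF assms])
qed

lemma mem_class:
  assumes "f \<in> fam" "u \<in> prime_class R f"
  shows "u \<in> fam \<and> prime_class R u = prime_class R f"
proof -
  interpret I: ideal "prime_sum R" "prime_prod R" by (rule ideal_prime_sum)
  have "u \<in> carrier (prime_prod R)"
    using assms(2) I.a_rcosets_carrier[of "prime_class R f"] class_closed[OF assms(1)]
    by (auto simp: FactRing_def)
  then have r: "restrict u primes = u" and u: "u \<in> fam"
    by (auto simp: carrier_prime_prod PiE_iff extensional_restrict fam_def)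
  have "prime_class R f = prime_class R u"
    using I.a_repr_independence'[OF _ restrict_fam[OF assms(1)]] assms(2) by (simp add: prime_class_def r)
  then show ?thesis using u by simp
qed

lemma class_int: "prime_class R (\<lambda>p. [n] \<cdot>\<^bsub>R p\<^esub> \<one>\<^bsub>R p\<^esub>) = [n] \<cdot>\<^bsub>quot\<^esub> \<one>\<^bsub>quot\<^esub>" for n :: int
proof -
  interpret P: cring "prime_prod R" by (rule cring_prime_prod)
  interpret Q: cring quot by (rule cring_quot)
  have "([n] \<cdot>\<^bsub>prime_prod R\<^esub> \<one>\<^bsub>prime_prod R\<^esub>) p = [n] \<cdot>\<^bsub>R p\<^esub> \<one>\<^bsub>R p\<^esub>" if p: "p \<in> primes" for p
  proof (rule ring_hom_int[where h = "\<lambda>f. f p" and R = "prime_prod R"])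
    show "(\<lambda>f. f p) \<in> ring_hom (prime_prod R) (R p)"
      using p by (auto intro!: ring_hom_memI simp: carrier_prime_prod)
  qed (use cring_R[OF p] P.ring_axioms in \<open>auto simp: cring_def\<close>)
  moreover have "[n] \<cdot>\<^bsub>prime_prod R\<^esub> \<one>\<^bsub>prime_prod R\<^esub> \<in> carrier (prime_prod R)"
    by (intro P.add.int_pow_closed P.one_closed)
  ultimately have "restrict (\<lambda>p. [n] \<cdot>\<^bsub>R p\<^esub> \<one>\<^bsub>R p\<^esub>) primes = [n] \<cdot>\<^bsub>prime_prod R\<^esub> \<one>\<^bsub>prime_prod R\<^esub>"
    by (intro ext) (auto simp: carrier_prime_prod PiE_iff extensional_def)
  then show ?thesis
    using ring_hom_int[OF P.ring_axioms Q.ring_axioms class_hom] by (simp add: prime_class_def)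
qed

text \<open>A positive integer n is invertible at every prime not dividing it, and the finitely many
  exceptions, all at most n, disappear in the quotient.\<close>

lemma rat_ring_quot: "rat_ring quot"
  unfolding rat_ring_def rat_ring_axioms_def
proof (intro conjI cring_quot allI impI)
  fix n :: int assume n: "0 < n"
  have "\<exists>y. y \<in> carrier (R p) \<and> (\<not> int p dvd n \<longrightarrow> [n] \<cdot>\<^bsub>R p\<^esub> \<one>\<^bsub>R p\<^esub> \<otimes>\<^bsub>R p\<^esub> y = \<one>\<^bsub>R p\<^esub>)" if p: "p \<in> primes" for p
  proof (cases "int p dvd n")
    case True
    then show ?thesis using closed(4)[OF p] by auto
  next
    case False
    then have "coprime n (int p)"
      using p prime_imp_coprime[of "int p" n] by (simp add: primes_iff coprime_commute)
    then show ?thesis using cring.int_invertible_mod[OF cring_R[OF p] char_R[OF p]] by auto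
  qed
  then obtain y where y: "\<And>p. p \<in> primes \<Longrightarrow> y p \<in> carrier (R p)"
      "\<And>p. p \<in> primes \<Longrightarrow> \<not> int p dvd n \<Longrightarrow> [n] \<cdot>\<^bsub>R p\<^esub> \<one>\<^bsub>R p\<^esub> \<otimes>\<^bsub>R p\<^esub> y p = \<one>\<^bsub>R p\<^esub>"
    by metis
  have fam: "y \<in> fam" "(\<lambda>p. [n] \<cdot>\<^bsub>R p\<^esub> \<one>\<^bsub>R p\<^esub>) \<in> fam" "(\<lambda>p. \<one>\<^bsub>R p\<^esub>) \<in> fam"
    "(\<lambda>p. [n] \<cdot>\<^bsub>R p\<^esub> \<one>\<^bsub>R p\<^esub> \<otimes>\<^bsub>R p\<^esub> y p) \<in> fam"
    using y(1) int_closed by (auto simp: fam_def closed)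
  have "{p \<in> primes. [n] \<cdot>\<^bsub>R p\<^esub> \<one>\<^bsub>R p\<^esub> \<otimes>\<^bsub>R p\<^esub> y p \<noteq> \<one>\<^bsub>R p\<^esub>} \<subseteq> {p. p \<le> nat n}"
  proof safe
    fix p assume "p \<in> primes" "[n] \<cdot>\<^bsub>R p\<^esub> \<one>\<^bsub>R p\<^esub> \<otimes>\<^bsub>R p\<^esub> y p \<noteq> \<one>\<^bsub>R p\<^esub>"
    then have "int p dvd n" using y(2) by blast
    then show "p \<le> nat n" using zdvd_imp_le[of "int p" n] n by linarith
  qed
  then have "prime_class R (\<lambda>p. [n] \<cdot>\<^bsub>R p\<^esub> \<one>\<^bsub>R p\<^esub> \<otimes>\<^bsub>R p\<^esub> y p) = prime_class R (\<lambda>p. \<one>\<^bsub>R p\<^esub>)"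
    unfolding class_eq_iff[OF fam(4,3)] by (rule finite_subset) simp
  then have "[n] \<cdot>\<^bsub>quot\<^esub> \<one>\<^bsub>quot\<^esub> \<otimes>\<^bsub>quot\<^esub> prime_class R y = \<one>\<^bsub>quot\<^esub>"
    by (simp add: class_mult[OF fam(2,1)] class_one class_int)
  then show "\<exists>y\<in>carrier quot. [n] \<cdot>\<^bsub>quot\<^esub> \<one>\<^bsub>quot\<^esub> \<otimes>\<^bsub>quot\<^esub> y = \<one>\<^bsub>quot\<^esub>"
    using class_closed[OF fam(1)] by blast
qed

end

section \<open>The rings of cyclotomic integers\<close>

definition zring :: "complex \<Rightarrow> complex set" where
  "zring z = generate_ring ring_of_type_algebra {z}"

lemma zring_closed [simp]:
  shows zring_1: "1 \<in> zring z" and zring_z: "z \<in> zring z"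
    and zring_add: "a \<in> zring z \<Longrightarrow> b \<in> zring z \<Longrightarrow> a + b \<in> zring z"
    and zring_mult: "a \<in> zring z \<Longrightarrow> b \<in> zring z \<Longrightarrow> a * b \<in> zring z"
    and zring_uminus: "a \<in> zring z \<Longrightarrow> - a \<in> zring z"
proof -
  interpret C: cring "ring_of_type_algebra :: complex ring" by (rule cring_from_type_algebra)
  have uminus: "\<ominus>\<^bsub>ring_of_type_algebra\<^esub> a = - a" for a :: complex
    by (rule C.minus_equality) auto
  show "1 \<in> zring z" using generate_ring.one[of ring_of_type_algebra "{z}"] by (simp add: zring_def)
  show "z \<in> zring z" by (auto simp: zring_def intro: generate_ring.incl)
  show "a + b \<in> zring z" if "a \<in> zring z" "b \<in> zring z"
    using generate_ring.eng_add[of a ring_of_type_algebra "{z}" b] that by (simp add: zring_def)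
  show "a * b \<in> zring z" if "a \<in> zring z" "b \<in> zring z"
    using generate_ring.eng_mult[of a ring_of_type_algebra "{z}" b] that by (simp add: zring_def)
  show "- a \<in> zring z" if "a \<in> zring z"
    using generate_ring.a_inv[of a ring_of_type_algebra "{z}"] that by (simp add: zring_def uminus)
qed

lemma zring_induct [consumes 1, case_names one root uminus add mult]:
  assumes "a \<in> zring z" "P 1" "P z" "\<And>a. a \<in> zring z \<Longrightarrow> P a \<Longrightarrow> P (- a)"
    "\<And>a b. a \<in> zring z \<Longrightarrow> b \<in> zring z \<Longrightarrow> P a \<Longrightarrow> P b \<Longrightarrow> P (a + b)"
    "\<And>a b. a \<in> zring z \<Longrightarrow> b \<in> zring z \<Longrightarrow> P a \<Longrightarrow> P b \<Longrightarrow> P (a * b)"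
  shows "P a"
proof -
  interpret C: cring "ring_of_type_algebra :: complex ring" by (rule cring_from_type_algebra)
  have uminus: "\<ominus>\<^bsub>ring_of_type_algebra\<^esub> a = - a" for a :: complex
    by (rule C.minus_equality) auto
  from assms(1) show ?thesis
    unfolding zring_def
    by (induction rule: generate_ring.induct) (use assms(2-) in \<open>auto simp: uminus zring_def\<close>)
qed

lemma zring_0 [simp]: "0 \<in> zring z"
  using zring_add[of 1 z "- 1"] by simp

lemma zring_diff [simp]: "a \<in> zring z \<Longrightarrow> b \<in> zring z \<Longrightarrow> a - b \<in> zring z"
  using zring_add[of a z "- b"] by simp

lemma zring_power [simp]: "a \<in> zring z \<Longrightarrow> a ^ n \<in> zring z"
  by (induction n) auto

lemma zring_of_nat [simp]: "of_nat n \<in> zring z"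
  by (induction n) auto

lemma zring_of_int [simp]: "of_int n \<in> zring z"
  by (cases n rule: int_cases2) auto

lemma zring_sum: "(\<And>i. i \<in> I \<Longrightarrow> f i \<in> zring z) \<Longrightarrow> (\<Sum>i\<in>I. f i) \<in> zring z"
  by (induction I rule: infinite_finite_induct) auto

lemma zring_prod: "(\<And>i. i \<in> I \<Longrightarrow> f i \<in> zring z) \<Longrightarrow> (\<Prod>i\<in>I. f i) \<in> zring z"
  by (induction I rule: infinite_finite_induct) auto

lemma cyc_ring_simps [simp]:
  "carrier (cyc_ring z) = zring z" "a \<otimes>\<^bsub>cyc_ring z\<^esub> b = a * b" "\<one>\<^bsub>cyc_ring z\<^esub> = 1"
  "\<zero>\<^bsub>cyc_ring z\<^esub> = 0" "a \<oplus>\<^bsub>cyc_ring z\<^esub> b = a + b"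
  by (simp_all add: cyc_ring_def zring_def ring_of_type_algebra_def)

lemma cring_cyc_ring: "cring (cyc_ring z)"
proof (intro cringI abelian_groupI comm_monoidI)
  show "\<exists>b\<in>carrier (cyc_ring z). b \<oplus>\<^bsub>cyc_ring z\<^esub> a = \<zero>\<^bsub>cyc_ring z\<^esub>" if "a \<in> carrier (cyc_ring z)" for a
    using that by (intro bexI[of _ "- a"]) auto
qed (auto simp: algebra_simps)

lemma cyc_ring_int: "[n] \<cdot>\<^bsub>cyc_ring z\<^esub> 1 = of_int n" for n :: int
proof -
  have "id ([n] \<cdot>\<^bsub>cyc_ring z\<^esub> \<one>\<^bsub>cyc_ring z\<^esub>) = [n] \<cdot>\<^bsub>ring_of_type_algebra\<^esub> \<one>\<^bsub>ring_of_type_algebra\<^esub>"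
  proof (rule ring_hom_int)
    show "ring (cyc_ring z)" using cring_cyc_ring by (simp add: cring_def)
    show "id \<in> ring_hom (cyc_ring z) ring_of_type_algebra" by (rule ring_hom_memI) auto
  qed (rule ring_from_type_algebra)
  then show ?thesis by (simp add: int_ring_of_type_algebra)
qed

lemma cyc_PIdl: "PIdl\<^bsub>cyc_ring z\<^esub> a = {a * b | b. b \<in> zring z}"
  by (auto simp: cgenideal_def mult.commute)

lemma ideal_cyc_PIdl: "a \<in> zring z \<Longrightarrow> ideal (PIdl\<^bsub>cyc_ring z\<^esub> a) (cyc_ring z)"
  using cring.cgenideal_ideal[OF cring_cyc_ring] by simp

lemma cyc_coset_eq:
  assumes "a \<in> zring z" "x \<in> zring z" "y \<in> zring z"
  shows "PIdl\<^bsub>cyc_ring z\<^esub> a +>\<^bsub>cyc_ring z\<^esub> x = PIdl\<^bsub>cyc_ring z\<^esub> a +>\<^bsub>cyc_ring z\<^esub> y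
    \<longleftrightarrow> (\<exists>b\<in>zring z. x - y = a * b)"
proof -
  interpret C: cring "cyc_ring z" by (rule cring_cyc_ring)
  have "\<ominus>\<^bsub>cyc_ring z\<^esub> y = - y" using assms by (intro C.minus_equality) auto
  then have "x \<ominus>\<^bsub>cyc_ring z\<^esub> y = x - y" by (simp add: a_minus_def)
  then show ?thesis
    using C.quotient_eq_iff_same_a_r_cos[OF ideal_cyc_PIdl[OF assms(1)], of x y] assms by (auto simp: cyc_PIdl)
qed

locale prime_root =
  fixes p :: nat and z :: complex
  assumes p: "Factorial_Ring.prime p" and root: "primitive_root_of_unity p z"
begin

lemma p2: "2 \<le> p" using p by (rule prime_ge_2_nat)

lemma z_power: "z ^ p = 1" and z_power_neq: "0 < m \<Longrightarrow> m < p \<Longrightarrow> z ^ m \<noteq> 1" and z_neq: "z \<noteq> 1" "z \<noteq> 0"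
proof -
  show 1: "z ^ p = 1" and 2: "0 < m \<Longrightarrow> m < p \<Longrightarrow> z ^ m \<noteq> 1" for m
    using root by (auto simp: primitive_root_of_unity_def)
  show "z \<noteq> 1" using 2[of 1] p2 by auto
  show "z \<noteq> 0" using 1 p2 by (auto simp: power_0_left)
qed

lemma one_minus_power: "\<exists>b\<in>zring z. 1 - z ^ n = (1 - z) * b"
  using one_diff_power_eq[of z n] zring_sum[of "{..<n}" "\<lambda>i. z ^ i"] by auto

text \<open>The powers of z sum to 0, so p is the sum of the 1 - z^i, each a multiple of 1 -
  z.\<close>

lemma p_multiple: "\<exists>b\<in>zring z. of_nat p = (1 - z) * b"
proof -
  have "\<exists>b. \<forall>n. b n \<in> zring z \<and> 1 - z ^ n = (1 - z) * b n" using one_minus_power by metis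
  then obtain b where b: "\<And>n. b n \<in> zring z" "\<And>n. 1 - z ^ n = (1 - z) * b n" by blast
  have "(1 - z) * (\<Sum>i<p. z ^ i) = 0" using one_diff_power_eq[of z p] z_power by simp
  then have "(\<Sum>i<p. z ^ i) = 0" using z_neq by simp
  then have "of_nat p = (\<Sum>i<p. 1 - z ^ i)" by (simp add: sum_subtractf)
  also have "\<dots> = (1 - z) * (\<Sum>i<p. b i)" by (simp add: b(2) sum_distrib_left)
  finally show ?thesis using b by (auto intro!: bexI[of _ "\<Sum>i<p. b i"] zring_sum)
qed

lemma congruent_to_int: "a \<in> zring z \<Longrightarrow> \<exists>c::int. \<exists>b\<in>zring z. a = of_int c + (1 - z) * b"
proof (induction rule: zring_induct)
  case one
  show ?case by (intro exI[of _ 1] bexI[of _ 0]) auto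
next
  case root
  show ?case by (intro exI[of _ 1] bexI[of _ "- 1"]) auto
next
  case (uminus a)
  then obtain c b where "a = of_int c + (1 - z) * b" "b \<in> zring z" by blast
  then show ?case by (intro exI[of _ "- c"] bexI[of _ "- b"]) auto
next
  case (add a a')
  then obtain c b c' b' where *: "a = of_int c + (1 - z) * b" "a' = of_int c' + (1 - z) * b'"
      and b: "b \<in> zring z" "b' \<in> zring z"
    by blast
  show ?case
    unfolding * using b by (intro exI[of _ "c + c'"] bexI[of _ "b + b'"]) (auto simp: algebra_simps)
next
  case (mult a a')
  then obtain c b c' b' where *: "a = of_int c + (1 - z) * b" "a' = of_int c' + (1 - z) * b'"
      and b: "b \<in> zring z" "b' \<in> zring z"
    by blast
  show ?case
    unfolding * using b by (intro exI[of _ "c * c'"] bexI[of _ "of_int c * b' + of_int c' * b + (1 - z) * b * b'"]) (auto simp: algebra_simps)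
qed

text \<open>A finite set of generators is all that is sought, for a bound on denominators; the
  powers are not independent. Exponents are reduced modulo p, and \<open>e\<close> records the
  reduction.\<close>

lemma zring_sum_powers: "a \<in> zring z \<Longrightarrow> \<exists>c :: nat \<Rightarrow> int. a = (\<Sum>i<p. of_int (c i) * z ^ i)"
proof (induction rule: zring_induct)
  have pow: "\<exists>c :: nat \<Rightarrow> int. z ^ n = (\<Sum>i<p. of_int (c i) * z ^ i)" for n
  proof -
    have "z ^ n = z ^ (p * (n div p) + n mod p)" by simp
    also have "\<dots> = z ^ (n mod p)" by (simp only: power_add power_mult z_power power_one mult_1)
    also have "\<dots> = (\<Sum>i<p. of_int (if i = n mod p then 1 else 0) * z ^ i)"
      using p2 by (simp add: if_distrib[of of_int] if_distrib[of "\<lambda>x. x * _"] cong: if_cong)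
    finally show ?thesis by (intro exI[of _ "\<lambda>i. if i = n mod p then 1 else 0"])
  qed
  {
    case one
    show ?case using pow[of 0] by simp
  next
    case root
    show ?case using pow[of 1] by simp
  next
    case (uminus a)
    then obtain c :: "nat \<Rightarrow> int" where "a = (\<Sum>i<p. of_int (c i) * z ^ i)" by blast
    then show ?case by (intro exI[of _ "\<lambda>i. - c i"]) (simp add: sum_negf)
  next
    case (add a b)
    then obtain c d :: "nat \<Rightarrow> int" where "a = (\<Sum>i<p. of_int (c i) * z ^ i)" "b = (\<Sum>i<p. of_int (d i) * z ^ i)" by blast
    then show ?case by (intro exI[of _ "\<lambda>i. c i + d i"]) (simp add: sum.distrib distrib_right)
  next
    case (mult a b)
    then obtain c d :: "nat \<Rightarrow> int" where cd: "a = (\<Sum>i<p. of_int (c i) * z ^ i)" "b = (\<Sum>i<p. of_int (d i) * z ^ i)" by blast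
    obtain e :: "nat \<Rightarrow> nat \<Rightarrow> int" where e: "\<And>n. z ^ n = (\<Sum>i<p. of_int (e n i) * z ^ i)" using pow by metis
    have "a * b = (\<Sum>i<p. \<Sum>j<p. of_int (c i * d j) * z ^ (i + j))"
      unfolding cd sum_product by (simp add: power_add mult_ac)
    also have "\<dots> = (\<Sum>i<p. \<Sum>j<p. \<Sum>l<p. of_int (c i * d j * e (i + j) l) * z ^ l)"
      by (intro sum.cong refl, subst e) (simp add: sum_distrib_left mult_ac)
    also have "\<dots> = (\<Sum>i<p. \<Sum>l<p. \<Sum>j<p. of_int (c i * d j * e (i + j) l) * z ^ l)"
      by (intro sum.cong refl sum.swap)
    also have "\<dots> = (\<Sum>l<p. \<Sum>i<p. \<Sum>j<p. of_int (c i * d j * e (i + j) l) * z ^ l)"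
      by (rule sum.swap)
    also have "\<dots> = (\<Sum>l<p. of_int (\<Sum>i<p. \<Sum>j<p. c i * d j * e (i + j) l) * z ^ l)"
      by (simp add: sum_distrib_right)
    finally show ?case by (intro exI[of _ "\<lambda>l. \<Sum>i<p. \<Sum>j<p. c i * d j * e (i + j) l"])
  }
qed

text \<open>
  A rational linear functional \<open>g\<close> with \<open>g 1 = 1\<close> has bounded denominators on the finitely generated
  group \<open>\<int>[z]\<close>, which therefore cannot contain all powers of \<open>1/p\<close>.
\<close>

lemma p_not_unit:
  assumes "d \<in> zring z"
  shows "of_nat p * d \<noteq> 1"
proof
  assume d: "of_nat p * d = 1"
  interpret V: vector_space "\<lambda>(q::rat) (x::complex). of_rat q * x"
    by unfold_locales (auto simp: algebra_simps of_rat_add of_rat_mult)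
  interpret VV: vector_space_pair "\<lambda>(q::rat) (x::complex). of_rat q * x" "\<lambda>(q::rat) (x::rat). q * x"
    by unfold_locales (auto simp: algebra_simps)
  have "V.independent {1}" by (simp add: V.dependent_single)
  then obtain g where g: "Vector_Spaces.linear (\<lambda>(q::rat) (x::complex). of_rat q * x) (\<lambda>(q::rat) (x::rat). q * x) g" "g 1 = 1"
    using VV.linear_independent_extend[of "{1}" "\<lambda>_. 1"] by blast
  interpret g: Vector_Spaces.linear "\<lambda>(q::rat) (x::complex). of_rat q * x" "\<lambda>(q::rat) (x::rat). q * x" g by fact
  have g_rat: "g (of_rat q * x) = q * g x" for q x by (rule g.scale)
  \<comment> \<open>A common denominator of the values of \<open>g\<close> on the p
    generators.\<close>
  define N where "N = (\<Prod>i<p. snd (quotient_of (g (z ^ i))))"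
  have N: "0 < N" unfolding N_def by (intro prod_pos) (simp add: quotient_of_denom_pos')
  have N_int: "of_int N * g (z ^ i) \<in> \<int>" if "i < p" for i
  proof -
    obtain a b where q: "quotient_of (g (z ^ i)) = (a, b)" by force
    have "b dvd N" unfolding N_def using that dvd_prodI[of "{..<p}" i "\<lambda>i. snd (quotient_of (g (z ^ i)))"] q by simp
    then obtain k where "N = b * k" ..
    then have "of_int N * g (z ^ i) = of_int (a * k)"
      using quotient_of_div[OF q] quotient_of_denom_pos[OF q] by simp
    then show ?thesis by (metis Ints_of_int)
  qed
  have bound: "of_int N * g a \<in> \<int>" if "a \<in> zring z" for a
  proof -
    from zring_sum_powers[OF that] obtain c :: "nat \<Rightarrow> int" where "a = (\<Sum>i<p. of_int (c i) * z ^ i)" by blast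
    then have "g a = (\<Sum>i<p. of_int (c i) * g (z ^ i))"
      using g_rat[of "of_int _"] by (simp add: g.sum)
    then have "of_int N * g a = (\<Sum>i<p. of_int (c i) * (of_int N * g (z ^ i)))"
      by (simp add: sum_distrib_left mult_ac)
    also have "\<dots> \<in> \<int>" by (intro Ints_sum Ints_mult N_int) auto
    finally show ?thesis .
  qed
  \<comment> \<open>\<open>N\<close> itself serves as exponent, because N < 2^N \<le> p^N.\<close>
  define k where "k = nat N"
  have "of_nat (p ^ k) * d ^ k = 1" using d by (simp flip: power_mult_distrib)
  then have "d ^ k = of_rat (1 / of_nat (p ^ k)) * 1"
    using p2 by (simp add: of_rat_divide of_rat_power field_simps)
  then have "g (d ^ k) = 1 / of_nat (p ^ k)" using g_rat[of _ 1] g(2) by simp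
  then have "of_int N / of_nat (p ^ k) \<in> (\<int> :: rat set)" using bound[of "d ^ k"] assms by simp
  then obtain m :: int where "of_int N / of_nat (p ^ k) = (of_int m :: rat)" by (elim Ints_cases)
  then have "(of_int N :: rat) = of_int (m * int (p ^ k))" using p2 by (simp add: field_simps)
  then have "N = m * int (p ^ k)" by (simp only: of_int_eq_iff)
  then have "int (p ^ k) \<le> N" using N by (intro zdvd_imp_le) auto
  moreover have "k < p ^ k" using p2 less_exp[of k] power_mono[of 2 p k] by linarith
  then have "N < int (p ^ k)" using N unfolding k_def by linarith
  ultimately show False by simp
qed

text \<open>Otherwise \<open>1 - z\<close> is a unit, and so is \<open>p\<close>, because it divides \<open>(1 - z)\<^sup>p\<close>.\<close>

lemma int_multiple_dvd:
  assumes "of_int n = (1 - z) * b" "b \<in> zring z"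
  shows "int p dvd n"
proof (rule ccontr)
  assume "\<not> int p dvd n"
  then have "coprime n (int p)" using p prime_imp_coprime[of "int p" n] by (simp add: coprime_commute)
  then obtain u v where "u * n + v * int p = 1" using bezout_int[of n "int p"] by auto
  then have uv: "of_int u * of_int n + of_int v * of_nat p = (1::complex)"
    by (metis of_int_1 of_int_add of_int_mult of_int_of_nat_eq)
  obtain c where c: "c \<in> zring z" "of_nat p = (1 - z) * c" using p_multiple by blast
  \<comment> \<open>The Bezout relation between n and p, both multiples of 1 - z, exhibits an
    inverse of 1 - z.\<close>
  define g where "g = of_int u * b + of_int v * c"
  have "(1 - z) * g = of_int u * ((1 - z) * b) + of_int v * ((1 - z) * c)" by (simp add: g_def algebra_simps)
  also have "\<dots> = 1" unfolding assms(1)[symmetric] c(2)[symmetric] by (rule uv)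
  finally have g: "g \<in> zring z" "(1 - z) * g = 1" using assms c by (auto simp: g_def)
  have "\<exists>d\<in>zring z. (1 - z) ^ p = of_nat p * d"
  proof -
    have "(1 - z) ^ p = (- z + 1) ^ p" by simp
    also have "\<dots> = (\<Sum>k\<le>p. of_nat (p choose k) * (- z) ^ k)" using binomial_ring[of "- z" 1 p] by simp
    also have "{..p} = insert 0 (insert p {0<..<p})" using p2 by auto
    also have "(\<Sum>k\<in>insert 0 (insert p {0<..<p}). of_nat (p choose k) * (- z) ^ k)
        = 1 + (- z) ^ p + (\<Sum>k\<in>{0<..<p}. of_nat (p choose k) * (- z) ^ k)"
      using p2 by simp
    also have "(\<Sum>k\<in>{0<..<p}. of_nat (p choose k) * (- z) ^ k)
        = of_nat p * (\<Sum>k\<in>{0<..<p}. of_nat ((p choose k) div p) * (- z) ^ k)"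
      unfolding sum_distrib_left
    proof (intro sum.cong refl)
      fix k assume "k \<in> {0<..<p}"
      then have "p dvd p choose k" using p by (intro dvd_choose_prime) auto
      then have "of_nat (p choose k) = (of_nat p * of_nat ((p choose k) div p) :: complex)"
        by (metis dvd_mult_div_cancel of_nat_mult)
      then show "of_nat (p choose k) * (- z) ^ k = of_nat p * (of_nat ((p choose k) div p) * (- z) ^ k)" by simp
    qed
    finally have e: "(1 - z) ^ p = 1 + (- z) ^ p + of_nat p * (\<Sum>k\<in>{0<..<p}. of_nat ((p choose k) div p) * (- z) ^ k)" .
    \<comment> \<open>The sum is 2 for p = 2 and 0 for odd p.\<close>
    have "\<exists>d\<in>zring z. 1 + (- z) ^ p = of_nat p * d"
    proof (cases "p = 2")
      case True
      then show ?thesis using z_power by (intro bexI[of _ 1]) auto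
    next
      case False
      then have "odd p" using p prime_odd_nat[of p] p2 by auto
      then show ?thesis using z_power by (intro bexI[of _ 0]) auto
    qed
    then obtain d where "d \<in> zring z" "1 + (- z) ^ p = of_nat p * d" by blast
    then show ?thesis
      unfolding e by (intro bexI[of _ "d + (\<Sum>k\<in>{0<..<p}. of_nat ((p choose k) div p) * (- z) ^ k)"])
        (simp_all add: distrib_left zring_sum)
  qed
  then obtain d where d: "d \<in> zring z" "(1 - z) ^ p = of_nat p * d" by blast
  have "of_nat p * (d * g ^ p) = ((1 - z) * g) ^ p" by (simp add: power_mult_distrib d(2) mult.assoc)
  then have "of_nat p * (d * g ^ p) = 1" by (simp add: g(2))
  then show False using p_not_unit[of "d * g ^ p"] d(1) g(1) by simp
qed

section \<open>The residue map modulo 1 - z\<close>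

lemma Fp_simps:
  "carrier (Fp p) = {0..<int p}" "x \<otimes>\<^bsub>Fp p\<^esub> y = x * y mod int p" "x \<oplus>\<^bsub>Fp p\<^esub> y = (x + y) mod int p"
  "\<one>\<^bsub>Fp p\<^esub> = 1" "\<zero>\<^bsub>Fp p\<^esub> = 0"
  by (auto simp: Fp_def residue_ring_def)

text \<open>This gives \<open>cyc_residue\<close> a definite value: an element is congruent to an
  integer, which may be reduced since p is a multiple of 1 - z, and two such integers differ by a
  multiple of p.\<close>

lemma cyc_residue_ex1:
  assumes "a \<in> zring z"
  shows "\<exists>!c. c \<in> carrier (Fp p) \<and> (PIdl\<^bsub>cyc_ring z\<^esub> (1 - z)) +>\<^bsub>cyc_ring z\<^esub> of_int c
     = (PIdl\<^bsub>cyc_ring z\<^esub> (1 - z)) +>\<^bsub>cyc_ring z\<^esub> a"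
proof -
  have eq: "(PIdl\<^bsub>cyc_ring z\<^esub> (1 - z)) +>\<^bsub>cyc_ring z\<^esub> of_int c
     = (PIdl\<^bsub>cyc_ring z\<^esub> (1 - z)) +>\<^bsub>cyc_ring z\<^esub> a \<longleftrightarrow> (\<exists>b\<in>zring z. of_int c - a = (1 - z) * b)" for c
    using assms by (intro cyc_coset_eq) auto
  obtain c b where c: "a = of_int c + (1 - z) * b" "b \<in> zring z" using congruent_to_int[OF assms] by blast
  obtain d where d: "d \<in> zring z" "of_nat p = (1 - z) * d" using p_multiple by blast
  show ?thesis
  proof (rule ex1I[of _ "c mod int p"])
    have "of_int (c mod int p) = of_int c - of_nat p * (of_int (c div int p) :: complex)"
      by (metis minus_mult_div_eq_mod of_int_diff of_int_mult of_int_of_nat_eq)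
    then have "of_int (c mod int p) - a = (1 - z) * (- b - d * of_int (c div int p))"
      using c d by (simp add: algebra_simps)
    then show "c mod int p \<in> carrier (Fp p) \<and> (PIdl\<^bsub>cyc_ring z\<^esub> (1 - z)) +>\<^bsub>cyc_ring z\<^esub> of_int (c mod int p)
     = (PIdl\<^bsub>cyc_ring z\<^esub> (1 - z)) +>\<^bsub>cyc_ring z\<^esub> a"
      unfolding eq using c d p2 by (auto simp: Fp_simps intro!: bexI[of _ "- b - d * of_int (c div int p)"])
  next
    fix c' assume "c' \<in> carrier (Fp p) \<and> (PIdl\<^bsub>cyc_ring z\<^esub> (1 - z)) +>\<^bsub>cyc_ring z\<^esub> of_int c'
     = (PIdl\<^bsub>cyc_ring z\<^esub> (1 - z)) +>\<^bsub>cyc_ring z\<^esub> a"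
    then obtain b' where c': "c' \<in> {0..<int p}" "b' \<in> zring z" "of_int c' - a = (1 - z) * b'"
      unfolding eq by (auto simp: Fp_simps)
    have "of_int (c' - c) = (of_int c' - a) + (a - of_int c)" by simp
    also have "\<dots> = (1 - z) * (b' + b)" unfolding c'(3) using c(1) by (simp add: distrib_left)
    finally have "of_int (c' - c) = (1 - z) * (b' + b)" .
    then have "int p dvd c' - c" by (rule int_multiple_dvd) (use c c' in auto)
    then have "c' mod int p = c mod int p" by (simp add: mod_eq_dvd_iff)
    then show "c' = c mod int p" using c' by simp
  qed
qed

lemma cyc_residue_props:
  assumes "a \<in> zring z"
  shows "cyc_residue z p a \<in> carrier (Fp p)" "\<exists>b\<in>zring z. of_int (cyc_residue z p a) - a = (1 - z) * b"
  using theI'[OF cyc_residue_ex1[OF assms]] assms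
  unfolding cyc_residue_def[symmetric] by (auto simp: cyc_coset_eq)

lemma cyc_residue_eqI:
  assumes "a \<in> zring z" "b \<in> zring z" "of_int c - a = (1 - z) * b"
  shows "cyc_residue z p a = c mod int p"
proof -
  obtain b' where b': "b' \<in> zring z" "of_int (cyc_residue z p a) - a = (1 - z) * b'"
    using cyc_residue_props(2)[OF assms(1)] by blast
  have "of_int (cyc_residue z p a - c) = (of_int (cyc_residue z p a) - a) - (of_int c - a)" by simp
  also have "\<dots> = (1 - z) * (b' - b)" unfolding b'(2) assms(3) by (simp add: right_diff_distrib)
  finally have "int p dvd cyc_residue z p a - c" by (rule int_multiple_dvd) (use assms b' in auto)
  then have "cyc_residue z p a mod int p = c mod int p" by (simp add: mod_eq_dvd_iff)
  then show ?thesis using cyc_residue_props(1)[OF assms(1)] by (simp add: Fp_simps)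
qed

lemma cyc_residue_hom: "cyc_residue z p \<in> ring_hom (cyc_ring z) (Fp p)"
proof (rule ring_hom_memI)
  fix a a' assume "a \<in> carrier (cyc_ring z)" "a' \<in> carrier (cyc_ring z)"
  then have a: "a \<in> zring z" "a' \<in> zring z" by auto
  obtain b where b: "b \<in> zring z" "of_int (cyc_residue z p a) - a = (1 - z) * b" using cyc_residue_props(2) a by blast
  obtain b' where b': "b' \<in> zring z" "of_int (cyc_residue z p a') - a' = (1 - z) * b'" using cyc_residue_props(2) a by blast
  have 1: "of_int (cyc_residue z p a) = a + (1 - z) * b" "of_int (cyc_residue z p a') = a' + (1 - z) * b'"
    using b b' by (auto simp: algebra_simps)
  show "cyc_residue z p (a \<otimes>\<^bsub>cyc_ring z\<^esub> a') = cyc_residue z p a \<otimes>\<^bsub>Fp p\<^esub> cyc_residue z p a'"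
    unfolding cyc_ring_simps Fp_simps
    by (rule cyc_residue_eqI[of _ "b * a' + b' * a + (1 - z) * b * b'"]) (use a b b' in \<open>auto simp: 1 algebra_simps\<close>)
  show "cyc_residue z p (a \<oplus>\<^bsub>cyc_ring z\<^esub> a') = cyc_residue z p a \<oplus>\<^bsub>Fp p\<^esub> cyc_residue z p a'"
    unfolding cyc_ring_simps Fp_simps
    by (rule cyc_residue_eqI[of _ "b + b'"]) (use a b b' in \<open>auto simp: 1 algebra_simps\<close>)
next
  have "cyc_residue z p 1 = 1 mod int p" by (rule cyc_residue_eqI[of _ 0]) auto
  then show "cyc_residue z p \<one>\<^bsub>cyc_ring z\<^esub> = \<one>\<^bsub>Fp p\<^esub>" using p2 by (simp add: Fp_simps)
qed (simp add: cyc_residue_props)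

text \<open>As p lies in the ideal of 1 - z, the residue is defined on classes modulo p.\<close>

lemma cyc_residue_mod_p:
  assumes "a \<in> zring z" "b \<in> zring z" "d \<in> zring z" "a - b = of_nat p * d"
  shows "cyc_residue z p a = cyc_residue z p b"
proof -
  obtain c where c: "c \<in> zring z" "of_nat p = (1 - z) * c" using p_multiple by blast
  obtain b' where b': "b' \<in> zring z" "of_int (cyc_residue z p b) - b = (1 - z) * b'"
    using cyc_residue_props(2)[OF assms(2)] by blast
  have "of_int (cyc_residue z p b) - a = (of_int (cyc_residue z p b) - b) - (a - b)" by simp
  also have "\<dots> = (1 - z) * (b' - c * d)" unfolding b'(2) assms(4) c(2) by (simp add: right_diff_distrib)
  finally have "cyc_residue z p a = cyc_residue z p b mod int p"
    using assms b' c by (intro cyc_residue_eqI[of _ "b' - c * d"]) auto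
  then show ?thesis using cyc_residue_props(1)[OF assms(2)] by (simp add: Fp_simps)
qed

end

section \<open>The values at roots of unity\<close>

context prime_root
begin

lemma qint_eq_sum: "qint z m = (\<Sum>j<m. z ^ j)"
  using one_diff_power_eq[of z m] z_neq by (simp add: qint_def)

lemma qint_neq_0: "0 < m \<Longrightarrow> m < p \<Longrightarrow> qint z m \<noteq> 0"
  using z_power_neq[of m] z_neq by (simp add: qint_def)

lemma qint_zring: "qint z m \<in> zring z"
  unfolding qint_eq_sum by (rule zring_sum) simp

text \<open>Choose l with m l congruent to 1 modulo p; then 1 - z = 1 - (z^m)^l is a multiple of 1 -
  z^m, with a geometric sum as cofactor.\<close>

lemma inverse_qint_zring:
  assumes "0 < m" "m < p"
  shows "1 / qint z m \<in> zring z"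
proof -
  have "coprime m p"
    using p assms prime_imp_coprime[of p m] by (metis coprime_commute nat_dvd_not_less)
  then obtain l where "[m * l = Suc 0] (mod p)" using cong_solve_coprime_nat by blast
  moreover have "Suc 0 mod p = 1" using p2 by simp
  ultimately have "m * l mod p = 1" by (simp add: Cong.cong_def)
  have "z ^ (m * l) = z ^ (p * (m * l div p) + m * l mod p)" by simp
  also have "\<dots> = z" by (simp only: power_add power_mult z_power power_one mult_1 \<open>m * l mod p = 1\<close> power_one_right)
  finally have "1 - z = (1 - z ^ m) * (\<Sum>j<l. (z ^ m) ^ j)"
    using one_diff_power_eq[of "z ^ m" l] by (simp add: power_mult)
  then have "1 / qint z m = (\<Sum>j<l. (z ^ m) ^ j)"
    using z_power_neq[OF assms] by (simp add: qint_def field_simps)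
  also have "\<dots> \<in> zring z" by (rule zring_sum) simp
  finally show ?thesis .
qed

lemma cring_Fp: "cring (Fp p)"
  unfolding Fp_def by (rule residues.cring) (use p2 in \<open>simp add: residues_def\<close>)

sublocale res: ring_hom_cring "cyc_ring z" "Fp p" "cyc_residue z p"
  using cring_cyc_ring cring_Fp cyc_residue_hom
  unfolding ring_hom_cring_def ring_hom_cring_axioms_def by blast

lemma cyc_residue_of_int: "cyc_residue z p (of_int n) = n mod int p"
  by (rule cyc_residue_eqI[of _ 0]) auto

text \<open>All m powers of z in the geometric sum are congruent to 1 modulo 1 - z.\<close>

lemma cyc_residue_qint:
  assumes "m < p"
  shows "cyc_residue z p (qint z m) = int m"
proof -
  obtain b where b: "\<And>n. b n \<in> zring z" "\<And>n. 1 - z ^ n = (1 - z) * b n" using one_minus_power by metis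
  have "of_int (int m) - qint z m = (\<Sum>j<m. 1 - z ^ j)" by (simp add: qint_eq_sum sum_subtractf)
  also have "\<dots> = (1 - z) * (\<Sum>j<m. b j)" by (simp add: b(2) sum_distrib_left)
  finally have "cyc_residue z p (qint z m) = int m mod int p"
    by (rule cyc_residue_eqI[rotated 2]) (auto intro: zring_sum qint_zring b)
  then show ?thesis using assms by simp
qed

lemma cyc_residue_inverse_qint:
  assumes "0 < m" "m < p"
  shows "cyc_residue z p (1 / qint z m) = inv\<^bsub>Fp p\<^esub> (int m)"
proof -
  have "cyc_residue z p (qint z m \<otimes>\<^bsub>cyc_ring z\<^esub> (1 / qint z m)) = \<one>\<^bsub>Fp p\<^esub>"
    using qint_neq_0[OF assms] res.hom_one by simp
  then have "cyc_residue z p (qint z m) \<otimes>\<^bsub>Fp p\<^esub> cyc_residue z p (1 / qint z m) = \<one>\<^bsub>Fp p\<^esub>"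
    using qint_zring inverse_qint_zring[OF assms] by (subst (asm) res.hom_mult) auto
  then have "inv\<^bsub>Fp p\<^esub> cyc_residue z p (qint z m) = cyc_residue z p (1 / qint z m)"
    using qint_zring inverse_qint_zring[OF assms] by (intro res.S.comm_inv_char) auto
  then show ?thesis by (simp add: cyc_residue_qint assms)
qed

abbreviation qterm :: "nat \<Rightarrow> nat \<Rightarrow> complex" where
  "qterm k m \<equiv> z ^ ((k - 1) * m) / qint z m ^ k"

lemma qterm_eq: "qterm k m = z ^ ((k - 1) * m) * (1 / qint z m) ^ k"
  by (simp add: power_divide)

lemma qterm_zring: "0 < m \<Longrightarrow> m < p \<Longrightarrow> qterm k m \<in> zring z"
  unfolding qterm_eq using inverse_qint_zring by simp

lemma cyc_residue_qterm:
  assumes "0 < m" "m < p"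
  shows "cyc_residue z p (qterm k m) = (inv\<^bsub>Fp p\<^esub> (int m)) [^]\<^bsub>Fp p\<^esub> k"
proof -
  have "1 - z = (1 - z) * 1" by simp
  then have "cyc_residue z p z = 1 mod int p" by (intro cyc_residue_eqI[of _ 1]) auto
  then have z: "cyc_residue z p z = \<one>\<^bsub>Fp p\<^esub>" using p2 by (simp add: Fp_simps)
  have pow: "cyc_residue z p (a ^ n) = cyc_residue z p a [^]\<^bsub>Fp p\<^esub> n" if "a \<in> zring z" for a n
  proof (induction n)
    case (Suc n)
    then show ?case
      using res.hom_mult[of "a ^ n" a] that by (simp add: mult.commute)
  qed (use res.hom_one in simp)
  have "cyc_residue z p (qterm k m) = cyc_residue z p (z ^ ((k - 1) * m)) \<otimes>\<^bsub>Fp p\<^esub> cyc_residue z p ((1 / qint z m) ^ k)"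
    unfolding qterm_eq using inverse_qint_zring[OF assms] res.hom_mult[of "z ^ ((k - 1) * m)" "(1 / qint z m) ^ k"] by simp
  also have "\<dots> = (inv\<^bsub>Fp p\<^esub> (int m)) [^]\<^bsub>Fp p\<^esub> k"
    using inverse_qint_zring[OF assms] res.hom_closed[of "1 / qint z m"]
    by (simp only: pow zring_z z cyc_residue_inverse_qint[OF assms] res.S.nat_pow_one) simp
  finally show ?thesis .
qed

lemma decr_tuples_nth: "ms \<in> decr_tuples {0<..<p} r \<Longrightarrow> j < r \<Longrightarrow> 0 < ms ! j \<and> ms ! j < p"
  using nth_mem[of j ms] by (auto simp: decr_tuples_def subset_iff)

lemma qmzv_zring: "qmzv p ks z \<in> zring z"
  unfolding qmzv_def
  by (intro zring_sum zring_prod qterm_zring) (auto dest: decr_tuples_nth)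

lemma cyc_residue_sum:
  assumes "finite A" "\<And>i. i \<in> A \<Longrightarrow> f i \<in> zring z"
  shows "cyc_residue z p (\<Sum>i\<in>A. f i) = (\<Oplus>\<^bsub>Fp p\<^esub>i\<in>A. cyc_residue z p (f i))"
  using assms
proof (induction A rule: finite_induct)
  case (insert a A)
  have "cyc_residue z p (f a + (\<Sum>i\<in>A. f i)) = cyc_residue z p (f a) \<oplus>\<^bsub>Fp p\<^esub> cyc_residue z p (\<Sum>i\<in>A. f i)"
    using insert.prems res.hom_add[of "f a" "\<Sum>i\<in>A. f i"] by (simp add: zring_sum)
  moreover have "(\<Oplus>\<^bsub>Fp p\<^esub>i\<in>insert a A. cyc_residue z p (f i)) = cyc_residue z p (f a) \<oplus>\<^bsub>Fp p\<^esub> (\<Oplus>\<^bsub>Fp p\<^esub>i\<in>A. cyc_residue z p (f i))"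
    using insert.hyps insert.prems cyc_residue_props(1) by (intro res.S.finsum_insert) auto
  ultimately show ?case using insert by simp
qed (use res.hom_zero in simp)

lemma cyc_residue_prod:
  assumes "finite A" "\<And>i. i \<in> A \<Longrightarrow> f i \<in> zring z"
  shows "cyc_residue z p (\<Prod>i\<in>A. f i) = (\<Otimes>\<^bsub>Fp p\<^esub>i\<in>A. cyc_residue z p (f i))"
  using assms
proof (induction A rule: finite_induct)
  case (insert a A)
  have "cyc_residue z p (f a * (\<Prod>i\<in>A. f i)) = cyc_residue z p (f a) \<otimes>\<^bsub>Fp p\<^esub> cyc_residue z p (\<Prod>i\<in>A. f i)"
    using insert.prems res.hom_mult[of "f a" "\<Prod>i\<in>A. f i"] by (simp add: zring_prod)
  moreover have "(\<Otimes>\<^bsub>Fp p\<^esub>i\<in>insert a A. cyc_residue z p (f i)) = cyc_residue z p (f a) \<otimes>\<^bsub>Fp p\<^esub> (\<Otimes>\<^bsub>Fp p\<^esub>i\<in>A. cyc_residue z p (f i))"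
    using insert.hyps insert.prems cyc_residue_props(1) by (intro res.S.finprod_insert) auto
  ultimately show ?case using insert by simp
qed (use res.hom_one in simp)

lemma cyc_residue_qmzv:
  "cyc_residue z p (qmzv p ks z) = (\<Oplus>\<^bsub>Fp p\<^esub>ms\<in>decr_tuples {0<..<p} (length ks).
     \<Otimes>\<^bsub>Fp p\<^esub>j\<in>{..<length ks}. (inv\<^bsub>Fp p\<^esub> (int (ms ! j))) [^]\<^bsub>Fp p\<^esub> (ks ! j))"
proof -
  have closed: "(inv\<^bsub>Fp p\<^esub> (int m)) [^]\<^bsub>Fp p\<^esub> (k::nat) \<in> carrier (Fp p)" if "0 < m" "m < p" for m k
    using cyc_residue_props(1)[OF qterm_zring[OF that, of k]] cyc_residue_qterm[OF that, of k] by simp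
  have "cyc_residue z p (qmzv p ks z) = (\<Oplus>\<^bsub>Fp p\<^esub>ms\<in>decr_tuples {0<..<p} (length ks).
     cyc_residue z p (\<Prod>j<length ks. qterm (ks ! j) (ms ! j)))"
    unfolding qmzv_def
    by (intro cyc_residue_sum finite_decr_tuples zring_prod qterm_zring) (auto dest: decr_tuples_nth)
  also have "\<dots> = (\<Oplus>\<^bsub>Fp p\<^esub>ms\<in>decr_tuples {0<..<p} (length ks).
     \<Otimes>\<^bsub>Fp p\<^esub>j\<in>{..<length ks}. (inv\<^bsub>Fp p\<^esub> (int (ms ! j))) [^]\<^bsub>Fp p\<^esub> (ks ! j))"
  proof (rule res.S.finsum_cong')
    fix ms assume ms: "ms \<in> decr_tuples {0<..<p} (length ks)"
    have "cyc_residue z p (\<Prod>j<length ks. qterm (ks ! j) (ms ! j))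
      = (\<Otimes>\<^bsub>Fp p\<^esub>j\<in>{..<length ks}. cyc_residue z p (qterm (ks ! j) (ms ! j)))"
      using decr_tuples_nth[OF ms] by (intro cyc_residue_prod qterm_zring) auto
    also have "\<dots> = (\<Otimes>\<^bsub>Fp p\<^esub>j\<in>{..<length ks}. (inv\<^bsub>Fp p\<^esub> (int (ms ! j))) [^]\<^bsub>Fp p\<^esub> (ks ! j))"
    proof (rule res.S.finprod_cong'[OF refl])
      fix j assume "j \<in> {..<length ks}"
      then show "cyc_residue z p (qterm (ks ! j) (ms ! j)) = (inv\<^bsub>Fp p\<^esub> (int (ms ! j))) [^]\<^bsub>Fp p\<^esub> (ks ! j)"
        using decr_tuples_nth[OF ms] by (intro cyc_residue_qterm) auto
    qed (use decr_tuples_nth[OF ms] closed in auto)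
    finally show "cyc_residue z p (\<Prod>j<length ks. qterm (ks ! j) (ms ! j))
      = (\<Otimes>\<^bsub>Fp p\<^esub>j\<in>{..<length ks}. (inv\<^bsub>Fp p\<^esub> (int (ms ! j))) [^]\<^bsub>Fp p\<^esub> (ks ! j))" .
  qed (use closed decr_tuples_nth in \<open>auto intro!: res.S.finprod_closed\<close>)
  finally show ?thesis .
qed

lemma qmzv_iter_sum: "qmzv p ks z = iter_sum qterm (rev [1..<p]) ks"
proof -
  have "set (rev [1..<p]) = {0<..<p}" by auto
  then show ?thesis
    unfolding qmzv_def by (subst iter_sum_eq_sum_decr_tuples) (auto simp: sorted_wrt_rev)
qed

text \<open>The product of two terms lacks a factor z^m compared with the term for k + l. Writing 1
  = z^m + (1 - z) [m] supplies this factor in one part and lowers the exponent of [m] by one in the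
  other.\<close>

lemma qmzv_mult:
  assumes "is_index u" "is_index v"
  shows "qmzv p u z * qmzv p v z = quasi (\<lambda>y. (1 - z) * y) (\<lambda>w. qmzv p w z) u v"
  unfolding qmzv_iter_sum
proof (rule iter_sum_mult[OF _ assms])
  fix m k l :: nat assume "m \<in> set (rev [1..<p])" and kl: "0 < k" "0 < l"
  then have q: "qint z m \<noteq> 0" by (intro qint_neq_0) auto
  obtain k' l' where kl': "k = Suc k'" "l = Suc l'" using kl by (metis gr0_implies_Suc)
  have "1 = z ^ m + (1 - z) * qint z m" using z_neq by (simp add: qint_def)
  then have "qterm k m * qterm l m = qterm k m * qterm l m * (z ^ m + (1 - z) * qint z m)" by simp
  also have "\<dots> = qterm (k + l) m + (1 - z) * qterm (k + l - 1) m"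
  proof -
    define A D where "A = z ^ (k' * m) * z ^ (l' * m)" and "D = qint z m ^ k' * qint z m ^ l'"
    have D: "D \<noteq> 0" using q by (simp add: D_def)
    have "qterm k m * qterm l m = A / (D * qint z m * qint z m)"
      by (simp add: kl' A_def D_def mult_ac)
    moreover have "qterm (k + l) m = A * z ^ m / (D * qint z m * qint z m)"
      by (simp add: kl' A_def D_def power_add add_mult_distrib add_mult_distrib2 mult_ac)
    moreover have "qterm (k + l - 1) m = A / (D * qint z m)"
      by (simp add: kl' A_def D_def power_add add_mult_distrib add_mult_distrib2 mult_ac)
    ultimately show ?thesis using D q by (simp only:) (simp add: field_simps)
  qed
  finally show "qterm k m * qterm l m = qterm (k + l) m + (1 - z) * qterm (k + l - 1) m" .
qed

text \<open>Pairing m with p - m: if x y = 1, then 1 / (1 - x) + 1 / (1 - y) = 1.\<close>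

lemma qmzv_1: "2 * qmzv p [1] z = of_nat (p - 1) * (1 - z)"
proof -
  have sum: "qmzv p [1] z = (\<Sum>m\<in>{0<..<p}. (1 - z) / (1 - z ^ m))"
  proof -
    have "iter_sum qterm xs [1] = (\<Sum>m\<leftarrow>xs. 1 / qint z m)" for xs
      by (induction xs) auto
    then have "qmzv p [1] z = (\<Sum>m\<leftarrow>rev [1..<p]. 1 / qint z m)" by (simp add: qmzv_iter_sum)
    also have "\<dots> = (\<Sum>m\<in>{0<..<p}. 1 / qint z m)"
      by (subst sum_list_distinct_conv_sum_set) (auto intro!: sum.cong)
    finally show ?thesis by (simp add: qint_def)
  qed
  have "(\<Sum>m\<in>{0<..<p}. (1 - z) / (1 - z ^ m)) = (\<Sum>m\<in>{0<..<p}. (1 - z) / (1 - z ^ (p - m)))"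
    by (rule sum.reindex_bij_witness[of _ "\<lambda>m. p - m" "\<lambda>m. p - m"]) auto
  then have "2 * qmzv p [1] z = (\<Sum>m\<in>{0<..<p}. (1 - z) / (1 - z ^ m) + (1 - z) / (1 - z ^ (p - m)))"
    unfolding sum sum.distrib mult_2 by simp
  also have "\<dots> = (\<Sum>m\<in>{0<..<p}. 1 - z)"
  proof (rule sum.cong[OF refl])
    fix m assume m: "m \<in> {0<..<p}"
    define x where "x = z ^ m"
    define y where "y = z ^ (p - m)"
    have xy: "x * y = 1" using m z_power by (simp add: x_def y_def flip: power_add)
    have "x \<noteq> 1" "y \<noteq> 1" using m z_power_neq[of m] z_power_neq[of "p - m"] by (auto simp: x_def y_def)
    then have "1 / (1 - x) + 1 / (1 - y) = ((1 - y) + (1 - x)) / ((1 - x) * (1 - y))"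
      by (simp add: add_frac_eq)
    also have "(1 - x) * (1 - y) = (1 - y) + (1 - x)" using xy by (simp add: algebra_simps)
    also have "((1 - y) + (1 - x)) / ((1 - y) + (1 - x)) = 1"
    proof -
      have "(1 - x) * (1 - y) \<noteq> 0" using \<open>x \<noteq> 1\<close> \<open>y \<noteq> 1\<close> by simp
      then have "(1 - y) + (1 - x) \<noteq> 0" using xy by (simp add: algebra_simps)
      then show ?thesis by simp
    qed
    finally have "(1 - z) * (1 / (1 - x) + 1 / (1 - y)) = 1 - z" by simp
    then show "(1 - z) / (1 - z ^ m) + (1 - z) / (1 - z ^ (p - m)) = 1 - z"
      by (simp add: x_def y_def distrib_left)
  qed
  also have "\<dots> = of_nat (p - 1) * (1 - z)" by simp
  finally show ?thesis .
qed

text \<open>The residue is constant on a class modulo p, so the image of the class is a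
  singleton.\<close>

lemma cyc_residue_coset:
  assumes "a \<in> zring z"
  shows "the_elem (cyc_residue z p ` ((PIdl\<^bsub>cyc_ring z\<^esub> (of_nat p)) +>\<^bsub>cyc_ring z\<^esub> a)) = cyc_residue z p a"
proof -
  let ?U = "(PIdl\<^bsub>cyc_ring z\<^esub> (of_nat p)) +>\<^bsub>cyc_ring z\<^esub> a"
  have U: "?U = {of_nat p * d + a | d. d \<in> zring z}"
    by (auto simp: a_r_coset_def' cyc_PIdl)
  have "cyc_residue z p ` ?U = {cyc_residue z p a}"
  proof
    show "cyc_residue z p ` ?U \<subseteq> {cyc_residue z p a}"
      using assms cyc_residue_mod_p[of "of_nat p * d + a" a d for d] by (auto simp: U)
    have "of_nat p * 0 + a \<in> ?U" unfolding U using zring_0 by blast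
    then show "{cyc_residue z p a} \<subseteq> cyc_residue z p ` ?U" by auto
  qed
  then show ?thesis by simp
qed

end

section \<open>The map from the cyclotomic to the finite side\<close>

context prime_root
begin

abbreviation p_ideal :: "complex set" where
  "p_ideal \<equiv> PIdl\<^bsub>cyc_ring z\<^esub> (of_nat p)"

lemma cring_cyc_ring_Quot: "cring (cyc_ring z Quot p_ideal)"
  by (rule ideal.quotient_is_cring[OF ideal_cyc_PIdl cring_cyc_ring]) simp

lemma coset_hom: "(\<lambda>a. p_ideal +>\<^bsub>cyc_ring z\<^esub> a) \<in> ring_hom (cyc_ring z) (cyc_ring z Quot p_ideal)"
  by (rule ideal.rcos_ring_hom[OF ideal_cyc_PIdl]) simp

lemma coset_int: "[n] \<cdot>\<^bsub>cyc_ring z Quot p_ideal\<^esub> \<one>\<^bsub>cyc_ring z Quot p_ideal\<^esub> = p_ideal +>\<^bsub>cyc_ring z\<^esub> of_int n" for n :: int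
  using ring_hom_int[OF _ _ coset_hom, of n] cring_cyc_ring cring_cyc_ring_Quot by (simp add: cring_def cyc_ring_int)

lemma char_cyc_ring_Quot:
  "[int p] \<cdot>\<^bsub>cyc_ring z Quot p_ideal\<^esub> \<one>\<^bsub>cyc_ring z Quot p_ideal\<^esub> = \<zero>\<^bsub>cyc_ring z Quot p_ideal\<^esub>"
proof -
  have "p_ideal +>\<^bsub>cyc_ring z\<^esub> of_nat p = p_ideal +>\<^bsub>cyc_ring z\<^esub> 0"
    by (subst cyc_coset_eq) (auto intro!: bexI[of _ 1])
  also have "\<dots> = \<zero>\<^bsub>cyc_ring z Quot p_ideal\<^esub>"
    using ring_hom_zero[OF coset_hom] cring_cyc_ring cring_cyc_ring_Quot by (simp add: cring_def)
  finally show ?thesis by (simp add: coset_int)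
qed

lemma char_Fp: "[int p] \<cdot>\<^bsub>Fp p\<^esub> \<one>\<^bsub>Fp p\<^esub> = \<zero>\<^bsub>Fp p\<^esub>"
  using ring_hom_int[OF _ _ cyc_residue_hom, of "int p"] cring_cyc_ring cring_Fp cyc_residue_of_int[of "int p"]
  by (simp add: cring_def cyc_ring_int Fp_simps)

end

locale root_family =
  fixes \<zeta> :: "nat \<Rightarrow> complex"
  assumes root: "\<And>p. Factorial_Ring.prime p \<Longrightarrow> primitive_root_of_unity p (\<zeta> p)"
begin

lemma prime_root: "p \<in> primes \<Longrightarrow> prime_root p (\<zeta> p)"
  by unfold_locales (auto simp: primes_iff root)

sublocale F: prime_family Fp
proof (rule prime_family.intro)
  fix p assume "p \<in> primes"
  then interpret prime_root p "\<zeta> p" by (rule prime_root)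
  show "cring (Fp p)" by (rule cring_Fp)
  show "[int p] \<cdot>\<^bsub>Fp p\<^esub> \<one>\<^bsub>Fp p\<^esub> = \<zero>\<^bsub>Fp p\<^esub>" by (rule char_Fp)
qed

sublocale D: prime_family "cyc_mod_p \<zeta>"
proof (rule prime_family.intro)
  fix p assume "p \<in> primes"
  then interpret prime_root p "\<zeta> p" by (rule prime_root)
  show "cring (cyc_mod_p \<zeta> p)" unfolding cyc_mod_p_def by (rule cring_cyc_ring_Quot)
  show "[int p] \<cdot>\<^bsub>cyc_mod_p \<zeta> p\<^esub> \<one>\<^bsub>cyc_mod_p \<zeta> p\<^esub> = \<zero>\<^bsub>cyc_mod_p \<zeta> p\<^esub>"
    unfolding cyc_mod_p_def by (rule char_cyc_ring_Quot)
qed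

sublocale FQ: rat_ring F.quot by (rule F.rat_ring_quot)

sublocale DQ: rat_ring D.quot by (rule D.rat_ring_quot)

text \<open>Elements of the cyclotomic algebra are handled through families of complex numbers
  instead of families of cosets; \<open>cls\<close> performs both quotients.\<close>

definition integral :: "(nat \<Rightarrow> complex) set" where
  "integral = {f. \<forall>p\<in>primes. f p \<in> zring (\<zeta> p)}"

definition cls :: "(nat \<Rightarrow> complex) \<Rightarrow> (nat \<Rightarrow> complex set) set" where
  "cls f = prime_class (cyc_mod_p \<zeta>) (\<lambda>p. (PIdl\<^bsub>cyc_ring (\<zeta> p)\<^esub> (of_nat p)) +>\<^bsub>cyc_ring (\<zeta> p)\<^esub> f p)"

lemma coset_fam:
  assumes "f \<in> integral"
  shows "(\<lambda>p. (PIdl\<^bsub>cyc_ring (\<zeta> p)\<^esub> (of_nat p)) +>\<^bsub>cyc_ring (\<zeta> p)\<^esub> f p) \<in> D.fam"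
  unfolding D.fam_def
proof (intro CollectI ballI)
  fix p assume mem: "p \<in> primes"
  interpret prime_root p "\<zeta> p" using mem by (rule prime_root)
  show "(PIdl\<^bsub>cyc_ring (\<zeta> p)\<^esub> (of_nat p)) +>\<^bsub>cyc_ring (\<zeta> p)\<^esub> f p \<in> carrier (cyc_mod_p \<zeta> p)"
    using ring_hom_closed[OF coset_hom, of "f p"] assms mem by (simp add: cyc_mod_p_def integral_def)
qed

lemma carrier_cyc_mod_pE:
  assumes "x \<in> carrier (cyc_mod_p \<zeta> p)"
  obtains a where "a \<in> zring (\<zeta> p)" "x = (PIdl\<^bsub>cyc_ring (\<zeta> p)\<^esub> (of_nat p)) +>\<^bsub>cyc_ring (\<zeta> p)\<^esub> a"
  using assms by (auto simp: cyc_mod_p_def FactRing_def A_RCOSETS_def')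

lemma cls_surj:
  assumes "x \<in> carrier D.quot"
  obtains f where "f \<in> integral" "x = cls f"
proof -
  obtain g where g: "g \<in> D.fam" "x = prime_class (cyc_mod_p \<zeta>) g" using D.class_surj[OF assms] by blast
  have "\<exists>a\<in>zring (\<zeta> p). g p = (PIdl\<^bsub>cyc_ring (\<zeta> p)\<^esub> (of_nat p)) +>\<^bsub>cyc_ring (\<zeta> p)\<^esub> a" if "p \<in> primes" for p
  proof -
    have "g p \<in> carrier (cyc_mod_p \<zeta> p)" using g(1) that by (simp add: D.fam_def)
    then show ?thesis by (rule carrier_cyc_mod_pE) blast
  qed
  then obtain f where f: "\<And>p. p \<in> primes \<Longrightarrow> f p \<in> zring (\<zeta> p)"
      "\<And>p. p \<in> primes \<Longrightarrow> g p = (PIdl\<^bsub>cyc_ring (\<zeta> p)\<^esub> (of_nat p)) +>\<^bsub>cyc_ring (\<zeta> p)\<^esub> f p" by metis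
  show ?thesis
  proof (rule that)
    show "f \<in> integral" using f(1) by (simp add: integral_def)
    show "x = cls f" unfolding g(2) cls_def by (rule prime_class_cong) (rule f(2))
  qed
qed

lemma cls_closed: "f \<in> integral \<Longrightarrow> cls f \<in> carrier D.quot"
  unfolding cls_def by (intro D.class_closed coset_fam)

lemma cls_add:
  assumes "f \<in> integral" "g \<in> integral"
  shows "cls (\<lambda>p. f p + g p) = cls f \<oplus>\<^bsub>D.quot\<^esub> cls g"
  unfolding cls_def D.class_add[OF coset_fam[OF assms(1)] coset_fam[OF assms(2)], symmetric]
proof (rule prime_class_cong)
  fix p assume mem: "p \<in> primes"
  interpret prime_root p "\<zeta> p" using mem by (rule prime_root)
  show "p_ideal +>\<^bsub>cyc_ring (\<zeta> p)\<^esub> (f p + g p) =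
      (p_ideal +>\<^bsub>cyc_ring (\<zeta> p)\<^esub> f p) \<oplus>\<^bsub>cyc_mod_p \<zeta> p\<^esub> (p_ideal +>\<^bsub>cyc_ring (\<zeta> p)\<^esub> g p)"
    using ring_hom_add[OF coset_hom, of "f p" "g p"] assms mem by (simp add: cyc_mod_p_def integral_def)
qed

lemma cls_mult:
  assumes "f \<in> integral" "g \<in> integral"
  shows "cls (\<lambda>p. f p * g p) = cls f \<otimes>\<^bsub>D.quot\<^esub> cls g"
  unfolding cls_def D.class_mult[OF coset_fam[OF assms(1)] coset_fam[OF assms(2)], symmetric]
proof (rule prime_class_cong)
  fix p assume mem: "p \<in> primes"
  interpret prime_root p "\<zeta> p" using mem by (rule prime_root)
  show "p_ideal +>\<^bsub>cyc_ring (\<zeta> p)\<^esub> (f p * g p) =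
      (p_ideal +>\<^bsub>cyc_ring (\<zeta> p)\<^esub> f p) \<otimes>\<^bsub>cyc_mod_p \<zeta> p\<^esub> (p_ideal +>\<^bsub>cyc_ring (\<zeta> p)\<^esub> g p)"
    using ring_hom_mult[OF coset_hom, of "f p" "g p"] assms mem by (simp add: cyc_mod_p_def integral_def)
qed

lemma cls_int: "cls (\<lambda>p. of_int n) = [n] \<cdot>\<^bsub>D.quot\<^esub> \<one>\<^bsub>D.quot\<^esub>" for n :: int
  unfolding cls_def D.class_int[symmetric]
  by (rule prime_class_cong) (simp add: prime_root.coset_int[OF prime_root] cyc_mod_p_def)

lemma cls_1: "cls (\<lambda>p. 1) = \<one>\<^bsub>D.quot\<^esub>"
  using cls_int[of 1] by simp

lemma cls_eqI:
  assumes "f \<in> integral" "g \<in> integral"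
    and "\<And>p. p \<in> primes \<Longrightarrow> \<exists>d\<in>zring (\<zeta> p). f p - g p = of_nat p * d"
  shows "cls f = cls g"
  unfolding cls_def
proof (rule prime_class_cong)
  fix p assume mem: "p \<in> primes"
  then show "(PIdl\<^bsub>cyc_ring (\<zeta> p)\<^esub> (of_nat p)) +>\<^bsub>cyc_ring (\<zeta> p)\<^esub> f p = (PIdl\<^bsub>cyc_ring (\<zeta> p)\<^esub> (of_nat p)) +>\<^bsub>cyc_ring (\<zeta> p)\<^esub> g p"
    using assms by (subst cyc_coset_eq) (auto simp: integral_def)
qed

lemma residue_fam: "f \<in> integral \<Longrightarrow> (\<lambda>p. cyc_residue (\<zeta> p) p (f p)) \<in> F.fam"
  unfolding F.fam_def integral_def using prime_root.cyc_residue_props(1)[OF prime_root] by blast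

text \<open>Two representatives of a class differ at finitely many primes only, and at the others
  \<open>cyc_residue_coset\<close> fixes the residue, so all representatives have the same
  image.\<close>

lemma phi_cls:
  assumes f: "f \<in> integral"
  shows "phi \<zeta> (cls f) = prime_class Fp (\<lambda>p. cyc_residue (\<zeta> p) p (f p))"
proof -
  let ?h = "\<lambda>u. prime_class Fp (\<lambda>p. the_elem (cyc_residue (\<zeta> p) p ` u p))"
  let ?c = "\<lambda>p. (PIdl\<^bsub>cyc_ring (\<zeta> p)\<^esub> (of_nat p)) +>\<^bsub>cyc_ring (\<zeta> p)\<^esub> f p"
  have "?h u = prime_class Fp (\<lambda>p. cyc_residue (\<zeta> p) p (f p))" if "u \<in> cls f" for u
  proof -
    have u: "u \<in> D.fam" "prime_class (cyc_mod_p \<zeta>) u = prime_class (cyc_mod_p \<zeta>) ?c"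
      using D.mem_class[OF coset_fam[OF f]] that by (auto simp: cls_def)
    have fin: "finite {p \<in> primes. u p \<noteq> ?c p}"
      using u(2) unfolding D.class_eq_iff[OF u(1) coset_fam[OF f]] .
    have fam: "(\<lambda>p. the_elem (cyc_residue (\<zeta> p) p ` u p)) \<in> F.fam"
      unfolding F.fam_def
    proof (intro CollectI ballI)
      fix p assume mem: "p \<in> primes"
      interpret prime_root p "\<zeta> p" using mem by (rule prime_root)
      from u(1) mem have "u p \<in> carrier (cyc_mod_p \<zeta> p)" by (simp add: D.fam_def)
      then obtain a where "a \<in> zring (\<zeta> p)" "u p = p_ideal +>\<^bsub>cyc_ring (\<zeta> p)\<^esub> a" by (rule carrier_cyc_mod_pE)
      then show "the_elem (cyc_residue (\<zeta> p) p ` u p) \<in> carrier (Fp p)"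
        using cyc_residue_coset[of a] cyc_residue_props(1)[of a] by simp
    qed
    show ?thesis
      unfolding F.class_eq_iff[OF fam residue_fam[OF f]]
    proof (rule finite_subset[OF _ fin], safe)
      fix p assume mem: "p \<in> primes" and ne: "the_elem (cyc_residue (\<zeta> p) p ` u p) \<noteq> cyc_residue (\<zeta> p) p (f p)"
        and eq: "u p = ?c p"
      interpret prime_root p "\<zeta> p" using mem by (rule prime_root)
      have "f p \<in> zring (\<zeta> p)" using f mem by (simp add: integral_def)
      then show False using ne cyc_residue_coset[of "f p"] by (simp add: eq)
    qed
  qed
  moreover have "restrict ?c primes \<in> cls f" unfolding cls_def by (rule D.class_rep[OF coset_fam[OF f]])
  ultimately have "?h ` cls f = {prime_class Fp (\<lambda>p. cyc_residue (\<zeta> p) p (f p))}" by blast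
  then show ?thesis by (simp add: phi_def)
qed

lemma integral_add: "f \<in> integral \<Longrightarrow> g \<in> integral \<Longrightarrow> (\<lambda>p. f p + g p) \<in> integral"
  and integral_mult: "f \<in> integral \<Longrightarrow> g \<in> integral \<Longrightarrow> (\<lambda>p. f p * g p) \<in> integral"
  by (simp_all add: integral_def)

lemma phi_hom: "phi \<zeta> \<in> ring_hom D.quot F.quot"
proof (rule ring_hom_memI)
  show "phi \<zeta> x \<in> carrier F.quot" if x: "x \<in> carrier D.quot" for x
  proof -
    obtain f where "f \<in> integral" "x = cls f" using cls_surj[OF x] by blast
    then show ?thesis by (simp only: phi_cls) (intro F.class_closed residue_fam)
  qed
  show "phi \<zeta> \<one>\<^bsub>D.quot\<^esub> = \<one>\<^bsub>F.quot\<^esub>"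
  proof -
    have "phi \<zeta> \<one>\<^bsub>D.quot\<^esub> = prime_class Fp (\<lambda>p. cyc_residue (\<zeta> p) p 1)"
      unfolding cls_1[symmetric] by (rule phi_cls) (simp add: integral_def)
    also have "\<dots> = prime_class Fp (\<lambda>p. \<one>\<^bsub>Fp p\<^esub>)"
      using ring_hom_one[OF prime_root.cyc_residue_hom[OF prime_root]] by (intro prime_class_cong) simp
    finally show ?thesis by (simp only: F.class_one)
  qed
  fix x y assume xy: "x \<in> carrier D.quot" "y \<in> carrier D.quot"
  obtain f where f: "f \<in> integral" "x = cls f" using cls_surj[OF xy(1)] by blast
  obtain g where g: "g \<in> integral" "y = cls g" using cls_surj[OF xy(2)] by blast
  have res: "\<And>p. p \<in> primes \<Longrightarrow> cyc_residue (\<zeta> p) p (f p * g p) = cyc_residue (\<zeta> p) p (f p) \<otimes>\<^bsub>Fp p\<^esub> cyc_residue (\<zeta> p) p (g p)"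
    "\<And>p. p \<in> primes \<Longrightarrow> cyc_residue (\<zeta> p) p (f p + g p) = cyc_residue (\<zeta> p) p (f p) \<oplus>\<^bsub>Fp p\<^esub> cyc_residue (\<zeta> p) p (g p)"
    using ring_hom_mult[OF prime_root.cyc_residue_hom[OF prime_root]] ring_hom_add[OF prime_root.cyc_residue_hom[OF prime_root]] f g
    by (simp_all add: integral_def)
  show "phi \<zeta> (x \<otimes>\<^bsub>D.quot\<^esub> y) = phi \<zeta> x \<otimes>\<^bsub>F.quot\<^esub> phi \<zeta> y"
    unfolding f(2) g(2) cls_mult[OF f(1) g(1), symmetric] phi_cls[OF f(1)] phi_cls[OF g(1)]
      phi_cls[OF integral_mult[OF f(1) g(1)]] F.class_mult[OF residue_fam[OF f(1)] residue_fam[OF g(1)], symmetric]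
    by (rule prime_class_cong) (rule res(1))
  show "phi \<zeta> (x \<oplus>\<^bsub>D.quot\<^esub> y) = phi \<zeta> x \<oplus>\<^bsub>F.quot\<^esub> phi \<zeta> y"
    unfolding f(2) g(2) cls_add[OF f(1) g(1), symmetric] phi_cls[OF f(1)] phi_cls[OF g(1)]
      phi_cls[OF integral_add[OF f(1) g(1)]] F.class_add[OF residue_fam[OF f(1)] residue_fam[OF g(1)], symmetric]
    by (rule prime_class_cong) (rule res(2))
qed

lemma qmzv_integral: "(\<lambda>p. qmzv p ks (\<zeta> p)) \<in> integral"
  unfolding integral_def using prime_root.qmzv_zring[OF prime_root] by blast

lemma Z_cyc_eq: "Z_cyc \<zeta> ks = cls (\<lambda>p. qmzv p ks (\<zeta> p))"
  by (simp add: Z_cyc_def cls_def)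

lemma phi_Z_cyc: "phi \<zeta> (Z_cyc \<zeta> ks) = zeta_A ks"
  unfolding Z_cyc_eq phi_cls[OF qmzv_integral] zeta_A_def
  by (rule prime_class_cong) (rule prime_root.cyc_residue_qmzv[OF prime_root])

abbreviation cyc_values :: "(nat \<Rightarrow> complex set) set set" where
  "cyc_values \<equiv> {Z_cyc \<zeta> ks | ks. is_index ks}"

abbreviation cyc_span :: "(nat \<Rightarrow> complex set) set set" where
  "cyc_span \<equiv> rat_span (rat_alg D.quot) cyc_values"

lemma cyc_values_closed: "cyc_values \<subseteq> carrier D.quot"
  by (auto simp: Z_cyc_eq intro: cls_closed qmzv_integral)

lemmas cyc_span_closed = DQ.rat_span_carrier[OF cyc_values_closed]

text \<open>Membership in the span is pulled back to representatives, where a quasi-shuffle product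
  can be formed with whole families as values.\<close>

definition span_fam :: "(nat \<Rightarrow> complex) set" where
  "span_fam = {f \<in> integral. cls f \<in> cyc_span}"

lemma qmzv_span_fam: "is_index w \<Longrightarrow> (\<lambda>p. qmzv p w (\<zeta> p)) \<in> span_fam"
  unfolding span_fam_def using DQ.rat_span_incl[OF cyc_values_closed, of "Z_cyc \<zeta> w"] qmzv_integral by (auto simp: Z_cyc_eq)

lemma span_fam_add: "f \<in> span_fam \<Longrightarrow> g \<in> span_fam \<Longrightarrow> f + g \<in> span_fam"
  unfolding span_fam_def plus_fun_def
  using DQ.rat_span_add[OF cyc_values_closed] by (auto simp: cls_add intro: integral_add)

lemma one_minus_integral: "(\<lambda>p. 1 - \<zeta> p) \<in> integral"
  by (simp add: integral_def)

text \<open>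
  Modulo \<open>p\<close>, \<open>2 Z(1)\<close> is \<open>- (1 - \<zeta>\<^sub>p)\<close>. Comparing with the quasi-shuffle product of \<open>1\<close> and \<open>w\<close>, in
  which \<open>1 - \<zeta>\<^sub>p\<close> occurs as \<open>length w \<cdot> (1 - \<zeta>\<^sub>p) Z(w)\<close>, expresses
  \<open>(2 length w + 1) (1 - \<zeta>\<^sub>p) Z(w)\<close> by the stuffle product of \<open>1\<close> and \<open>w\<close>.
\<close>

lemma one_minus_mult_Z_cyc:
  assumes w: "is_index w"
  shows "cls (\<lambda>p. 1 - \<zeta> p) \<otimes>\<^bsub>D.quot\<^esub> Z_cyc \<zeta> w \<in> cyc_span"
proof -
  \<comment> \<open>Odd, hence nonzero, so it can be divided out in the rational algebra.\<close>
  define n where "n = 2 * int (length w) + 1"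
  define S where "S = stuf (\<lambda>w p. qmzv p w (\<zeta> p)) [1] w"
  let ?x = "\<lambda>p. (1 - \<zeta> p) * qmzv p w (\<zeta> p)"
  have S: "S \<in> span_fam"
    unfolding S_def using w by (intro stuf_closed span_fam_add qmzv_span_fam) auto
  have int: "?x \<in> integral" "S \<in> integral" "(\<lambda>p. of_int m) \<in> integral" for m
    using S integral_mult[OF one_minus_integral qmzv_integral] by (auto simp: span_fam_def integral_def)
  have Sp: "S p = stuf (\<lambda>w. qmzv p w (\<zeta> p)) [1] w" for p
    unfolding S_def by (rule quasi_hom[where h = "\<lambda>f. f p"]) (auto simp: zero_fun_def)
  have "cls (\<lambda>p. of_int n * ?x p) = cls (\<lambda>p. of_int (- 2) * S p)"
  proof (rule cls_eqI)
    fix p assume mem: "p \<in> primes"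
    interpret prime_root p "\<zeta> p" using mem by (rule prime_root)
    \<comment> \<open>The factor p - 1 is split so that its multiple of p is forgotten by
      \<open>cls\<close>.\<close>
    have 1: "2 * qmzv p [1] (\<zeta> p) = of_nat p * (1 - \<zeta> p) - (1 - \<zeta> p)"
      using qmzv_1 p2 by (simp add: of_nat_diff algebra_simps)
    have "qmzv p [1] (\<zeta> p) * qmzv p w (\<zeta> p) = quasi (\<lambda>y. (1 - \<zeta> p) * y) (\<lambda>w. qmzv p w (\<zeta> p)) [1] w"
      using w by (intro qmzv_mult) auto
    also have "\<dots> = S p + of_nat (length w) * ?x p" by (subst quasi_1) (simp add: Sp)
    finally have "2 * qmzv p [1] (\<zeta> p) * qmzv p w (\<zeta> p) = 2 * S p + 2 * of_nat (length w) * ?x p"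
      by (simp add: mult.assoc)
    then have "of_int n * ?x p - of_int (- 2) * S p = of_nat p * ?x p"
      unfolding 1 by (simp add: n_def algebra_simps)
    then show "\<exists>d\<in>zring (\<zeta> p). of_int n * ?x p - of_int (- 2) * S p = of_nat p * d"
      using int(1) mem by (auto simp: integral_def)
  qed (intro integral_mult int)+
  then have eq: "DQ.rat_emb (of_int n) \<otimes>\<^bsub>D.quot\<^esub> cls ?x = DQ.rat_emb (of_int (- 2)) \<otimes>\<^bsub>D.quot\<^esub> cls S"
    by (simp only: cls_mult[OF int(3) int(1)] cls_mult[OF int(3) int(2)] cls_int DQ.rat_emb_int)
  have "cls ?x = DQ.rat_emb (1 / of_int n * of_int n) \<otimes>\<^bsub>D.quot\<^esub> cls ?x"
    using cls_closed[OF int(1)] by (simp add: n_def)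
  also have "\<dots> = DQ.rat_emb (1 / of_int n) \<otimes>\<^bsub>D.quot\<^esub> (DQ.rat_emb (of_int (- 2)) \<otimes>\<^bsub>D.quot\<^esub> cls S)"
    unfolding DQ.rat_emb_mult eq[symmetric] using cls_closed[OF int(1)] by (intro DQ.m_assoc) auto
  also have "\<dots> \<in> cyc_span"
    using S by (intro DQ.rat_span_smult cyc_values_closed) (simp add: span_fam_def)
  finally show ?thesis
    unfolding Z_cyc_eq by (simp add: cls_mult[OF one_minus_integral qmzv_integral])
qed

lemma span_fam_one_minus_mult:
  assumes "f \<in> span_fam"
  shows "(\<lambda>p. 1 - \<zeta> p) * f \<in> span_fam"
proof -
  let ?t = "cls (\<lambda>p. 1 - \<zeta> p)"
  have t: "?t \<in> carrier D.quot" by (rule cls_closed[OF one_minus_integral])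
  have f: "f \<in> integral" "cls f \<in> cyc_span" using assms by (auto simp: span_fam_def)
  from cyc_values_closed f(2) have "?t \<otimes>\<^bsub>D.quot\<^esub> cls f \<in> cyc_span"
  proof (induction rule: DQ.rat_span_induct)
    case zero
    show ?case using t DQ.rat_span_zero[OF cyc_values_closed] by simp
  next
    case (smult c x)
    have "x \<in> carrier D.quot" using smult cyc_values_closed by blast
    then have "?t \<otimes>\<^bsub>D.quot\<^esub> (DQ.rat_emb c \<otimes>\<^bsub>D.quot\<^esub> x) = DQ.rat_emb c \<otimes>\<^bsub>D.quot\<^esub> (?t \<otimes>\<^bsub>D.quot\<^esub> x)"
      using t by (intro DQ.m_lcomm) auto
    then show ?case using smult one_minus_mult_Z_cyc by (auto intro!: DQ.rat_span_smult[OF cyc_values_closed])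
  next
    case (add x y)
    have "x \<in> carrier D.quot" "y \<in> carrier D.quot" using add cyc_span_closed by auto
    then show ?case using t add by (simp only: DQ.r_distr) (intro DQ.rat_span_add cyc_values_closed)
  qed
  then show ?thesis
    using f by (simp add: span_fam_def times_fun_def integral_mult one_minus_integral cls_mult)
qed

text \<open>\<open>T\<close> is multiplication by the family 1 - \<zeta>; closure of
  \<open>span_fam\<close> under it keeps every term of the product in the span, and evaluation at
  each p recovers \<open>qmzv_mult\<close>.\<close>

lemma Z_cyc_mult:
  assumes "is_index u" "is_index v"
  shows "Z_cyc \<zeta> u \<otimes>\<^bsub>D.quot\<^esub> Z_cyc \<zeta> v \<in> cyc_span"
proof -
  let ?T = "\<lambda>f. (\<lambda>p. 1 - \<zeta> p) * f"
  let ?P = "quasi ?T (\<lambda>w p. qmzv p w (\<zeta> p)) u v"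
  have P: "?P \<in> span_fam"
    by (rule quasi_closed[OF span_fam_add span_fam_one_minus_mult assms qmzv_span_fam])
  have Pp: "?P p = quasi (\<lambda>y. (1 - \<zeta> p) * y) (\<lambda>w. qmzv p w (\<zeta> p)) u v" for p
    by (rule quasi_hom[where h = "\<lambda>f. f p"]) auto
  have "Z_cyc \<zeta> u \<otimes>\<^bsub>D.quot\<^esub> Z_cyc \<zeta> v = cls (\<lambda>p. qmzv p u (\<zeta> p) * qmzv p v (\<zeta> p))"
    unfolding Z_cyc_eq by (rule cls_mult[symmetric, OF qmzv_integral qmzv_integral])
  also have "\<dots> = cls ?P"
    unfolding cls_def
    by (rule prime_class_cong) (simp add: prime_root.qmzv_mult[OF prime_root assms] Pp)
  finally show ?thesis using P by (simp add: span_fam_def)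
qed

lemma Z_cyc_Nil: "Z_cyc \<zeta> [] = \<one>\<^bsub>D.quot\<^esub>"
proof -
  have "qmzv p [] q = 1" for p q by (simp add: qmzv_def decr_tuples_Nil)
  then show ?thesis by (simp add: Z_cyc_eq cls_1)
qed

lemma one_cyc_span: "\<one>\<^bsub>D.quot\<^esub> \<in> cyc_span"
proof (rule DQ.rat_span_incl[OF cyc_values_closed])
  have "is_index []" by simp
  then show "\<one>\<^bsub>D.quot\<^esub> \<in> cyc_values" unfolding Z_cyc_Nil[symmetric] by blast
qed

lemma carrier_cyc_mzv_alg: "carrier (cyc_mzv_alg \<zeta>) = cyc_span"
  by (simp add: cyc_mzv_alg_def prime_alg_def)

lemma cyc_mzv_alg_simps [simp]:
  "x \<otimes>\<^bsub>cyc_mzv_alg \<zeta>\<^esub> y = x \<otimes>\<^bsub>D.quot\<^esub> y" "x \<oplus>\<^bsub>cyc_mzv_alg \<zeta>\<^esub> y = x \<oplus>\<^bsub>D.quot\<^esub> y"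
  "\<one>\<^bsub>cyc_mzv_alg \<zeta>\<^esub> = \<one>\<^bsub>D.quot\<^esub>" "\<zero>\<^bsub>cyc_mzv_alg \<zeta>\<^esub> = \<zero>\<^bsub>D.quot\<^esub>" "c \<odot>\<^bsub>cyc_mzv_alg \<zeta>\<^esub> x = DQ.rat_emb c \<otimes>\<^bsub>D.quot\<^esub> x"
  by (simp_all add: cyc_mzv_alg_def prime_alg_def DQ.smult_rat_alg)

lemma cring_cyc_mzv_alg: "cring (cyc_mzv_alg \<zeta>)"
  unfolding cyc_mzv_alg_def prime_alg_def
  by (rule DQ.cring_rat_span[OF cyc_values_closed one_cyc_span]) (auto intro: Z_cyc_mult)

lemma smult_cyc_mzv_alg: "x \<in> carrier (cyc_mzv_alg \<zeta>) \<Longrightarrow> c \<odot>\<^bsub>cyc_mzv_alg \<zeta>\<^esub> x \<in> carrier (cyc_mzv_alg \<zeta>)"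
  unfolding carrier_cyc_mzv_alg by (simp add: DQ.rat_span_smult[OF cyc_values_closed])

lemma phi_cyc_span: "phi \<zeta> ` cyc_span = rat_span (rat_alg F.quot) {zeta_A ks | ks. is_index ks}"
proof -
  have "phi \<zeta> ` cyc_values = {zeta_A ks | ks. is_index ks}" using phi_Z_cyc by force
  then show ?thesis
    using rat_span_image[OF D.rat_ring_quot F.rat_ring_quot phi_hom cyc_values_closed] by simp
qed

lemma zeta_A_closed: "{zeta_A ks | ks. is_index ks} \<subseteq> carrier F.quot"
  unfolding phi_Z_cyc[symmetric] using cyc_values_closed ring_hom_closed[OF phi_hom] by blast

text \<open>Closure under products is transported along \<open>phi\<close> from the cyclotomic side
  instead of being computed in the prime fields.\<close>

lemma cring_finite_mzv_alg: "cring finite_mzv_alg"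
  unfolding finite_mzv_alg_def prime_alg_def
proof (rule FQ.cring_rat_span[OF zeta_A_closed])
  show "\<one>\<^bsub>F.quot\<^esub> \<in> rat_span (rat_alg F.quot) {zeta_A ks |ks. is_index ks}"
    unfolding phi_cyc_span[symmetric] ring_hom_one[OF phi_hom, symmetric] by (rule imageI[OF one_cyc_span])
  fix x y assume "x \<in> {zeta_A ks |ks. is_index ks}" "y \<in> {zeta_A ks |ks. is_index ks}"
  then obtain u v where uv: "is_index u" "x = zeta_A u" "is_index v" "y = zeta_A v" by blast
  have "x \<otimes>\<^bsub>F.quot\<^esub> y = phi \<zeta> (Z_cyc \<zeta> u \<otimes>\<^bsub>D.quot\<^esub> Z_cyc \<zeta> v)"
    unfolding uv phi_Z_cyc[symmetric]
    using uv cyc_values_closed by (intro ring_hom_mult[OF phi_hom, symmetric]) auto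
  then show "x \<otimes>\<^bsub>F.quot\<^esub> y \<in> rat_span (rat_alg F.quot) {zeta_A ks |ks. is_index ks}"
    unfolding phi_cyc_span[symmetric] using Z_cyc_mult[OF uv(1,3)] by blast
qed

lemma phi_A_surj: "phi_A \<zeta> ` carrier (cyc_mzv_alg \<zeta>) = carrier finite_mzv_alg"
  unfolding phi_A_def image_restrict_eq carrier_cyc_mzv_alg phi_cyc_span by (simp add: finite_mzv_alg_def prime_alg_def)

lemma phi_A_hom: "phi_A \<zeta> \<in> rat_alg_hom (cyc_mzv_alg \<zeta>) finite_mzv_alg"
proof -
  have eq: "phi_A \<zeta> x = phi \<zeta> x" if "x \<in> cyc_span" for x
    using that by (simp add: phi_A_def carrier_cyc_mzv_alg)
  interpret C: cring "cyc_mzv_alg \<zeta>" by (rule cring_cyc_mzv_alg)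
  note closed = C.m_closed C.a_closed smult_cyc_mzv_alg
  have simps: "x \<otimes>\<^bsub>finite_mzv_alg\<^esub> y = x \<otimes>\<^bsub>F.quot\<^esub> y" "x \<oplus>\<^bsub>finite_mzv_alg\<^esub> y = x \<oplus>\<^bsub>F.quot\<^esub> y"
    "\<one>\<^bsub>finite_mzv_alg\<^esub> = \<one>\<^bsub>F.quot\<^esub>" "c \<odot>\<^bsub>finite_mzv_alg\<^esub> x = FQ.rat_emb c \<otimes>\<^bsub>F.quot\<^esub> x" for x y c
    by (simp_all add: finite_mzv_alg_def prime_alg_def FQ.smult_rat_alg)
  have "phi_A \<zeta> \<in> ring_hom (cyc_mzv_alg \<zeta>) finite_mzv_alg"
  proof (rule ring_hom_memI)
    show "phi_A \<zeta> x \<in> carrier finite_mzv_alg" if "x \<in> carrier (cyc_mzv_alg \<zeta>)" for x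
      unfolding phi_A_surj[symmetric] using that by (rule imageI)
  next
    fix x y assume "x \<in> carrier (cyc_mzv_alg \<zeta>)" "y \<in> carrier (cyc_mzv_alg \<zeta>)"
    then show "phi_A \<zeta> (x \<otimes>\<^bsub>cyc_mzv_alg \<zeta>\<^esub> y) = phi_A \<zeta> x \<otimes>\<^bsub>finite_mzv_alg\<^esub> phi_A \<zeta> y"
      "phi_A \<zeta> (x \<oplus>\<^bsub>cyc_mzv_alg \<zeta>\<^esub> y) = phi_A \<zeta> x \<oplus>\<^bsub>finite_mzv_alg\<^esub> phi_A \<zeta> y"
      using closed(1,2)[of x y] cyc_span_closed ring_hom_mult[OF phi_hom, of x y] ring_hom_add[OF phi_hom, of x y]
      by (simp_all add: carrier_cyc_mzv_alg eq simps subset_iff)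
  next
    show "phi_A \<zeta> \<one>\<^bsub>cyc_mzv_alg \<zeta>\<^esub> = \<one>\<^bsub>finite_mzv_alg\<^esub>"
      using one_cyc_span ring_hom_one[OF phi_hom] by (simp add: eq simps)
  qed
  moreover have "phi_A \<zeta> (c \<odot>\<^bsub>cyc_mzv_alg \<zeta>\<^esub> x) = c \<odot>\<^bsub>finite_mzv_alg\<^esub> phi_A \<zeta> x" if "x \<in> carrier (cyc_mzv_alg \<zeta>)" for c x
    using closed(3)[OF that, of c] that cyc_span_closed ring_hom_mult[OF phi_hom, of "DQ.rat_emb c" x]
      ring_hom_rat_emb[OF D.rat_ring_quot F.rat_ring_quot phi_hom]
    by (simp add: carrier_cyc_mzv_alg eq simps subset_iff)
  ultimately show ?thesis by (simp add: rat_alg_hom_def)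
qed

end

section \<open>The quotient of the algebra of multiple zeta values\<close>

lemma mzv_alg_simps [simp]:
  "carrier mzv_alg = mzv_span" "x \<otimes>\<^bsub>mzv_alg\<^esub> y = x * y" "x \<oplus>\<^bsub>mzv_alg\<^esub> y = x + y"
  "\<one>\<^bsub>mzv_alg\<^esub> = 1" "\<zero>\<^bsub>mzv_alg\<^esub> = 0"
  by (simp_all add: mzv_alg_def mzv_span_def Let_def)

lemma cring_mzv_alg: "cring mzv_alg"
  unfolding mzv_alg_def Let_def
proof (rule rat_ring.cring_rat_span[OF rat_ring_real(1)])
  show "\<one>\<^bsub>ring_of_type_algebra\<^esub> \<in> real_span {mzv ks |ks. admissible ks}"
    using one_in_mzv_span by (simp add: mzv_span_def)
  fix x y assume "x \<in> {mzv ks |ks. admissible ks}" "y \<in> {mzv ks |ks. admissible ks}"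
  then show "x \<otimes>\<^bsub>ring_of_type_algebra\<^esub> y \<in> real_span {mzv ks |ks. admissible ks}"
    using mzv_span_mult[of x y] mzv_in_span by (auto simp: mzv_span_def)
qed auto

lemma ideal_zeta2: "ideal zeta2_ideal mzv_alg"
  unfolding zeta2_ideal_def
  by (rule cring.cgenideal_ideal[OF cring_mzv_alg]) (simp add: mzv_in_span admissible_def)

abbreviation mzv_quot :: "real set ring" where
  "mzv_quot \<equiv> mzv_alg Quot zeta2_ideal"

abbreviation mzv_coset :: "real \<Rightarrow> real set" where
  "mzv_coset x \<equiv> zeta2_ideal +>\<^bsub>mzv_alg\<^esub> x"

lemma cring_mzv_quot: "cring mzv_quot"
  by (rule ideal.quotient_is_cring[OF ideal_zeta2 cring_mzv_alg])

lemma mzv_coset_hom: "mzv_coset \<in> ring_hom mzv_alg mzv_quot"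
  by (rule ideal.rcos_ring_hom[OF ideal_zeta2])

lemma mzv_quot_int: "[n] \<cdot>\<^bsub>mzv_quot\<^esub> \<one>\<^bsub>mzv_quot\<^esub> = mzv_coset (of_int n)" for n :: int
proof -
  have ring: "ring mzv_alg" "ring mzv_quot" using cring_mzv_alg cring_mzv_quot by (simp_all add: cring_def)
  have "id \<in> ring_hom mzv_alg ring_of_type_algebra" by (rule ring_hom_memI) auto
  then have "[n] \<cdot>\<^bsub>mzv_alg\<^esub> (1::real) = of_int n"
    using ring_hom_int[OF ring(1) ring_from_type_algebra, of id n] by (simp add: int_ring_of_type_algebra)
  then show ?thesis using ring_hom_int[OF ring mzv_coset_hom, of n] by simp
qed

lemma of_rat_in_mzv_span: "of_rat c \<in> mzv_span"
  using real_span_scale[of 1 _ c] one_in_mzv_span by (simp add: mzv_span_def)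

lemma mzv_coset_mult: "x \<in> mzv_span \<Longrightarrow> y \<in> mzv_span \<Longrightarrow> mzv_coset (x * y) = mzv_coset x \<otimes>\<^bsub>mzv_quot\<^esub> mzv_coset y"
  using ring_hom_mult[OF mzv_coset_hom, of x y] by simp

lemma mzv_coset_closed: "x \<in> mzv_span \<Longrightarrow> mzv_coset x \<in> carrier mzv_quot"
  using ring_hom_closed[OF mzv_coset_hom, of x] by simp

lemma mzv_coset_rat:
  assumes "of_rat c * of_int b = (of_int a :: real)"
  shows "mzv_coset (of_rat c) \<otimes>\<^bsub>mzv_quot\<^esub> [b] \<cdot>\<^bsub>mzv_quot\<^esub> \<one>\<^bsub>mzv_quot\<^esub> = [a] \<cdot>\<^bsub>mzv_quot\<^esub> \<one>\<^bsub>mzv_quot\<^esub>"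
  using of_rat_in_mzv_span[of "of_int b"] of_rat_in_mzv_span[of c] mzv_coset_mult[of "of_rat c" "of_int b"] assms
  by (simp add: mzv_quot_int)

lemma rat_ring_mzv_quot: "rat_ring mzv_quot"
  unfolding rat_ring_def rat_ring_axioms_def
proof (intro conjI cring_mzv_quot allI impI)
  interpret cring mzv_quot by (rule cring_mzv_quot)
  fix n :: int assume "0 < n"
  then have "of_rat (1 / of_int n) * of_int n = (of_int 1 :: real)" by (simp add: of_rat_divide)
  from mzv_coset_rat[OF this]
  show "\<exists>y\<in>carrier mzv_quot. [n] \<cdot>\<^bsub>mzv_quot\<^esub> \<one>\<^bsub>mzv_quot\<^esub> \<otimes>\<^bsub>mzv_quot\<^esub> y = \<one>\<^bsub>mzv_quot\<^esub>"
    using mzv_coset_closed[OF of_rat_in_mzv_span]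
    by (intro bexI[of _ "mzv_coset (of_rat (1 / of_int n))"]) (auto simp: m_comm)
qed

lemma mzv_quot_rat_emb: "rat_ring.rat_emb mzv_quot c = mzv_coset (of_rat c)"
proof -
  obtain a b where q: "quotient_of c = (a, b)" by force
  then have ab: "0 < b" "c * of_int b = of_int a"
    using quotient_of_denom_pos[OF q] quotient_of_div[OF q] by auto
  from arg_cong[OF ab(2), of "of_rat :: rat \<Rightarrow> real"] have "of_rat c * of_int b = (of_int a :: real)"
    by (simp add: of_rat_mult)
  then show ?thesis
    by (intro rat_ring.rat_emb_unique[OF rat_ring_mzv_quot ab] mzv_coset_closed of_rat_in_mzv_span mzv_coset_rat)
qed

lemma cring_mzv_mod_zeta2: "cring mzv_mod_zeta2"
  unfolding mzv_mod_zeta2_def by (rule cring_rat_alg[OF cring_mzv_quot])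

lemma zeta_S_in_mzv_span: "is_index ks \<Longrightarrow> zeta_S ks \<in> mzv_span"
  using symm_val_in_span by (simp add: zeta_S_eq symm_span_eq)

context root_family
begin

text \<open>Each class in the target is that of a rational combination of symmetric values, by
  \<open>symm_span_eq\<close>, and each symmetric value modulo the ideal is the image of some
  \<open>Z_cyc \<zeta> ks\<close>.\<close>

lemma phi_S_surj:
  assumes hom: "phi_S \<in> rat_alg_hom (cyc_mzv_alg \<zeta>) mzv_mod_zeta2"
    and values_S: "\<And>ks. is_index ks \<Longrightarrow> phi_S (Z_cyc \<zeta> ks) = zeta_S_mod ks"
  shows "phi_S ` carrier (cyc_mzv_alg \<zeta>) = carrier mzv_mod_zeta2"
proof -
  have phi_S: "phi_S \<in> ring_hom (cyc_mzv_alg \<zeta>) mzv_mod_zeta2"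
    and phi_S_smult: "\<And>c x. x \<in> carrier (cyc_mzv_alg \<zeta>) \<Longrightarrow> phi_S (c \<odot>\<^bsub>cyc_mzv_alg \<zeta>\<^esub> x) = c \<odot>\<^bsub>mzv_mod_zeta2\<^esub> phi_S x"
    using hom by (auto simp: rat_alg_hom_def)
  interpret C: cring "cyc_mzv_alg \<zeta>" by (rule cring_cyc_mzv_alg)
  interpret M: cring mzv_mod_zeta2 by (rule cring_mzv_mod_zeta2)
  interpret S: ring_hom_ring "cyc_mzv_alg \<zeta>" mzv_mod_zeta2 phi_S
    by (rule ring_hom_ringI2[OF C.ring_axioms M.ring_axioms phi_S])
  have M_simps: "x \<oplus>\<^bsub>mzv_mod_zeta2\<^esub> y = x \<oplus>\<^bsub>mzv_quot\<^esub> y" "\<zero>\<^bsub>mzv_mod_zeta2\<^esub> = \<zero>\<^bsub>mzv_quot\<^esub>"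
    "c \<odot>\<^bsub>mzv_mod_zeta2\<^esub> x = mzv_coset (of_rat c) \<otimes>\<^bsub>mzv_quot\<^esub> x" for x y c
    by (simp_all add: mzv_mod_zeta2_def rat_ring.smult_rat_alg[OF rat_ring_mzv_quot] mzv_quot_rat_emb)
  have image: "mzv_coset x \<in> phi_S ` carrier (cyc_mzv_alg \<zeta>)" if "x \<in> symm_span" for x
  proof -
    have sub: "{symm_val ks | ks. is_index ks} \<subseteq> carrier ring_of_type_algebra" by simp
    have incl: "real_span {symm_val ks | ks. is_index ks} = mzv_span" using symm_span_eq by (simp add: symm_span_def)
    from sub that[unfolded symm_span_def] show ?thesis
    proof (induction x rule: rat_ring.rat_span_induct[OF rat_ring_real(1), consumes 2, case_names zero smult add])
      case zero
      have "mzv_coset 0 = phi_S \<zero>\<^bsub>cyc_mzv_alg \<zeta>\<^esub>"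
        using ring_hom_zero[OF mzv_coset_hom] cring_mzv_alg cring_mzv_quot S.hom_zero by (simp add: cring_def M_simps)
      then show ?case using imageI[OF C.zero_closed, of phi_S] by simp
    next
      case (smult c x)
      then obtain ks where ks: "is_index ks" "x = symm_val ks" by blast
      have Z: "Z_cyc \<zeta> ks \<in> carrier (cyc_mzv_alg \<zeta>)"
        unfolding carrier_cyc_mzv_alg using ks by (intro DQ.rat_span_incl cyc_values_closed) auto
      have "mzv_coset (of_rat c * x) = phi_S (c \<odot>\<^bsub>cyc_mzv_alg \<zeta>\<^esub> Z_cyc \<zeta> ks)"
        unfolding phi_S_smult[OF Z] values_S[OF ks(1)] zeta_S_mod_def M_simps
        using ks zeta_S_in_mzv_span[OF ks(1)] mzv_coset_mult[OF of_rat_in_mzv_span, of x c] by (simp add: zeta_S_eq)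
      then show ?case using smult_cyc_mzv_alg[OF Z, of c] by (auto simp: rat_ring_real(2) simp del: cyc_mzv_alg_simps)
    next
      case (add x y)
      then obtain u v where u: "u \<in> carrier (cyc_mzv_alg \<zeta>)" "mzv_coset x = phi_S u"
          and v: "v \<in> carrier (cyc_mzv_alg \<zeta>)" "mzv_coset y = phi_S v" by blast
      have "mzv_coset (x + y) = phi_S (u \<oplus>\<^bsub>cyc_mzv_alg \<zeta>\<^esub> v)"
        using ring_hom_add[OF mzv_coset_hom, of x y] add(1,2) S.hom_add[OF u(1) v(1)]
        by (simp add: incl M_simps u(2) v(2) del: cyc_mzv_alg_simps)
      then show ?case using C.a_closed[OF u(1) v(1)] by (auto simp del: cyc_mzv_alg_simps)
    qed
  qed
  show ?thesis
  proof
    show "carrier mzv_mod_zeta2 \<subseteq> phi_S ` carrier (cyc_mzv_alg \<zeta>)"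
    proof
      fix y assume "y \<in> carrier mzv_mod_zeta2"
      then obtain x where "x \<in> mzv_span" "y = mzv_coset x"
        by (auto simp: mzv_mod_zeta2_def FactRing_def A_RCOSETS_def')
      then show "y \<in> phi_S ` carrier (cyc_mzv_alg \<zeta>)" using image by (simp add: symm_span_eq)
    qed
  qed (use S.hom_closed in auto)
qed

end

theorem theorem3p12:
  fixes \<zeta> :: "nat \<Rightarrow> complex"
    and phi_S :: "(nat \<Rightarrow> complex set) set \<Rightarrow> real set"
  assumes root: "\<And>p. Factorial_Ring.prime p \<Longrightarrow> primitive_root_of_unity p (\<zeta> p)"
    and hom: "phi_S \<in> rat_alg_hom (cyc_mzv_alg \<zeta>) mzv_mod_zeta2"
    and values_S: "\<And>ks. is_index ks \<Longrightarrow> phi_S (Z_cyc \<zeta> ks) = zeta_S_mod ks"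
    and kernels: "a_kernel (cyc_mzv_alg \<zeta>) mzv_mod_zeta2 phi_S
                    = a_kernel (cyc_mzv_alg \<zeta>) finite_mzv_alg (phi_A \<zeta>)"
  shows "\<exists>phi_KZ \<in> rat_alg_iso finite_mzv_alg mzv_mod_zeta2.
           \<forall>ks. is_index ks \<longrightarrow> phi_KZ (zeta_A ks) = zeta_S_mod ks"
proof -
  interpret root_family \<zeta> by (rule root_family.intro) (rule root)
  note rings = cring_cyc_mzv_alg cring_finite_mzv_alg cring_mzv_mod_zeta2
  obtain k where k: "k \<in> rat_alg_iso finite_mzv_alg mzv_mod_zeta2"
      "\<And>x. x \<in> carrier (cyc_mzv_alg \<zeta>) \<Longrightarrow> k (phi_A \<zeta> x) = phi_S x"
    using rat_alg_iso_of_kernels_eq[OF rings[unfolded cring_def, THEN conjunct1] smult_cyc_mzv_alg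
        phi_A_hom phi_A_surj hom phi_S_surj[OF hom values_S] kernels] by blast
  have "k (zeta_A ks) = zeta_S_mod ks" if ks: "is_index ks" for ks
  proof -
    have Z: "Z_cyc \<zeta> ks \<in> carrier (cyc_mzv_alg \<zeta>)"
      unfolding carrier_cyc_mzv_alg using ks by (intro DQ.rat_span_incl cyc_values_closed) auto
    then show ?thesis using k(2)[OF Z] phi_Z_cyc[of ks] by (simp add: phi_A_def values_S[OF ks])
  qed
  then show ?thesis using k(1) by blast
qed

end
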